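(* Let $X_k=\sum_{i=0}^{\infty}a_i\varepsilon_{k-i}$ be the linear process described in the context. Assume $\sup_x[f_\varepsilon(x)+|f_\varepsilon'(x)|]<\infty$, $\inf_{p_0\le p\le p_1}f(\xi_p)>0$ for some $0<p_0<p_1<1$, and $\sup_x|f_\varepsilon''(x)|<\infty$. In addition, assume that there exist $\alpha>0$ and $q\ge2$ such that $\mathbb{E}(|\varepsilon_k|^\alpha)<\infty$ and $$\sum_{i=1}^\infty|a_i|^{\min(\alpha/q,1)}<\infty.$$ Then (i) $\displaystyle\sup_{p_0\le p\le p_1}|\xi_{n,p}-\xi_p|=o_{\mathrm{a.s.}}[\iota_q(n)/\sqrt n]$, and (ii) the uniform Bahadur representation holds: $$\sup_{p_0\le p\le p_1}\left|\xi_{n,p}-\xi_p-\frac{p-F_n(\xi_p)}{f(\xi_p)}\right|=O_{\mathrm{a.s.}}\bigl[n^{-3/4}(\iota_q(n)\log n)^{1/2}\bigr].$$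
   Context: $(\varepsilon_k)_{k\in\mathbb{Z}}$ are i.i.d. real random variables with distribution function $F_\varepsilon$ and (twice differentiable) density $f_\varepsilon$; $(a_i)_{i\ge0}$ are real coefficients with $a_0=1$ such that $X_k=\sum_{i=0}^\infty a_i\varepsilon_{k-i}$ exists almost surely. $F$ and $f$ are the distribution function and density of $X_k$; $\xi_p=\inf\{x:F(x)\ge p\}$. Given $X_1,\dots,X_n$, $F_n(x)=\frac1n\sum_{i=1}^n\mathbf 1_{X_i\le x}$ and $\xi_{n,p}=\inf\{x:F_n(x)\ge p\}$. Define $\iota_q(n)=(\log n)^{1/q}(\log\log n)^{2/q}$ if $q>2$ and $\iota_2(n)=(\log n)^{3/2}(\log\log n)$. A sequence of random variables $Z_n$ is $O_{\mathrm{a.s.}}(r_n)$ if $Z_n/r_n$ is almost surely bounded, and $o_{\mathrm{a.s.}}(r_n)$ if $Z_n/r_n\to0$ almost surely. *)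

theory Defs
  imports "HOL-Probability.Probability"
begin

definition linear_process ::
    "(nat \<Rightarrow> real) \<Rightarrow> (int \<Rightarrow> 'a \<Rightarrow> real) \<Rightarrow> int \<Rightarrow> 'a \<Rightarrow> real" where
  "linear_process a \<epsilon> k \<omega> = (\<Sum>i. a i * \<epsilon> (k - int i) \<omega>)"

definition empirical_cdf :: "(int \<Rightarrow> 'a \<Rightarrow> real) \<Rightarrow> nat \<Rightarrow> 'a \<Rightarrow> real \<Rightarrow> real" where
  "empirical_cdf X n \<omega> x = (\<Sum>i = 1..n. if X (int i) \<omega> \<le> x then 1 else 0) / real n"

definition quantile :: "(real \<Rightarrow> real) \<Rightarrow> real \<Rightarrow> real" where
  "quantile G p = Inf {x. p \<le> G x}"

text \<open>A density is determined only almost everywhere, but here it is evaluated at single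
  points.  The version meant is the derivative of the distribution function; the lemma below
  shows that this is the continuous density whenever there is one.\<close>

definition pdf_of :: "'a measure \<Rightarrow> ('a \<Rightarrow> real) \<Rightarrow> real \<Rightarrow> real" where
  "pdf_of M Y = deriv (cdf (distr M borel Y))"

lemma pdf_of_eq_continuous_density:
  assumes "prob_space M"
    and dist: "distributed M lborel Y (\<lambda>x. ennreal (g x))"
    and nonneg: "\<And>x. 0 \<le> g x"
    and cont: "continuous_on UNIV g"
  shows "(cdf (distr M borel Y) has_real_derivative g x) (at x)"
    and "pdf_of M Y x = g x"
proof -
  interpret prob_space M by fact
  have Y [measurable]: "Y \<in> borel_measurable M"
    using distributed_measurable[OF dist] by simp
  have g [measurable]: "g \<in> borel_measurable borel"
    using cont by (rule borel_measurable_continuous_onI)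
  interpret D: real_distribution "distr M borel Y"
    by (rule real_distribution_distr) simp
  define c where "c = x - 1"
  have diff: "cdf (distr M borel Y) y - cdf (distr M borel Y) c = integral {c..y} g"
    if "c \<le> y" for y
  proof (cases "c = y")
    case False
    then have "c < y" using that by simp
    have int: "set_integrable lborel {c..y} g"
      by (rule borel_integrable_atLeastAtMost') (rule continuous_on_subset[OF cont], simp)
    have sub: "AE z in lborel. z \<noteq> c" by (rule AE_lborel_singleton)
    have "emeasure (distr M borel Y) {c<..y} = emeasure (density lborel (\<lambda>x. ennreal (g x))) {c<..y}"
      using distributed_distr_eq_density[OF dist]
      by (metis distr_cong sets_lborel)
    also have "\<dots> = (\<integral>\<^sup>+z. ennreal (g z) * indicator {c<..y} z \<partial>lborel)"
      by (subst emeasure_density) auto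
    also have "\<dots> = (\<integral>\<^sup>+z. ennreal (indicator {c..y} z *\<^sub>R g z) \<partial>lborel)"
      by (rule nn_integral_cong_AE)
        (use sub in \<open>eventually_elim, auto simp: indicator_def\<close>)
    also have "\<dots> = ennreal (set_lebesgue_integral lborel {c..y} g)"
      unfolding set_lebesgue_integral_def
      by (rule nn_integral_eq_integral)
        (use int nonneg in \<open>auto simp: set_integrable_def\<close>)
    finally have "emeasure (distr M borel Y) {c<..y} =
      ennreal (set_lebesgue_integral lborel {c..y} g)" .
    then have "measure (distr M borel Y) {c<..y} = set_lebesgue_integral lborel {c..y} g"
      unfolding measure_def
      by (simp add: set_lebesgue_integral_def nonneg)
    then show ?thesis
      using D.cdf_diff_eq[OF \<open>c < y\<close>] set_borel_integral_eq_integral(2)[OF int] by simp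
  qed simp
  have "((\<lambda>y. integral {c..y} g) has_real_derivative g x) (at x within {c..x + 1})"
    by (rule integral_has_real_derivative[OF continuous_on_subset[OF cont]])
      (auto simp: c_def)
  moreover have "at x within {c..x + 1} = at x"
    by (rule at_within_interior) (auto simp: c_def)
  ultimately have "((\<lambda>y. integral {c..y} g) has_real_derivative g x) (at x)"
    by simp
  then have "((\<lambda>y. cdf (distr M borel Y) c + integral {c..y} g) has_real_derivative g x) (at x)"
    by (auto intro!: derivative_eq_intros)
  then show *: "(cdf (distr M borel Y) has_real_derivative g x) (at x)"
  proof (rule has_field_derivative_transform_within_open[where S = "{c<..}"])
    fix y assume "y \<in> {c<..}"
    then show "cdf (distr M borel Y) c + integral {c..y} g = cdf (distr M borel Y) y"
      using diff[of y] by simp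
  qed (auto simp: c_def)
  show "pdf_of M Y x = g x"
    unfolding pdf_of_def using * by (rule DERIV_imp_deriv)
qed

definition iota_rate :: "real \<Rightarrow> nat \<Rightarrow> real" where
  "iota_rate q n =
    (if q = 2 then ln (real n) powr (3/2) * ln (ln (real n))
     else ln (real n) powr (1/q) * ln (ln (real n)) powr (2/q))"

text \<open>The quotients below are total because division by zero yields zero.  The finitely many
  small \<open>n\<close> for which an iterated logarithm is undefined or nonpositive therefore affect
  neither definition.\<close>

definition big_O_as :: "'a measure \<Rightarrow> (nat \<Rightarrow> 'a \<Rightarrow> real) \<Rightarrow> (nat \<Rightarrow> real) \<Rightarrow> bool" where
  "big_O_as M Z r \<longleftrightarrow> (AE \<omega> in M. Bseq (\<lambda>n. Z n \<omega> / r n))"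

definition small_o_as :: "'a measure \<Rightarrow> (nat \<Rightarrow> 'a \<Rightarrow> real) \<Rightarrow> (nat \<Rightarrow> real) \<Rightarrow> bool" where
  "small_o_as M Z r \<longleftrightarrow> (AE \<omega> in M. (\<lambda>n. Z n \<omega> / r n) \<longlonglongrightarrow> 0)"

end

theory Submission
  imports Defs "HOL-Real_Asymp.Real_Asymp"
begin

text \<open>Write \<open>X\<^sub>k = \<epsilon>\<^sub>k + Y\<^sub>k\<close> with \<open>Y\<^sub>k\<close> determined by the past, and split the centred
  empirical distribution function at the conditional one, \<open>F\<^sub>\<epsilon> (x - Y\<^sub>k)\<close>.

  The remaining smooth part, and its derivative in \<open>x\<close>, are sums of \<open>g (x - Y\<^sub>k) - E g (x - Y\<^sub>k)\<close> with \<open>g\<close>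
  bounded and Lipschitz.  Integrating out one noise variable after the other writes such a sum as a series
  of martingales; the \<open>i\<close>-th has increments of conditional \<open>L\<^sup>q\<close> norm at most a constant times
  \<open>\<bar>a\<^sub>i\<bar>\<close> to the power \<open>min (\<alpha> / q) 1\<close>, so the \<open>q\<close>-th moment of a sum of \<open>n\<close> terms is
  \<open>O(n\<close> to the \<open>q / 2)\<close>.  Dyadic chaining, first in \<open>x\<close> and then in \<open>n\<close>, turns this into an almost sure
  uniform rate; the exponent \<open>q = 2\<close> is critical for the chaining in \<open>n\<close>, which explains the two
  forms of the rate.

  The martingale part has bounded increments whose conditional variance over an interval is at most
  proportional to its length.  Hence the same chaining applies with the exponent \<open>q + 1\<close>, and an
  exponential inequality on a grid controls its oscillation over distances
  \<open>iota_rate q n / sqrt n\<close>, which is what the Bahadur remainder requires.\<close>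

subsection \<open>Moment inequalities and dyadic chaining\<close>

text \<open>The noise may have only a small fractional moment, so no expansion in powers of the
  noise is available. A bounded Lipschitz function, however, changes by at most a constant times
  \<open>min 1 \<bar>b i * e\<bar>\<close> when its argument moves by \<open>b i * e\<close>, and
  the q-th power of this is at most \<open>\<bar>b i * e\<bar> powr min \<alpha> q\<close>. The q-th
  root of that moment is what the summability condition sums. Conditional expectations are not
  formed abstractly: each increment is a function of the past and of one fresh noise value, and
  conditioning means integrating that value out. Suprema over x and maxima over n enter only through
  explicit dominating sums, so their measurability never arises. The Bahadur remainder compares two
  scales. Over a distance r = iota / sqrt n the martingale part, divided by n, moves by the order of
  sqrt (r * ln n / n), which is the claimed rate. The smooth part and the Taylor error of the
  distribution function move by the order of r^2, which is smaller because iota is bounded by powers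
  of logarithms.\<close>

lemma powr_ge_tangent:
  fixes y q :: real
  assumes "1 \<le> q" "0 \<le> y"
  shows "1 + q * (y - 1) \<le> y powr q"
proof (cases "q = 1")
  case False
  then have q: "q > 1" using assms by simp
  \<comment> \<open>Young's inequality with second factor 1 is Bernoulli's inequality for real
    exponents, and it covers y = 0 as well.\<close>
  have "y * 1 \<le> y powr q / q + 1 powr (q / (q - 1)) / (q / (q - 1))"
    by (rule Youngs_inequality) (use q assms in \<open>auto simp: field_simps\<close>)
  then have "q * y \<le> q * (y powr q / q + (q - 1) / q)"
    using q by (intro mult_left_mono) auto
  also have "\<dots> = y powr q + (q - 1)" using q by (simp add: distrib_left)
  finally show ?thesis by (simp add: algebra_simps)
qed (use assms in auto)

text \<open>Hoelder's inequality with free weights, or Jensen for the probabilities proportional to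
  \<open>\<theta>\<close>. Used pointwise it replaces the triangle inequality in
  \<open>L\<^sup>q\<close>: its right side is linear in the q-th powers, so expectations can be
  taken term by term.\<close>

lemma sum_powr_le_weighted:
  fixes y \<theta> :: "'i \<Rightarrow> real" and q :: real
  assumes fin: "finite I" and q: "1 \<le> q"
    and \<theta>: "\<And>i. i \<in> I \<Longrightarrow> 0 < \<theta> i" and y: "\<And>i. i \<in> I \<Longrightarrow> 0 \<le> y i"
  shows "(\<Sum>i\<in>I. y i) powr q \<le> (\<Sum>i\<in>I. \<theta> i) powr (q - 1) * (\<Sum>i\<in>I. \<theta> i powr (1 - q) * y i powr q)"
proof (cases "(\<Sum>i\<in>I. y i) = 0")
  case True
  then show ?thesis by (auto intro!: sum_nonneg mult_nonneg_nonneg)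
next
  case False
  define Y where "Y = (\<Sum>i\<in>I. y i)"
  define T where "T = (\<Sum>i\<in>I. \<theta> i)"
  have Y: "Y > 0" using False y unfolding Y_def by (metis order_le_less sum_nonneg)
  have ne: "I \<noteq> {}" using False by auto
  have T: "T > 0" unfolding T_def using fin ne \<theta> by (rule sum_pos)
  \<comment> \<open>Tangents at the ratios \<open>y i * T / (\<theta> i * Y)\<close>, whose mean
    with weights \<open>\<theta> i / T\<close> is 1. The linear terms therefore cancel and T
    remains.\<close>
  have "T = (\<Sum>i\<in>I. \<theta> i * (1 + q * (y i * T / (\<theta> i * Y) - 1)))"
  proof -
    have "(\<Sum>i\<in>I. \<theta> i * (1 + q * (y i * T / (\<theta> i * Y) - 1))) = (\<Sum>i\<in>I. (1 - q) * \<theta> i + q * T / Y * y i)"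
    proof (rule sum.cong)
      fix i assume "i \<in> I"
      then have "\<theta> i \<noteq> 0" using \<theta>[of i] by simp
      then show "\<theta> i * (1 + q * (y i * T / (\<theta> i * Y) - 1)) = (1 - q) * \<theta> i + q * T / Y * y i"
        using Y by (simp add: field_simps)
    qed simp
    also have "\<dots> = (1 - q) * T + q * T / Y * Y"
      by (simp add: sum.distrib sum_distrib_left T_def Y_def)
    finally show ?thesis using Y by (simp add: field_simps)
  qed
  also have "\<dots> \<le> (\<Sum>i\<in>I. \<theta> i * (y i * T / (\<theta> i * Y)) powr q)"
    by (intro sum_mono mult_left_mono powr_ge_tangent q) (use \<theta> y Y T in \<open>auto simp: less_imp_le\<close>)
  also have "\<dots> = (\<Sum>i\<in>I. (T / Y) powr q * (\<theta> i powr (1 - q) * y i powr q))"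
  proof (rule sum.cong)
    fix i assume i: "i \<in> I"
    have "y i * T / (\<theta> i * Y) = (T / Y) * y i / \<theta> i" by (simp add: mult.commute)
    then have "(y i * T / (\<theta> i * Y)) powr q = (T / Y) powr q * y i powr q / \<theta> i powr q"
      using T Y y[OF i] \<theta>[OF i] by (simp only: powr_divide powr_mult divide_nonneg_pos mult_nonneg_nonneg less_imp_le)
    then show "\<theta> i * (y i * T / (\<theta> i * Y)) powr q = (T / Y) powr q * (\<theta> i powr (1 - q) * y i powr q)"
      using \<theta>[OF i] by (simp add: powr_diff)
  qed simp
  finally have *: "T \<le> (T / Y) powr q * (\<Sum>i\<in>I. \<theta> i powr (1 - q) * y i powr q)"
    by (simp add: sum_distrib_left)
  have "Y powr q = (Y powr q / T) * T" using T by simp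
  also have "\<dots> \<le> (Y powr q / T) * ((T / Y) powr q * (\<Sum>i\<in>I. \<theta> i powr (1 - q) * y i powr q))"
    by (rule mult_left_mono[OF *]) (use T in auto)
  also have "\<dots> = T powr (q - 1) * (\<Sum>i\<in>I. \<theta> i powr (1 - q) * y i powr q)"
    using T Y by (simp add: powr_divide powr_diff)
  finally show ?thesis by (simp add: Y_def T_def)
qed

text \<open>Jensen, by integrating the tangent inequality for \<open>m\<close> divided by its mean.
  The bound B provides integrability.\<close>

lemma (in prob_space) integral_powr_le:
  fixes m :: "'a \<Rightarrow> real" and q :: real
  assumes q: "1 \<le> q" and [measurable]: "m \<in> borel_measurable M"
    and m: "\<And>x. 0 \<le> m x" "\<And>x. m x \<le> B"
  shows "(\<integral>x. m x \<partial>M) powr q \<le> (\<integral>x. m x powr q \<partial>M)"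
proof (cases "(\<integral>x. m x \<partial>M) = 0")
  case False
  define t where "t = (\<integral>x. m x \<partial>M)"
  have "t \<ge> 0" unfolding t_def by (rule Bochner_Integration.integral_nonneg) (rule m)
  then have t: "t > 0" using False unfolding t_def by simp
  have int: "integrable M m"
    by (rule integrable_const_bound[where B = B]) (use m in auto)
  have intq: "integrable M (\<lambda>x. m x powr q)"
    by (rule integrable_const_bound[where B = "B powr q"])
       (use m q in \<open>auto intro!: powr_mono2\<close>)
  have "1 = (\<integral>x. 1 + q * (m x / t - 1) \<partial>M)"
    using int t by (simp add: prob_space t_def[symmetric])
  also have "\<dots> \<le> (\<integral>x. m x powr q / t powr q \<partial>M)"
  proof (rule integral_mono)
    show "1 + q * (m x / t - 1) \<le> m x powr q / t powr q" for x
      using powr_ge_tangent[OF q, of "m x / t"] m t by (simp add: powr_divide)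
  qed (use int intq in auto)
  finally show ?thesis using t unfolding t_def by (simp add: field_simps)
qed (use m in \<open>auto intro!: integral_nonneg\<close>)

text \<open>One summand for each estimate in \<open>abs_add_powr_le\<close>: the first two bound the
  left side and the linear term when d dominates, the third bounds the Taylor remainder when s
  dominates.\<close>

definition taylor_const :: "real \<Rightarrow> real" where
  "taylor_const q = 3 powr q + q * 2 powr q + q\<^sup>2 * 2 powr q"

lemma taylor_const_nonneg: "2 \<le> q \<Longrightarrow> 0 \<le> taylor_const q"
  by (simp add: taylor_const_def)

text \<open>The linear term is kept exactly because it integrates to zero when d is a martingale
  increment. The rest is split at |d| = |s| / 2: Taylor expansion below, comparison with a multiple
  of |d| above.\<close>

lemma abs_add_powr_le:
  fixes s d q :: real
  assumes q: "2 \<le> q"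
  shows "\<bar>s + d\<bar> powr q \<le> \<bar>s\<bar> powr q + q * \<bar>s\<bar> powr (q - 1) * sgn s * d
    + taylor_const q * (\<bar>s\<bar> powr (q - 2) * d\<^sup>2 + \<bar>d\<bar> powr q)"
proof (cases "\<bar>d\<bar> \<le> \<bar>s\<bar> / 2 \<and> s \<noteq> 0")
  case True
  have pos: "(s + d) powr q \<le> s powr q + q * s powr (q - 1) * d + taylor_const q * (s powr (q - 2) * d\<^sup>2)"
    if s: "s > 0" and d: "\<bar>d\<bar> \<le> s / 2" for s d :: real
  proof (cases "d = 0")
    case False
    define df :: "nat \<Rightarrow> real \<Rightarrow> real" where
      "df n = (if n = 0 then (\<lambda>x. x powr q) else if n = 1 then (\<lambda>x. q * x powr (q - 1))
        else (\<lambda>x. q * (q - 1) * x powr (q - 2)))" for n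
    have "\<exists>t. (if s + d < s then s + d < t \<and> t < s else s < t \<and> t < s + d) \<and>
       (s + d) powr q = (\<Sum>m<2. df m s / fact m * (s + d - s) ^ m) + df 2 t / fact 2 * (s + d - s) ^ 2"
    \<comment> \<open>The interval stays away from 0, so the powers are differentiable, and its
      right end bounds the intermediate point by 2 * s.\<close>
    proof (rule Taylor[where a = "s / 2" and b = "2 * s"])
      show "\<forall>m t. m < 2 \<and> s / 2 \<le> t \<and> t \<le> 2 * s \<longrightarrow> DERIV (df m) t :> df (Suc m) t"
      proof (intro allI impI)
        fix m :: nat and t :: real assume A: "m < 2 \<and> s / 2 \<le> t \<and> t \<le> 2 * s"
        then have t: "t > 0" using s by linarith
        have "m = 0 \<or> m = 1" using A by auto
        then show "DERIV (df m) t :> df (Suc m) t"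
          using t by (auto simp: df_def intro!: derivative_eq_intros)
      qed
    qed (use s d False in \<open>auto simp: df_def\<close>)
    then obtain t where t: "(if s + d < s then s + d < t \<and> t < s else s < t \<and> t < s + d)"
      and eq: "(s + d) powr q = (\<Sum>m<2. df m s / fact m * (s + d - s) ^ m) + df 2 t / fact 2 * (s + d - s) ^ 2"
      by blast
    have t': "0 < t" "t \<le> 2 * s" using t s d by (auto split: if_splits)
    have "t powr (q - 2) \<le> (2 * s) powr (q - 2)" using t' q by (intro powr_mono2) auto
    also have "\<dots> = 2 powr (q - 2) * s powr (q - 2)" using s by (simp add: powr_mult)
    also have "\<dots> \<le> 2 powr q * s powr (q - 2)" by (intro mult_right_mono) auto
    finally have tb: "t powr (q - 2) \<le> 2 powr q * s powr (q - 2)" .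
    have "df 2 t / fact 2 * d\<^sup>2 = (q * (q - 1) / 2) * t powr (q - 2) * d\<^sup>2" by (simp add: df_def)
    also have "\<dots> \<le> q\<^sup>2 * (2 powr q * s powr (q - 2)) * d\<^sup>2"
    proof (intro mult_mono tb order_refl)
      have "0 \<le> q * q" by simp
      then show "q * (q - 1) / 2 \<le> q\<^sup>2" using q by (simp add: power2_eq_square algebra_simps)
    qed (use q in auto)
    also have "\<dots> = (q\<^sup>2 * 2 powr q) * (s powr (q - 2) * d\<^sup>2)" by simp
    also have "\<dots> \<le> taylor_const q * (s powr (q - 2) * d\<^sup>2)"
      by (rule mult_right_mono) (use q in \<open>auto simp: taylor_const_def\<close>)
    finally show ?thesis using eq by (simp add: df_def numeral_2_eq_2)
  qed simp
  have K: "0 \<le> taylor_const q * \<bar>d\<bar> powr q" using taylor_const_nonneg[OF q] by simp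
  show ?thesis
  proof (cases "s > 0")
    case True
    have "\<bar>d\<bar> \<le> s / 2" using True \<open>\<bar>d\<bar> \<le> \<bar>s\<bar> / 2 \<and> s \<noteq> 0\<close> by auto
    moreover have "\<bar>s + d\<bar> = s + d" using calculation True by linarith
    ultimately show ?thesis using pos[of s d] True K by (simp add: algebra_simps)
  next
    case False
    then have "- s > 0" "\<bar>- d\<bar> \<le> - s / 2" using True by auto
    moreover have "\<bar>s + d\<bar> = - s + - d" using calculation by linarith
    ultimately show ?thesis using pos[of "- s" "- d"] K by (simp add: algebra_simps)
  qed
next
  case False
  then have s: "\<bar>s\<bar> \<le> 2 * \<bar>d\<bar>" by auto
  have "\<bar>s + d\<bar> powr q \<le> (3 * \<bar>d\<bar>) powr q" using s q by (intro powr_mono2) auto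
  also have "\<dots> = 3 powr q * \<bar>d\<bar> powr q" by (simp add: powr_mult)
  finally have 1: "\<bar>s + d\<bar> powr q \<le> 3 powr q * \<bar>d\<bar> powr q" .
  have 2: "- (q * \<bar>s\<bar> powr (q - 1) * sgn s * d) \<le> q * 2 powr q * \<bar>d\<bar> powr q"
  proof (cases "d = 0")
    case False
    have "- (q * \<bar>s\<bar> powr (q - 1) * sgn s * d) \<le> \<bar>q * \<bar>s\<bar> powr (q - 1) * sgn s * d\<bar>" by linarith
    also have "\<dots> \<le> q * \<bar>s\<bar> powr (q - 1) * 1 * \<bar>d\<bar>"
      unfolding abs_mult by (intro mult_mono) (use q in \<open>auto simp: abs_sgn_eq\<close>)
    also have "\<dots> \<le> q * (2 * \<bar>d\<bar>) powr (q - 1) * \<bar>d\<bar>"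
      unfolding mult_1_right
      by (rule mult_right_mono, rule mult_left_mono, rule powr_mono2) (use s q in auto)
    also have "\<dots> = q * 2 powr (q - 1) * \<bar>d\<bar> powr q"
      using False by (simp add: powr_mult powr_diff)
    also have "\<dots> \<le> q * 2 powr q * \<bar>d\<bar> powr q"
      using q by (intro mult_mono) auto
    finally show ?thesis .
  qed simp
  have "(3 powr q + q * 2 powr q) * \<bar>d\<bar> powr q \<le> taylor_const q * (\<bar>s\<bar> powr (q - 2) * d\<^sup>2 + \<bar>d\<bar> powr q)"
    using q by (intro mult_mono) (auto simp: taylor_const_def)
  moreover have "0 \<le> \<bar>s\<bar> powr q" by simp
  ultimately show ?thesis using 1 2 unfolding distrib_right by linarith
qed

text \<open>With \<open>t\<close> the final scale of a martingale, this absorbs the mixed moments in its moment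
  recursion, where one would otherwise use the inequalities of Hoelder and Young.\<close>

lemma powr_le_add_powr:
  fixes s t q r :: real
  assumes "0 < t" "0 \<le> s" "0 \<le> r" "r \<le> q"
  shows "s powr r \<le> t powr r * (1 + s powr q / t powr q)"
proof (cases "s \<le> t")
  case True
  then have "s powr r \<le> t powr r * 1" using assms by (simp add: powr_mono2)
  also have "\<dots> \<le> t powr r * (1 + s powr q / t powr q)" by (rule mult_left_mono) auto
  finally show ?thesis .
next
  case False
  have "(s / t) powr r \<le> (s / t) powr q" using False assms by (intro powr_mono) auto
  then have "s powr r / t powr r \<le> s powr q / t powr q" using assms by (simp add: powr_divide)
  then have "s powr r \<le> t powr r * (s powr q / t powr q)" using assms by (simp add: field_simps)
  also have "\<dots> \<le> t powr r * (1 + s powr q / t powr q)" by (rule mult_left_mono) auto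
  finally show ?thesis .
qed

text \<open>Replacing j by the even number 2 * (j div 2) costs at most one increment of the finest
  level; the even indices form a sequence of smaller depth.\<close>

lemma dyadic_chain:
  fixes s :: "nat \<Rightarrow> real" and y :: "nat \<Rightarrow> real"
  assumes "\<And>l i. l \<le> L \<Longrightarrow> i < 2 ^ l \<Longrightarrow> \<bar>s (Suc i * 2 ^ (L - l)) - s (i * 2 ^ (L - l))\<bar> \<le> y l"
    and "j \<le> 2 ^ L"
  shows "\<bar>s j - s 0\<bar> \<le> (\<Sum>l\<le>L. y l)"
  using assms
proof (induction L arbitrary: s j)
  case 0
  then have "j = 0 \<or> j = 1" by auto
  moreover have "\<bar>s 1 - s 0\<bar> \<le> y 0" using 0(1)[of 0 0] by simp
  ultimately show ?case by auto
next
  case (Suc L)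
  define k where "k = j div 2"
  have k: "k \<le> 2 ^ L" using Suc.prems(2) by (simp add: k_def)
  have "\<bar>s (2 * k) - s (2 * 0)\<bar> \<le> (\<Sum>l\<le>L. y l)"
  proof (rule Suc.IH[of "\<lambda>i. s (2 * i)"])
    fix l i :: nat assume "l \<le> L" "i < 2 ^ l"
    then have "\<bar>s (Suc i * 2 ^ (Suc L - l)) - s (i * 2 ^ (Suc L - l))\<bar> \<le> y l"
      by (intro Suc.prems(1)) auto
    moreover have "2 ^ (Suc L - l) = (2::nat) * 2 ^ (L - l)" using \<open>l \<le> L\<close> by (simp add: Suc_diff_le)
    ultimately show "\<bar>s (2 * (Suc i * 2 ^ (L - l))) - s (2 * (i * 2 ^ (L - l)))\<bar> \<le> y l"
      by (simp add: mult.left_commute)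
  qed (rule k)
  moreover have "\<bar>s j - s (2 * k)\<bar> \<le> y (Suc L)"
  proof (cases "even j")
    case True
    have "\<bar>s (Suc 0 * 2 ^ (Suc L - Suc L)) - s (0 * 2 ^ (Suc L - Suc L))\<bar> \<le> y (Suc L)"
      by (rule Suc.prems(1)) auto
    then have "0 \<le> y (Suc L)" by linarith
    then show ?thesis using True by (simp add: k_def)
  next
    case False
    then have j: "j = Suc (2 * k)" by (simp add: k_def odd_two_times_div_two_succ)
    have "2 * k < 2 ^ Suc L" using Suc.prems(2) j by auto
    then have "\<bar>s (Suc (2 * k) * 2 ^ (Suc L - Suc L)) - s ((2 * k) * 2 ^ (Suc L - Suc L))\<bar> \<le> y (Suc L)"
      by (rule Suc.prems(1)[OF order_refl])
    then show ?thesis using j by simp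
  qed
  ultimately show ?case by simp
qed

text \<open>The largest increment of a level is bounded by the \<open>q\<close>-th power sum of all of them, so that
  expectations can be taken term by term.\<close>

lemma dyadic_chain_powr:
  fixes s :: "nat \<Rightarrow> real" and \<theta> :: "nat \<Rightarrow> real"
  assumes q: "1 \<le> q" and \<theta>: "\<And>l. 0 < \<theta> l" and j: "j \<le> 2 ^ L"
  shows "\<bar>s j - s 0\<bar> powr q \<le> (\<Sum>l\<le>L. \<theta> l) powr (q - 1) *
    (\<Sum>l\<le>L. \<theta> l powr (1 - q) * (\<Sum>i<2 ^ l. \<bar>s (Suc i * 2 ^ (L - l)) - s (i * 2 ^ (L - l))\<bar> powr q))"
proof -
  define y where "y l = (\<Sum>i<2 ^ l. \<bar>s (Suc i * 2 ^ (L - l)) - s (i * 2 ^ (L - l))\<bar> powr q) powr (1 / q)" for l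
  have "\<bar>s j - s 0\<bar> \<le> (\<Sum>l\<le>L. y l)"
  proof (rule dyadic_chain[OF _ j])
    fix l i :: nat assume "i < 2 ^ l"
    define D where "D = \<bar>s (Suc i * 2 ^ (L - l)) - s (i * 2 ^ (L - l))\<bar>"
    have "D = (D powr q) powr (1 / q)" using q by (simp add: powr_powr D_def)
    also have "\<dots> \<le> y l" unfolding y_def D_def
      by (intro powr_mono2 member_le_sum) (use \<open>i < 2 ^ l\<close> q in auto)
    finally show "\<bar>s (Suc i * 2 ^ (L - l)) - s (i * 2 ^ (L - l))\<bar> \<le> y l" by (simp add: D_def)
  qed
  then have "\<bar>s j - s 0\<bar> powr q \<le> (\<Sum>l\<le>L. y l) powr q" using q by (intro powr_mono2) auto
  also have "\<dots> \<le> (\<Sum>l\<le>L. \<theta> l) powr (q - 1) * (\<Sum>l\<le>L. \<theta> l powr (1 - q) * y l powr q)"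
    by (intro sum_powr_le_weighted q \<theta>) (auto simp: y_def)
  also have "(\<lambda>l. y l powr q) = (\<lambda>l. \<Sum>i<2 ^ l. \<bar>s (Suc i * 2 ^ (L - l)) - s (i * 2 ^ (L - l))\<bar> powr q)"
    using q by (auto simp: y_def powr_powr sum_nonneg)
  finally show ?thesis .
qed

subsection \<open>Martingale moments for independent noise\<close>

locale iid_noise = prob_space M for M :: "'a measure" +
  fixes \<epsilon> :: "int \<Rightarrow> 'a \<Rightarrow> real" and \<mu> :: "real measure"
  assumes indep: "indep_vars (\<lambda>_. borel) \<epsilon> UNIV"
    and distr_eps: "\<And>k. distr M borel (\<epsilon> k) = \<mu>"
begin

lemma eps_measurable [measurable]: "\<epsilon> k \<in> borel_measurable M"
  using indep unfolding indep_vars_def by auto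

lemma sets_mu [measurable_cong, simp]: "sets \<mu> = sets borel"
  unfolding distr_eps[of 0, symmetric] by simp

lemma space_mu [simp]: "space \<mu> = UNIV"
  unfolding distr_eps[of 0, symmetric] by simp

sublocale mu: prob_space \<mu>
  unfolding distr_eps[of 0, symmetric] by (rule prob_space_distr) measurable

lemma prob_mu_UNIV [simp]: "measure \<mu> UNIV = 1"
  using mu.prob_space by simp

text \<open>The noise strictly before time k. Generating it by the coordinate map on
  \<open>{..<k}\<close> lets independence of disjoint index blocks apply directly, and as a measure
  space it turns predictability into plain measurability.\<close>

definition past :: "int \<Rightarrow> 'a measure" where
  "past k = vimage_algebra (space M) (\<lambda>\<omega>. restrict (\<lambda>j. \<epsilon> j \<omega>) {..<k}) (PiM {..<k} (\<lambda>_. borel))"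

lemma space_past [simp]: "space (past k) = space M"
  by (simp add: past_def)

lemma restrict_measurable_past:
  "(\<lambda>\<omega>. restrict (\<lambda>j. \<epsilon> j \<omega>) {..<k}) \<in> measurable (past k) (PiM {..<k} (\<lambda>_. borel))"
  unfolding past_def by (rule measurable_vimage_algebra1) (auto simp: space_PiM)

lemma eps_measurable_past:
  assumes "j < k"
  shows "\<epsilon> j \<in> borel_measurable (past k)"
proof -
  have "(\<lambda>\<omega>. restrict (\<lambda>j. \<epsilon> j \<omega>) {..<k} j) \<in> borel_measurable (past k)"
    by (rule measurable_compose[OF restrict_measurable_past measurable_component_singleton])
       (use assms in auto)
  then show ?thesis using assms by simp
qed

lemma sets_past_subset: "sets (past k) \<subseteq> sets M"
  unfolding past_def by (rule sets_image_in_sets) (auto intro!: measurable_restrict)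

lemma sets_past_mono: "k \<le> l \<Longrightarrow> sets (past k) \<subseteq> sets (past l)"
  unfolding past_def[of k]
  by (rule sets_image_in_sets) (auto intro!: measurable_restrict eps_measurable_past)

lemma measurable_past_mono: "f \<in> measurable (past k) N \<Longrightarrow> k \<le> l \<Longrightarrow> f \<in> measurable (past l) N"
  using sets_past_mono[of k l] by (auto simp: measurable_def)

lemma measurable_pastD: "f \<in> measurable (past k) N \<Longrightarrow> f \<in> measurable M N"
  using sets_past_subset[of k] by (auto simp: measurable_def)

lemma ident_measurable_past: "k \<le> l \<Longrightarrow> (\<lambda>\<omega>. \<omega>) \<in> measurable (past l) (past k)"
  using measurable_past_mono[OF measurable_ident] by (auto simp: id_def)

lemma ident_measurable_M_past: "(\<lambda>\<omega>. \<omega>) \<in> measurable M (past k)"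
  using measurable_pastD[OF measurable_ident] by (auto simp: id_def)

text \<open>The index blocks \<open>{..<k}\<close> and \<open>{k}\<close> are disjoint, hence
  independent. This is the case of rectangles, which determines the joint law.\<close>

lemma prob_past_eps:
  assumes A: "A \<in> sets (past k)" and B: "B \<in> sets borel"
  shows "prob (A \<inter> \<epsilon> k -` B) = prob A * measure \<mu> B"
proof -
  let ?P = "\<lambda>\<omega>. restrict (\<lambda>j. \<epsilon> j \<omega>) {..<k}"
  let ?R = "\<lambda>\<omega>. restrict (\<lambda>j. \<epsilon> j \<omega>) {k}"
  obtain A' where A': "A' \<in> sets (PiM {..<k} (\<lambda>_. borel))" "A = ?P -` A' \<inter> space M"
    using A sets_vimage_algebra2[of ?P "space M" "PiM {..<k} (\<lambda>_. borel :: real measure)"]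
    by (auto simp: past_def space_PiM)
  define B' where "B' = (\<lambda>z. z k) -` B \<inter> space (PiM {k} (\<lambda>_::int. borel :: real measure))"
  have B': "B' \<in> sets (PiM {k} (\<lambda>_. borel))"
    unfolding B'_def by (intro measurable_sets[OF _ B] measurable_component_singleton) simp
  have R: "?R -` B' \<inter> space M = \<epsilon> k -` B \<inter> space M"
    by (auto simp: B'_def space_PiM)
  have "indep_var (PiM {..<k} (\<lambda>_. borel)) ?P (PiM {k} (\<lambda>_. borel)) ?R"
    by (rule indep_var_restrict[OF indep]) auto
  then have "prob ((\<lambda>\<omega>. (?P \<omega>, ?R \<omega>)) -` (A' \<times> B') \<inter> space M)
      = prob (?P -` A' \<inter> space M) * prob (?R -` B' \<inter> space M)"
    by (rule indep_varD) (fact A'(1) B')+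
  then have "prob ((\<lambda>\<omega>. (?P \<omega>, ?R \<omega>)) -` (A' \<times> B') \<inter> space M) = prob A * prob (\<epsilon> k -` B \<inter> space M)"
    by (simp only: A'(2) R)
  also have "(\<lambda>\<omega>. (?P \<omega>, ?R \<omega>)) -` (A' \<times> B') \<inter> space M = A \<inter> \<epsilon> k -` B"
    using R A'(2) by blast
  also have "prob (\<epsilon> k -` B \<inter> space M) = measure \<mu> B"
    unfolding distr_eps[of k, symmetric] using B by (simp add: measure_distr)
  finally show ?thesis .
qed

text \<open>The only way independence is used: given the past, \<open>\<epsilon> k\<close> is integrated out against \<open>\<mu>\<close>.\<close>

lemma integral_past:
  fixes \<phi> :: "'a \<Rightarrow> real \<Rightarrow> real"
  assumes \<phi> [measurable]: "(\<lambda>(\<omega>, e). \<phi> \<omega> e) \<in> borel_measurable (past k \<Otimes>\<^sub>M borel)"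
    and B: "\<And>\<omega> e. \<bar>\<phi> \<omega> e\<bar> \<le> B"
  shows "(\<integral>\<omega>. \<phi> \<omega> (\<epsilon> k \<omega>) \<partial>M) = (\<integral>\<omega>. (\<integral>e. \<phi> \<omega> e \<partial>\<mu>) \<partial>M)"
    and "(\<lambda>\<omega>. \<integral>e. \<phi> \<omega> e \<partial>\<mu>) \<in> borel_measurable (past k)"
proof -
  note [measurable] = ident_measurable_M_past
  define P where "P = distr M (past k) (\<lambda>\<omega>. \<omega>)"
  interpret P: prob_space P unfolding P_def by (rule prob_space_distr) measurable
  interpret PP: pair_prob_space P \<mu> ..
  \<comment> \<open>The joint law of the past and the fresh noise is a product measure, by
    comparison on rectangles; Fubini then gives the claim.\<close>
  have eq: "P \<Otimes>\<^sub>M \<mu> = distr M (past k \<Otimes>\<^sub>M borel) (\<lambda>x. (x, \<epsilon> k x))"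
  proof (rule pair_measure_eqI)
    fix A B assume A: "A \<in> sets P" and B: "B \<in> sets \<mu>"
    have A': "A \<in> sets (past k)" "A \<in> sets M" using A sets_past_subset by (auto simp: P_def)
    have AM: "A \<subseteq> space M" using A'(2) by (rule sets.sets_into_space)
    have "emeasure P A * emeasure \<mu> B = ennreal (prob A * measure \<mu> B)"
      using A' AM unfolding P_def
      by (simp add: emeasure_distr Int_absorb2 emeasure_eq_measure mu.emeasure_eq_measure ennreal_mult')
    also have "\<dots> = ennreal (prob (A \<inter> \<epsilon> k -` B))"
      using prob_past_eps[OF A'(1), of B] B by simp
    also have "A \<inter> \<epsilon> k -` B = (\<lambda>x. (x, \<epsilon> k x)) -` (A \<times> B) \<inter> space M"
      using AM by auto
    finally show "emeasure P A * emeasure \<mu> B = emeasure (distr M (past k \<Otimes>\<^sub>M borel) (\<lambda>x. (x, \<epsilon> k x))) (A \<times> B)"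
      using A' B by (simp add: emeasure_distr emeasure_eq_measure)
  next
    show "sets (P \<Otimes>\<^sub>M \<mu>) = sets (distr M (past k \<Otimes>\<^sub>M borel) (\<lambda>x. (x, \<epsilon> k x)))"
      unfolding sets_distr by (rule sets_pair_measure_cong) (simp_all add: P_def)
  qed (rule P.sigma_finite_measure_axioms mu.sigma_finite_measure_axioms)+
  have meas: "(\<lambda>(\<omega>, e). \<phi> \<omega> e) \<in> borel_measurable (P \<Otimes>\<^sub>M \<mu>)"
    unfolding eq by simp
  have int: "integrable (P \<Otimes>\<^sub>M \<mu>) (\<lambda>(\<omega>, e). \<phi> \<omega> e)"
    by (rule PP.P.integrable_const_bound[where B = B]) (use B meas in auto)
  have m: "(\<lambda>\<omega>. \<integral>e. \<phi> \<omega> e \<partial>\<mu>) \<in> borel_measurable P"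
    by (rule mu.borel_measurable_lebesgue_integral[OF meas])
  then show m': "(\<lambda>\<omega>. \<integral>e. \<phi> \<omega> e \<partial>\<mu>) \<in> borel_measurable (past k)"
    unfolding P_def by simp
  have "(\<integral>\<omega>. \<phi> \<omega> (\<epsilon> k \<omega>) \<partial>M) = integral\<^sup>L (P \<Otimes>\<^sub>M \<mu>) (\<lambda>(\<omega>, e). \<phi> \<omega> e)"
    unfolding eq by (subst integral_distr) auto
  also have "\<dots> = (\<integral>\<omega>. (\<integral>e. \<phi> \<omega> e \<partial>\<mu>) \<partial>P)"
    using PP.integral_fst'[OF int] by simp
  also have "\<dots> = (\<integral>\<omega>. (\<integral>e. \<phi> \<omega> e \<partial>\<mu>) \<partial>M)"
    unfolding P_def by (rule integral_distr) (auto intro: m' ident_measurable_M_past)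
  finally show "(\<integral>\<omega>. \<phi> \<omega> (\<epsilon> k \<omega>) \<partial>M) = (\<integral>\<omega>. (\<integral>e. \<phi> \<omega> e \<partial>\<mu>) \<partial>M)" .
qed

lemma eval_measurable_past:
  assumes "(\<lambda>(\<omega>, e). \<phi> \<omega> e) \<in> borel_measurable (past k \<Otimes>\<^sub>M borel)" "k < l"
  shows "(\<lambda>\<omega>. \<phi> \<omega> (\<epsilon> k \<omega>) :: real) \<in> borel_measurable (past l)"
proof -
  have "(\<lambda>\<omega>. (\<omega>, \<epsilon> k \<omega>)) \<in> measurable (past l) (past k \<Otimes>\<^sub>M borel)"
    using assms(2) by (intro measurable_Pair ident_measurable_past eps_measurable_past less_imp_le)
  from measurable_compose[OF this assms(1)] show ?thesis by simp
qed

lemma section_measurable: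
  assumes "(\<lambda>(\<omega>, e). \<phi> \<omega> e) \<in> borel_measurable (past k \<Otimes>\<^sub>M borel)" "\<omega> \<in> space M"
  shows "\<phi> \<omega> \<in> borel_measurable \<mu>"
  using measurable_compose_Pair1[of \<omega> "past k" "\<lambda>(\<omega>, e). \<phi> \<omega> e" borel borel] assms
  by (simp cong: measurable_cong_sets)

text \<open>With K = \<open>taylor_const q\<close>, the exponential bounds the growth (1 + K / n)^n
  of the moment recursion, and the other factor is the cost of its additive term.\<close>

definition moment_const :: "real \<Rightarrow> real" where
  "moment_const q = exp (taylor_const q) * taylor_const q"

lemma moment_const_nonneg: "2 \<le> q \<Longrightarrow> 0 \<le> moment_const q"
  by (simp add: moment_const_def taylor_const_nonneg)

section \<open>Sums of martingale increments with deterministic conditional moment bounds\<close>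

context
  fixes \<psi> :: "nat \<Rightarrow> 'a \<Rightarrow> real \<Rightarrow> real" and t0 :: int and B v :: real
  assumes \<psi>: "\<And>j. (\<lambda>(\<omega>, e). \<psi> j \<omega> e) \<in> borel_measurable (past (t0 + int j) \<Otimes>\<^sub>M borel)"
    and B: "\<And>j \<omega> e. \<bar>\<psi> j \<omega> e\<bar> \<le> B"
    and mean: "\<And>j \<omega>. (\<integral>e. \<psi> j \<omega> e \<partial>\<mu>) = 0"
    and var: "\<And>j \<omega>. (\<integral>e. (\<psi> j \<omega> e)\<^sup>2 \<partial>\<mu>) \<le> v"
begin

lemma partial_sum_measurable:
  "(\<lambda>\<omega>. \<Sum>i<j. \<psi> i \<omega> (\<epsilon> (t0 + int i) \<omega>)) \<in> borel_measurable (past (t0 + int j))"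
  by (intro borel_measurable_sum eval_measurable_past[OF \<psi>]) auto

lemma partial_sum_bound: "\<bar>\<Sum>i<j. \<psi> i \<omega> (\<epsilon> (t0 + int i) \<omega>)\<bar> \<le> real j * B"
proof -
  have "\<bar>\<Sum>i<j. \<psi> i \<omega> (\<epsilon> (t0 + int i) \<omega>)\<bar> \<le> (\<Sum>i<j. B)"
    by (intro order_trans[OF sum_abs] sum_mono B)
  then show ?thesis by simp
qed

lemma step_measurable:
  assumes [measurable]: "g \<in> borel_measurable borel"
  shows "(\<lambda>(\<omega>, e). g ((\<Sum>i<j. \<psi> i \<omega> (\<epsilon> (t0 + int i) \<omega>)) + \<psi> j \<omega> e) :: real)
    \<in> borel_measurable (past (t0 + int j) \<Otimes>\<^sub>M borel)"
proof -
  note [measurable] = partial_sum_measurable[of j] \<psi>[of j, unfolded split_beta']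
  show ?thesis by (simp add: split_beta')
qed

text \<open>A Rosenthal type inequality. Because the bounds on the conditional moments are
  deterministic, a recursion for the q-th moments of the partial sums is enough: the linear term
  vanishes and the quadratic one is spread evenly over the n steps.\<close>

lemma martingale_moment:
  assumes q: "2 \<le> q" and v: "0 < v"
    and mom: "\<And>j \<omega>. (\<integral>e. \<bar>\<psi> j \<omega> e\<bar> powr q \<partial>\<mu>) \<le> w"
  shows "(\<integral>\<omega>. \<bar>\<Sum>j<n. \<psi> j \<omega> (\<epsilon> (t0 + int j) \<omega>)\<bar> powr q \<partial>M)
    \<le> moment_const q * ((real n * v) powr (q / 2) + real n * w)"
proof (cases "n = 0")
  case False
  define K where "K = taylor_const q"
  have K: "K \<ge> 0" using q unfolding K_def by (rule taylor_const_nonneg)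
  define S where "S j \<omega> = (\<Sum>i<j. \<psi> i \<omega> (\<epsilon> (t0 + int i) \<omega>))" for j \<omega>
  define u where "u j = (\<integral>\<omega>. \<bar>S j \<omega>\<bar> powr q \<partial>M)" for j
  \<comment> \<open>The expected size of the final sum. As \<tau>^2 = n * v, the mixed term |S|^(q -
    2) * v is at most (\<tau>^q + |S|^q) / n, so a step multiplies the moment by no more than 1 + K
    / n.\<close>
  define \<tau> where "\<tau> = sqrt (real n * v)"
  have n: "real n > 0" using False by simp
  have \<tau>: "\<tau> > 0" using n v by (simp add: \<tau>_def)
  have B0: "B \<ge> 0" using B[of 0 undefined 0] by linarith
  have w: "w \<ge> 0" using mom[of 0 undefined] by (rule order_trans[rotated]) simp
  have S [measurable]: "S j \<in> borel_measurable M" for j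
    unfolding S_def by (rule measurable_pastD[OF partial_sum_measurable])
  have Sb: "\<bar>S j \<omega>\<bar> \<le> real j * B" for j \<omega> unfolding S_def by (rule partial_sum_bound)
  have Sq: "integrable M (\<lambda>\<omega>. \<bar>S j \<omega>\<bar> powr r)" if "r \<ge> 0" for j r
    by (rule integrable_const_bound[where B = "(real j * B) powr r"])
       (use Sb that in \<open>auto intro!: powr_mono2\<close>)
  have inner: "(\<integral>e. \<bar>S j \<omega> + \<psi> j \<omega> e\<bar> powr q \<partial>\<mu>)
      \<le> (1 + K / real n) * \<bar>S j \<omega>\<bar> powr q + K * (\<tau> powr q / real n + w)" if \<omega>: "\<omega> \<in> space M" for j \<omega>
  proof -
    note [measurable] = section_measurable[OF \<psi> \<omega>, of j]
    have i1: "integrable \<mu> (\<psi> j \<omega>)"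
      by (rule mu.integrable_const_bound[where B = B]) (use B in auto)
    have i2: "integrable \<mu> (\<lambda>e. (\<psi> j \<omega> e)\<^sup>2)"
      by (rule mu.integrable_const_bound[where B = "B\<^sup>2"])
         (use B B0 in \<open>auto simp: power2_le_iff_abs_le\<close>)
    have i3: "integrable \<mu> (\<lambda>e. \<bar>\<psi> j \<omega> e\<bar> powr q)"
      by (rule mu.integrable_const_bound[where B = "B powr q"])
         (use B q in \<open>auto intro!: powr_mono2\<close>)
    have i4: "integrable \<mu> (\<lambda>e. \<bar>S j \<omega> + \<psi> j \<omega> e\<bar> powr q)"
      by (rule mu.integrable_const_bound[where B = "(real j * B + B) powr q"])
         (use B Sb q in \<open>auto intro!: powr_mono2 order_trans[OF abs_triangle_ineq] add_mono\<close>)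
    have "(\<integral>e. \<bar>S j \<omega> + \<psi> j \<omega> e\<bar> powr q \<partial>\<mu>) \<le>
       (\<integral>e. \<bar>S j \<omega>\<bar> powr q + q * \<bar>S j \<omega>\<bar> powr (q - 1) * sgn (S j \<omega>) * \<psi> j \<omega> e
         + K * (\<bar>S j \<omega>\<bar> powr (q - 2) * (\<psi> j \<omega> e)\<^sup>2 + \<bar>\<psi> j \<omega> e\<bar> powr q) \<partial>\<mu>)"
      unfolding K_def by (intro integral_mono i4 abs_add_powr_le[OF q]) (use i1 i2 i3 in auto)
    also have "\<dots> = \<bar>S j \<omega>\<bar> powr q + K * (\<bar>S j \<omega>\<bar> powr (q - 2) * (\<integral>e. (\<psi> j \<omega> e)\<^sup>2 \<partial>\<mu>) + (\<integral>e. \<bar>\<psi> j \<omega> e\<bar> powr q \<partial>\<mu>))"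
      using i1 i2 i3 mean[of j \<omega>] by (simp add: mu.prob_space)
    also have "\<dots> \<le> \<bar>S j \<omega>\<bar> powr q + K * (\<bar>S j \<omega>\<bar> powr (q - 2) * v + w)"
      by (intro add_left_mono mult_left_mono add_mono var mom K) auto
    also have "\<dots> \<le> \<bar>S j \<omega>\<bar> powr q + K * (\<tau> powr (q - 2) * (1 + \<bar>S j \<omega>\<bar> powr q / \<tau> powr q) * v + w)"
      by (intro add_left_mono mult_left_mono add_right_mono mult_right_mono powr_le_add_powr \<tau> K)
         (use q v in auto)
    also have "\<tau> powr (q - 2) * (1 + \<bar>S j \<omega>\<bar> powr q / \<tau> powr q) * v = (\<tau> powr q + \<bar>S j \<omega>\<bar> powr q) / real n"
    proof -
      have "\<tau> powr 2 = real n * v" using n v \<tau> by (simp add: \<tau>_def)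
      then have "\<tau> powr (q - 2) = \<tau> powr q / (real n * v)" by (simp add: powr_diff)
      then have "\<tau> powr (q - 2) * (1 + \<bar>S j \<omega>\<bar> powr q / \<tau> powr q) * v
          = (1 / real n) * (\<tau> powr q * (1 + \<bar>S j \<omega>\<bar> powr q / \<tau> powr q))"
        using n v by simp
      also have "\<tau> powr q * (1 + \<bar>S j \<omega>\<bar> powr q / \<tau> powr q) = \<tau> powr q + \<bar>S j \<omega>\<bar> powr q"
        using \<tau> by (simp add: distrib_left)
      finally show ?thesis by simp
    qed
    also have "\<bar>S j \<omega>\<bar> powr q + K * ((\<tau> powr q + \<bar>S j \<omega>\<bar> powr q) / real n + w)
        = (1 + K / real n) * \<bar>S j \<omega>\<bar> powr q + K * (\<tau> powr q / real n + w)"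
      by (simp add: distrib_left distrib_right add_divide_distrib)
    finally show ?thesis .
  qed
  have step: "u (Suc j) \<le> (1 + K / real n) * u j + K * (\<tau> powr q / real n + w)" for j
  proof -
    have "u (Suc j) = (\<integral>\<omega>. \<bar>S j \<omega> + \<psi> j \<omega> (\<epsilon> (t0 + int j) \<omega>)\<bar> powr q \<partial>M)"
      by (simp add: u_def S_def)
    also have "\<dots> = (\<integral>\<omega>. (\<integral>e. \<bar>S j \<omega> + \<psi> j \<omega> e\<bar> powr q \<partial>\<mu>) \<partial>M)"
    proof (rule integral_past(1))
      show "(\<lambda>(\<omega>, e). \<bar>S j \<omega> + \<psi> j \<omega> e\<bar> powr q) \<in> borel_measurable (past (t0 + int j) \<Otimes>\<^sub>M borel)"
        unfolding S_def by (rule step_measurable) measurable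
      show "\<bar>\<bar>S j \<omega> + \<psi> j \<omega> e\<bar> powr q\<bar> \<le> (real j * B + B) powr q" for \<omega> e
        using B Sb q by (auto intro!: powr_mono2 order_trans[OF abs_triangle_ineq] add_mono)
    qed
    also have "\<dots> \<le> (\<integral>\<omega>. (1 + K / real n) * \<bar>S j \<omega>\<bar> powr q + K * (\<tau> powr q / real n + w) \<partial>M)"
      by (rule integral_mono') (use inner Sq[of q j] q K w in auto)
    also have "\<dots> = (1 + K / real n) * u j + K * (\<tau> powr q / real n + w)"
      using Sq[of q j] q by (simp add: u_def prob_space)
    finally show ?thesis .
  qed
  define c where "c = K * (\<tau> powr q / real n + w)"
  have c: "c \<ge> 0" using K w by (simp add: c_def)
  \<comment> \<open>Discrete Gronwall: the growth factors multiply, and each additive term is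
    charged with the full product.\<close>
  have u: "u j \<le> (1 + K / real n) ^ j * (real j * c)" for j
  proof (induction j)
    case 0
    show ?case by (simp add: u_def S_def)
  next
    case (Suc j)
    have "u (Suc j) \<le> (1 + K / real n) * u j + c" using step[of j] by (simp add: c_def)
    also have "\<dots> \<le> (1 + K / real n) * ((1 + K / real n) ^ j * (real j * c)) + (1 + K / real n) ^ Suc j * c"
    proof (intro add_mono mult_left_mono Suc.IH)
      show "c \<le> (1 + K / real n) ^ Suc j * c"
        using c K by (intro mult_le_cancel_right1[THEN iffD2]) (auto intro!: one_le_power simp del: power_Suc)
    qed (use K in auto)
    also have "\<dots> = (1 + K / real n) ^ Suc j * (real (Suc j) * c)"
      by (simp add: algebra_simps add_divide_distrib)
    finally show ?case .
  qed
  have "u n \<le> (1 + K / real n) ^ n * (real n * c)" by (rule u)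
  also have "\<dots> \<le> exp K * (real n * c)"
    using K c n by (intro mult_right_mono exp_ge_one_plus_x_over_n_power_n) auto
  also have "real n * c = K * (\<tau> powr q + real n * w)"
    using n by (simp add: c_def field_simps)
  also have "\<tau> powr q = (real n * v) powr (q / 2)"
    using n v by (simp add: \<tau>_def powr_half_sqrt[symmetric] powr_powr)
  finally show ?thesis by (simp add: u_def S_def moment_const_def K_def)
qed (use q moment_const_nonneg in auto)

text \<open>Bernstein's method. Given the past, a step multiplies the exponential moment by at most
  1 + c^2 * v because the increment has mean zero. The quadratic bound on the exponential holds for
  arguments in [-1, 1], hence the conditions on B and c.\<close>

lemma martingale_exp_moment:
  assumes B1: "B = 1" and c: "\<bar>c\<bar> \<le> 1"
  shows "(\<integral>\<omega>. exp (c * (\<Sum>j<n. \<psi> j \<omega> (\<epsilon> (t0 + int j) \<omega>))) \<partial>M) \<le> exp (real n * c\<^sup>2 * v)"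
proof (induction n)
  case 0
  show ?case by (simp add: prob_space)
next
  case (Suc j)
  define S where "S \<omega> = (\<Sum>i<j. \<psi> i \<omega> (\<epsilon> (t0 + int i) \<omega>))" for \<omega>
  have S [measurable]: "S \<in> borel_measurable M"
    unfolding S_def by (rule measurable_pastD[OF partial_sum_measurable])
  have Sb: "\<bar>S \<omega>\<bar> \<le> real j" for \<omega> using partial_sum_bound[where j=j and \<omega>=\<omega>] by (simp add: S_def B1)
  have le: "c * x \<le> \<bar>x\<bar>" for x
    using mult_right_mono[OF c, of "\<bar>x\<bar>"] by (auto simp: abs_mult[symmetric])
  have exp_le: "exp x \<le> 1 + x + x\<^sup>2" if "\<bar>x\<bar> \<le> 1" for x :: real
  proof (cases "x \<ge> 0")
    case False
    define y where "y = - x"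
    have y: "0 \<le> y" using False by (simp add: y_def)
    \<comment> \<open>For a negative argument - y, multiply by \<open>exp y\<close> instead, which
      is at least 1 + y + y^2 / 2; the product of the two polynomials is at least 1.\<close>
    have "1 \<le> (1 - y + y\<^sup>2) * (1 + y + y\<^sup>2 / 2)"
    proof -
      have "(1 - y + y\<^sup>2) * (1 + y + y\<^sup>2 / 2) = 1 + (y\<^sup>2 + y ^ 3 + y ^ 4) / 2"
        by (simp add: field_simps power2_eq_square power3_eq_cube power4_eq_xxxx)
      then show ?thesis using y by simp
    qed
    also have "\<dots> \<le> (1 - y + y\<^sup>2) * exp y"
      by (rule mult_left_mono[OF exp_lower_Taylor_quadratic])
         (use y that in \<open>auto simp: y_def\<close>)
    finally show ?thesis by (simp add: y_def exp_minus field_simps)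
  qed (use that exp_bound in auto)
  have inner: "(\<integral>e. exp (c * (S \<omega> + \<psi> j \<omega> e)) \<partial>\<mu>) \<le> exp (c * S \<omega>) * exp (c\<^sup>2 * v)"
    if \<omega>: "\<omega> \<in> space M" for \<omega>
  proof -
    note [measurable] = section_measurable[OF \<psi> \<omega>, of j]
    have i1: "integrable \<mu> (\<psi> j \<omega>)"
      by (rule mu.integrable_const_bound[where B = B]) (use B in auto)
    have i2: "integrable \<mu> (\<lambda>e. (\<psi> j \<omega> e)\<^sup>2)"
      by (rule mu.integrable_const_bound[where B = "1"])
         (use B B1 in \<open>auto simp: abs_square_le_1\<close>)
    have i3: "integrable \<mu> (\<lambda>e. exp (c * \<psi> j \<omega> e))"
      by (rule mu.integrable_const_bound[where B = "exp 1"])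
         (use B B1 in \<open>auto intro!: order_trans[OF le]\<close>)
    have "(\<integral>e. exp (c * (S \<omega> + \<psi> j \<omega> e)) \<partial>\<mu>) = exp (c * S \<omega>) * (\<integral>e. exp (c * \<psi> j \<omega> e) \<partial>\<mu>)"
      by (simp add: distrib_left exp_add)
    also have "(\<integral>e. exp (c * \<psi> j \<omega> e) \<partial>\<mu>) \<le> (\<integral>e. 1 + c * \<psi> j \<omega> e + (c * \<psi> j \<omega> e)\<^sup>2 \<partial>\<mu>)"
    proof (intro integral_mono i3 exp_le)
      show "\<bar>c * \<psi> j \<omega> e\<bar> \<le> 1" for e
        using c B[of j \<omega> e] B1 by (simp add: abs_mult mult_le_one)
    qed (use i1 i2 in \<open>auto simp: power_mult_distrib\<close>)
    also have "\<dots> = 1 + c\<^sup>2 * (\<integral>e. (\<psi> j \<omega> e)\<^sup>2 \<partial>\<mu>)"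
      using i1 i2 mean[of j \<omega>] by (simp add: mu.prob_space power_mult_distrib)
    also have "\<dots> \<le> 1 + c\<^sup>2 * v"
      by (intro add_left_mono mult_left_mono var) auto
    also have "\<dots> \<le> exp (c\<^sup>2 * v)" by (rule exp_ge_add_one_self)
    finally show ?thesis by simp
  qed
  have iS: "integrable M (\<lambda>\<omega>. exp (c * S \<omega>))"
    by (rule integrable_const_bound[where B = "exp (real j)"])
       (use Sb in \<open>auto intro!: order_trans[OF le]\<close>)
  have "(\<integral>\<omega>. exp (c * (\<Sum>i<Suc j. \<psi> i \<omega> (\<epsilon> (t0 + int i) \<omega>))) \<partial>M)
      = (\<integral>\<omega>. exp (c * (S \<omega> + \<psi> j \<omega> (\<epsilon> (t0 + int j) \<omega>))) \<partial>M)"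
    by (simp add: S_def)
  also have "\<dots> = (\<integral>\<omega>. (\<integral>e. exp (c * (S \<omega> + \<psi> j \<omega> e)) \<partial>\<mu>) \<partial>M)"
  proof (rule integral_past(1))
    show "(\<lambda>(\<omega>, e). exp (c * (S \<omega> + \<psi> j \<omega> e))) \<in> borel_measurable (past (t0 + int j) \<Otimes>\<^sub>M borel)"
      unfolding S_def by (rule step_measurable) measurable
    show "\<bar>exp (c * (S \<omega> + \<psi> j \<omega> e))\<bar> \<le> exp (real j + 1)" for \<omega> e
      using B[of j \<omega> e] Sb[of \<omega>] le[of "S \<omega> + \<psi> j \<omega> e"] B1 by simp
  qed
  also have "\<dots> \<le> (\<integral>\<omega>. exp (c * S \<omega>) * exp (c\<^sup>2 * v) \<partial>M)"
    by (rule integral_mono') (use inner iS in auto)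
  also have "\<dots> \<le> exp (real j * c\<^sup>2 * v) * exp (c\<^sup>2 * v)"
    using Suc.IH iS by (simp add: S_def)
  also have "\<dots> = exp (real (Suc j) * c\<^sup>2 * v)"
    by (simp add: algebra_simps flip: exp_add)
  finally show ?case .
qed

end

end

subsection \<open>Moments of the predictable part\<close>

text \<open>With one constant for size and slope, moving the argument by d costs at most
  \<open>2 * K * min 1 \<bar>d\<bar>\<close>, and averages of translates stay in the class with the
  same constant.\<close>

definition bdd_lip :: "real \<Rightarrow> (real \<Rightarrow> real) \<Rightarrow> bool" where
  "bdd_lip K G \<longleftrightarrow> (\<forall>t. \<bar>G t\<bar> \<le> K) \<and> (\<forall>s t. \<bar>G s - G t\<bar> \<le> K * \<bar>s - t\<bar>)"

lemma bdd_lipD: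
  assumes "bdd_lip K G"
  shows "\<bar>G t\<bar> \<le> K" "\<bar>G s - G t\<bar> \<le> K * \<bar>s - t\<bar>" "0 \<le> K"
  using assms abs_ge_zero[of "G t"] unfolding bdd_lip_def by (auto intro: order_trans)

lemma bdd_lip_measurable:
  assumes "bdd_lip K G"
  shows "G \<in> borel_measurable borel"
proof -
  have "K-lipschitz_on UNIV G"
    using bdd_lipD[OF assms] by (auto intro!: lipschitz_onI simp: dist_real_def)
  then show ?thesis
    by (intro borel_measurable_continuous_onI lipschitz_on_continuous_on)
qed

locale linear_noise = iid_noise M \<epsilon> \<mu> for M :: "'a measure" and \<epsilon> \<mu> +
  fixes b :: "nat \<Rightarrow> real" and \<alpha> q :: real
  assumes \<alpha>: "0 < \<alpha>" and q: "2 \<le> q"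
    and moment_\<alpha>: "integrable \<mu> (\<lambda>e. \<bar>e\<bar> powr \<alpha>)"
    and summable_b: "summable (\<lambda>i. \<bar>b i\<bar> powr min (\<alpha> / q) 1)"
    and summable_eps: "\<And>k. AE \<omega> in M. summable (\<lambda>i. b i * \<epsilon> (k - int i) \<omega>)"
begin

text \<open>\<open>tail k 0\<close> is the part of \<open>X (k + 1)\<close> that is determined by the past.\<close>

definition tail :: "int \<Rightarrow> nat \<Rightarrow> 'a \<Rightarrow> real" where
  "tail k i \<omega> = (\<Sum>j. b (i + j) * \<epsilon> (k - int (i + j)) \<omega>)"

lemma tail_measurable_past:
  assumes "k - int i < l"
  shows "tail k i \<in> borel_measurable (past l)"
  unfolding tail_def
  by (intro borel_measurable_suminf borel_measurable_times borel_measurable_const eps_measurable_past)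
     (use assms in auto)

lemma tail_measurable [measurable]: "tail k i \<in> borel_measurable M"
  by (rule measurable_pastD[OF tail_measurable_past[of k i "k + 1"]]) simp

text \<open>Almost sure because the recursion needs the series to converge; all i share one
  exceptional set.\<close>

lemma tail_split: "AE \<omega> in M. \<forall>i. tail k i \<omega> = b i * \<epsilon> (k - int i) \<omega> + tail k (Suc i) \<omega>"
  using summable_eps[of k]
proof eventually_elim
  case (elim \<omega>)
  show ?case
  proof
    fix i
    have "summable (\<lambda>j. b (i + j) * \<epsilon> (k - int (i + j)) \<omega>)"
      using summable_ignore_initial_segment[OF elim, of i] by (simp add: add.commute)
    from suminf_split_head[OF this]
    show "tail k i \<omega> = b i * \<epsilon> (k - int i) \<omega> + tail k (Suc i) \<omega>" by (simp add: tail_def)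
  qed
qed

lemma tail_tendsto: "AE \<omega> in M. (\<lambda>i. tail k i \<omega>) \<longlonglongrightarrow> 0"
  using summable_eps[of k]
proof eventually_elim
  case (elim \<omega>)
  have "(\<lambda>i. (\<Sum>j. b j * \<epsilon> (k - int j) \<omega>) - (\<Sum>j<i. b j * \<epsilon> (k - int j) \<omega>))
      \<longlonglongrightarrow> (\<Sum>j. b j * \<epsilon> (k - int j) \<omega>) - (\<Sum>j. b j * \<epsilon> (k - int j) \<omega>)"
    by (intro tendsto_diff tendsto_const summable_LIMSEQ elim)
  moreover have "tail k i \<omega> = (\<Sum>j. b j * \<epsilon> (k - int j) \<omega>) - (\<Sum>j<i. b j * \<epsilon> (k - int j) \<omega>)" for i
    using suminf_minus_initial_segment[OF elim, of i] by (simp add: tail_def add.commute)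
  ultimately show ?case by simp
qed

text \<open>\<open>smooth G i\<close> evaluated at \<open>tail k i\<close> is the conditional expectation of
  \<open>G (tail k 0)\<close> given the noise up to time \<open>k - i\<close>.\<close>

primrec smooth :: "(real \<Rightarrow> real) \<Rightarrow> nat \<Rightarrow> real \<Rightarrow> real" where
  "smooth G 0 = G"
| "smooth G (Suc i) = (\<lambda>t. \<integral>e. smooth G i (b i * e + t) \<partial>\<mu>)"

lemma bdd_lip_integrable:
  assumes "bdd_lip K G"
  shows "integrable \<mu> (\<lambda>e. G (c * e + t))"
proof -
  note [measurable] = bdd_lip_measurable[OF assms]
  show ?thesis
  proof (rule mu.integrable_const_bound[where B = K])
    show "AE e in \<mu>. norm (G (c * e + t)) \<le> K" using bdd_lipD(1)[OF assms] by simp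
  qed measurable
qed

lemma bdd_lip_smooth:
  assumes "bdd_lip K G"
  shows "bdd_lip K (smooth G i)"
proof (induction i)
  case (Suc i)
  have int: "integrable \<mu> (\<lambda>e. smooth G i (b i * e + t))" for t
    by (rule bdd_lip_integrable[OF Suc.IH])
  have "\<bar>smooth G (Suc i) t\<bar> \<le> K" for t
  proof -
    have "\<bar>\<integral>e. smooth G i (b i * e + t) \<partial>\<mu>\<bar> \<le> (\<integral>e. \<bar>smooth G i (b i * e + t)\<bar> \<partial>\<mu>)"
      by (rule integral_abs_bound)
    also have "\<dots> \<le> (\<integral>e. K \<partial>\<mu>)"
      by (rule integral_mono[OF integrable_abs[OF int] mu.integrable_const bdd_lipD(1)[OF Suc.IH]])
    finally show ?thesis by simp
  qed
  moreover have "\<bar>smooth G (Suc i) s - smooth G (Suc i) t\<bar> \<le> K * \<bar>s - t\<bar>" for s t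
  proof -
    have eq: "smooth G (Suc i) s - smooth G (Suc i) t
        = (\<integral>e. smooth G i (b i * e + s) - smooth G i (b i * e + t) \<partial>\<mu>)"
      unfolding smooth.simps by (rule Bochner_Integration.integral_diff[OF int int, symmetric])
    have "\<bar>smooth G (Suc i) s - smooth G (Suc i) t\<bar> \<le> (\<integral>e. \<bar>smooth G i (b i * e + s) - smooth G i (b i * e + t)\<bar> \<partial>\<mu>)"
      unfolding eq by (rule integral_abs_bound)
    also have "\<dots> \<le> (\<integral>e. K * \<bar>s - t\<bar> \<partial>\<mu>)"
    proof (rule integral_mono[OF integrable_abs[OF Bochner_Integration.integrable_diff[OF int int]] mu.integrable_const])
      show "\<bar>smooth G i (b i * e + s) - smooth G i (b i * e + t)\<bar> \<le> K * \<bar>s - t\<bar>" for e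
        using bdd_lipD(2)[OF Suc.IH, of "b i * e + s" "b i * e + t"] by simp
    qed
    finally show ?thesis by simp
  qed
  ultimately show ?case by (simp add: bdd_lip_def)
qed (use assms in simp)

lemma smooth_eval_measurable:
  assumes "bdd_lip K G"
  shows "(\<lambda>(\<omega>, e). smooth G i (b i * e + tail k (Suc i) \<omega>)) \<in> borel_measurable (past (k - int i) \<Otimes>\<^sub>M borel)"
proof -
  note [measurable] = bdd_lip_measurable[OF bdd_lip_smooth[OF assms]]
    tail_measurable_past[of k "Suc i" "k - int i", simplified]
  show ?thesis by measurable
qed

text \<open>Each step integrates out the most recent remaining noise variable, so the expectation is
  the same at every level.\<close>

lemma expectation_smooth:
  assumes G: "bdd_lip K G"
  shows "(\<integral>\<omega>. smooth G m (tail k m \<omega>) \<partial>M) = (\<integral>\<omega>. G (tail k 0 \<omega>) \<partial>M)"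
proof (induction m)
  case (Suc m)
  note [measurable] = bdd_lip_measurable[OF bdd_lip_smooth[OF G]]
  have "(\<integral>\<omega>. smooth G m (tail k m \<omega>) \<partial>M)
      = (\<integral>\<omega>. smooth G m (b m * \<epsilon> (k - int m) \<omega> + tail k (Suc m) \<omega>) \<partial>M)"
  proof (rule integral_cong_AE)
    show "AE \<omega> in M. smooth G m (tail k m \<omega>) = smooth G m (b m * \<epsilon> (k - int m) \<omega> + tail k (Suc m) \<omega>)"
      using tail_split[of k]
    proof eventually_elim
      case (elim \<omega>)
      show ?case unfolding elim[rule_format, of m, symmetric] ..
    qed
  qed measurable
  also have "\<dots> = (\<integral>\<omega>. (\<integral>e. smooth G m (b m * e + tail k (Suc m) \<omega>) \<partial>\<mu>) \<partial>M)"
    by (rule integral_past(1)[OF smooth_eval_measurable[OF G]])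
       (rule bdd_lipD(1)[OF bdd_lip_smooth[OF G]])
  finally show ?case using Suc.IH by simp
qed simp

text \<open>The tails tend to zero and all \<open>smooth G m\<close> share one Lipschitz constant,
  so the tail may be replaced by 0 in the limit.\<close>

lemma smooth_tendsto:
  assumes G: "bdd_lip K G"
  shows "(\<lambda>m. smooth G m 0) \<longlonglongrightarrow> (\<integral>\<omega>. G (tail k 0 \<omega>) \<partial>M)"
proof -
  note lip = bdd_lipD[OF bdd_lip_smooth[OF G]] and [measurable] = bdd_lip_measurable[OF bdd_lip_smooth[OF G]]
  have "(\<lambda>m. \<integral>\<omega>. smooth G m 0 - smooth G m (tail k m \<omega>) \<partial>M) \<longlonglongrightarrow> (\<integral>\<omega>. 0 \<partial>M)"
  proof (rule integral_dominated_convergence[where w = "\<lambda>_. 2 * K"])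
    show "AE \<omega> in M. (\<lambda>m. smooth G m 0 - smooth G m (tail k m \<omega>)) \<longlonglongrightarrow> 0"
      using tail_tendsto[of k]
    proof eventually_elim
      case (elim \<omega>)
      then have "(\<lambda>m. K * \<bar>0 - tail k m \<omega>\<bar>) \<longlonglongrightarrow> K * \<bar>0 - 0\<bar>" by (intro tendsto_intros)
      then have lim: "(\<lambda>m. K * \<bar>0 - tail k m \<omega>\<bar>) \<longlonglongrightarrow> 0" by simp
      show ?case
      proof (rule Lim_null_comparison[OF always_eventually lim], rule allI)
        show "norm (smooth G m 0 - smooth G m (tail k m \<omega>)) \<le> K * \<bar>0 - tail k m \<omega>\<bar>" for m
          unfolding real_norm_def by (rule lip(2))
      qed
    qed
    show "AE \<omega> in M. norm (smooth G m 0 - smooth G m (tail k m \<omega>)) \<le> 2 * K" for m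
    proof (rule AE_I2)
      fix \<omega>
      show "norm (smooth G m 0 - smooth G m (tail k m \<omega>)) \<le> 2 * K"
        using lip(1)[of m 0] lip(1)[of m "tail k m \<omega>"] unfolding real_norm_def by linarith
    qed
  qed auto
  moreover have "(\<integral>\<omega>. smooth G m 0 - smooth G m (tail k m \<omega>) \<partial>M) = smooth G m 0 - (\<integral>\<omega>. G (tail k 0 \<omega>) \<partial>M)" for m
  proof -
    have "integrable M (\<lambda>\<omega>. smooth G m (tail k m \<omega>))"
      by (rule integrable_const_bound[where B = K]) (simp_all add: lip(1))
    then show ?thesis by (simp add: prob_space expectation_smooth[OF G])
  qed
  ultimately have "(\<lambda>m. smooth G m 0 - (\<integral>\<omega>. G (tail k 0 \<omega>) \<partial>M)) \<longlonglongrightarrow> 0" by simp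
  then show ?thesis by (simp add: LIM_zero_iff)
qed

definition pred_mean :: "(real \<Rightarrow> real) \<Rightarrow> real" where
  "pred_mean G = (\<integral>\<omega>. G (tail 0 0 \<omega>) \<partial>M)"

text \<open>Stationarity of the mean: for every k the expectation is the limit of the sequence
  \<open>smooth G m 0\<close>, in which k does not occur.\<close>

lemma expectation_tail_eq: "bdd_lip K G \<Longrightarrow> (\<integral>\<omega>. G (tail k 0 \<omega>) \<partial>M) = pred_mean G"
  unfolding pred_mean_def by (rule LIMSEQ_unique[OF smooth_tendsto smooth_tendsto])

text \<open>The 1 comes from bounding lower powers of |e| by
  \<open>1 + \<bar>e\<bar> powr \<alpha>\<close>. It also makes the constant at least 1, so that it
  can be moved inside a q-th power.\<close>

definition noise_moment :: real where
  "noise_moment = 1 + (\<integral>e. \<bar>e\<bar> powr \<alpha> \<partial>\<mu>)"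

text \<open>The geometric term keeps the weights positive where \<open>b i = 0\<close>: they serve
  as Hoelder weights and are raised to the negative power 1 - q.\<close>

definition weight :: "nat \<Rightarrow> real" where
  "weight i = \<bar>b i\<bar> powr min (\<alpha> / q) 1 + (1 / 2) ^ i"

lemma noise_moment_ge: "1 \<le> noise_moment"
  by (simp add: noise_moment_def)

lemma weight_pos: "0 < weight i"
  by (simp add: weight_def add_nonneg_pos)

lemma summable_weight: "summable weight"
  unfolding weight_def by (intro summable_add summable_b summable_geometric) simp

text \<open>The source of the exponent \<beta> = min (\<alpha> / q) 1. Since \<beta> * q is at most
  q, truncation at 1 allows q to be lowered to \<beta> * q; since it is at most \<alpha>, the noise
  has a moment of that order.\<close>

lemma truncated_moment:
  "(\<integral>e. min 1 \<bar>b i * e\<bar> powr q \<partial>\<mu>) \<le> weight i powr q * noise_moment"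
proof -
  let ?\<beta> = "min (\<alpha> / q) 1"
  have \<beta>: "0 < ?\<beta> * q" "?\<beta> * q \<le> \<alpha>" "?\<beta> * q \<le> q" using \<alpha> q by (auto simp: min_def field_simps)
  have le: "min 1 \<bar>b i * e\<bar> powr q \<le> weight i powr q * (1 + \<bar>e\<bar> powr \<alpha>)" for e
  proof -
    have "min 1 \<bar>b i * e\<bar> powr q \<le> min 1 \<bar>b i * e\<bar> powr (?\<beta> * q)"
      by (rule powr_mono') (use \<beta> in auto)
    also have "\<dots> \<le> \<bar>b i * e\<bar> powr (?\<beta> * q)"
      by (rule powr_mono2) (use \<beta> in auto)
    also have "\<dots> = (\<bar>b i\<bar> powr ?\<beta>) powr q * \<bar>e\<bar> powr (?\<beta> * q)"
      by (simp add: abs_mult powr_mult powr_powr)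
    also have "\<dots> \<le> weight i powr q * (1 + \<bar>e\<bar> powr \<alpha>)"
    proof (rule mult_mono)
      show "(\<bar>b i\<bar> powr ?\<beta>) powr q \<le> weight i powr q"
        by (rule powr_mono2) (use q in \<open>auto simp: weight_def\<close>)
      show "\<bar>e\<bar> powr (?\<beta> * q) \<le> 1 + \<bar>e\<bar> powr \<alpha>"
        using powr_le_add_powr[of 1 "\<bar>e\<bar>" "?\<beta> * q" \<alpha>] \<beta> by simp
    qed auto
    finally show ?thesis .
  qed
  have "(\<integral>e. min 1 \<bar>b i * e\<bar> powr q \<partial>\<mu>) \<le> (\<integral>e. weight i powr q * (1 + \<bar>e\<bar> powr \<alpha>) \<partial>\<mu>)"
    by (intro integral_mono' le) (use moment_\<alpha> in auto)
  also have "\<dots> = weight i powr q * noise_moment"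
    using moment_\<alpha> by (simp add: noise_moment_def)
  finally show ?thesis .
qed

text \<open>The conditional expectation of \<open>G (tail k 0)\<close> given the noise up to time k
  - i, minus the one given the noise up to time k - i - 1. The noise at time k - i is a separate
  argument e, as \<open>integral_past\<close> requires.\<close>

definition proj :: "(real \<Rightarrow> real) \<Rightarrow> nat \<Rightarrow> int \<Rightarrow> 'a \<Rightarrow> real \<Rightarrow> real" where
  "proj G i k \<omega> e = smooth G i (b i * e + tail k (Suc i) \<omega>) - smooth G (Suc i) (tail k (Suc i) \<omega>)"

lemma proj_measurable:
  assumes "bdd_lip K G"
  shows "(\<lambda>(\<omega>, e). proj G i k \<omega> e) \<in> borel_measurable (past (k - int i) \<Otimes>\<^sub>M borel)"
proof -
  have "(\<lambda>x. smooth G (Suc i) (tail k (Suc i) (fst x))) \<in> borel_measurable (past (k - int i) \<Otimes>\<^sub>M (borel :: real measure))"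
    by (rule measurable_compose[OF measurable_compose[OF measurable_fst tail_measurable_past]
          bdd_lip_measurable[OF bdd_lip_smooth[OF assms]]]) simp
  from borel_measurable_diff[OF smooth_eval_measurable[OF assms, of i k, unfolded split_beta'] this]
  show ?thesis unfolding proj_def split_beta' .
qed

lemma proj_bound:
  assumes G: "bdd_lip K G"
  shows "\<bar>proj G i k \<omega> e\<bar> \<le> 2 * K"
  unfolding proj_def
  using bdd_lipD(1)[OF bdd_lip_smooth[OF G], of i "b i * e + tail k (Suc i) \<omega>"]
    bdd_lipD(1)[OF bdd_lip_smooth[OF G], of "Suc i" "tail k (Suc i) \<omega>"] by linarith

lemma proj_section_measurable:
  assumes G: "bdd_lip K G"
  shows "proj G i k \<omega> \<in> borel_measurable \<mu>"
  unfolding proj_def measurable_cong_sets[OF sets_mu refl]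
  by (intro borel_measurable_diff borel_measurable_const
      measurable_compose[OF _ bdd_lip_measurable[OF bdd_lip_smooth[OF G]]]) measurable

lemma proj_mean:
  assumes G: "bdd_lip K G"
  shows "(\<integral>e. proj G i k \<omega> e \<partial>\<mu>) = 0"
  unfolding proj_def using bdd_lip_integrable[OF bdd_lip_smooth[OF G]] by simp

lemma proj_pointwise:
  assumes G: "bdd_lip K G"
  shows "\<bar>proj G i k \<omega> e\<bar> \<le> 2 * K * (min 1 \<bar>b i * e\<bar> + (\<integral>e. min 1 \<bar>b i * e\<bar> \<partial>\<mu>))"
proof -
  let ?t = "tail k (Suc i) \<omega>"
  note int = bdd_lip_integrable[OF bdd_lip_smooth[OF G]] and lip = bdd_lipD[OF bdd_lip_smooth[OF G, of i]]
  have im: "integrable \<mu> (\<lambda>e. min 1 \<bar>b i * e\<bar>)"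
    by (rule mu.integrable_const_bound[where B = 1]) auto
  \<comment> \<open>An independent copy e' of the noise represents the subtracted conditional
    expectation as an average, which leaves a difference of two values of one Lipschitz
    function.\<close>
  have eq: "proj G i k \<omega> e = (\<integral>e'. smooth G i (b i * e + ?t) - smooth G i (b i * e' + ?t) \<partial>\<mu>)"
    using int by (simp add: proj_def)
  have "\<bar>proj G i k \<omega> e\<bar> \<le> (\<integral>e'. \<bar>smooth G i (b i * e + ?t) - smooth G i (b i * e' + ?t)\<bar> \<partial>\<mu>)"
    unfolding eq by (rule integral_abs_bound)
  also have "\<dots> \<le> (\<integral>e'. 2 * K * (min 1 \<bar>b i * e\<bar> + min 1 \<bar>b i * e'\<bar>) \<partial>\<mu>)"
  proof (rule integral_mono)
    fix e'
    let ?d = "\<bar>smooth G i (b i * e + ?t) - smooth G i (b i * e' + ?t)\<bar>"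
    have 1: "?d \<le> 2 * K" using lip(1)[of "b i * e + ?t"] lip(1)[of "b i * e' + ?t"] by linarith
    have "?d \<le> K * \<bar>b i * e - b i * e'\<bar>" using lip(2)[of "b i * e + ?t" "b i * e' + ?t"] by simp
    also have "\<dots> \<le> 2 * K * (\<bar>b i * e\<bar> + \<bar>b i * e'\<bar>)"
      using lip(3) by (intro mult_mono) auto
    finally have 2: "?d \<le> 2 * K * (\<bar>b i * e\<bar> + \<bar>b i * e'\<bar>)" .
    have 3: "2 * K * 1 \<le> 2 * K * (min 1 \<bar>b i * e\<bar> + min 1 \<bar>b i * e'\<bar>)"
      if "\<bar>b i * e\<bar> > 1 \<or> \<bar>b i * e'\<bar> > 1"
      using lip(3) that by (intro mult_left_mono) auto
    show "?d \<le> 2 * K * (min 1 \<bar>b i * e\<bar> + min 1 \<bar>b i * e'\<bar>)"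
    proof (cases "\<bar>b i * e\<bar> > 1 \<or> \<bar>b i * e'\<bar> > 1")
      case True
      then show ?thesis using 1 3 by linarith
    next
      case False
      then have "min 1 \<bar>b i * e\<bar> = \<bar>b i * e\<bar>" "min 1 \<bar>b i * e'\<bar> = \<bar>b i * e'\<bar>" by auto
      then show ?thesis using 2 by presburger
    qed
  qed (use int im in auto)
  also have "\<dots> = 2 * K * (min 1 \<bar>b i * e\<bar> + (\<integral>e. min 1 \<bar>b i * e\<bar> \<partial>\<mu>))"
    using im by (simp add: distrib_left)
  finally show ?thesis .
qed

text \<open>The factor 4 is the pointwise 2 times a sum bounded by twice its maximum. Adding two
  truncated moments gives \<open>2 * noise_moment\<close>, which is at least 1 and may go inside the
  power, so that the bound is the q-th power of a single scale.\<close>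

lemma proj_moment:
  assumes G: "bdd_lip K G"
  shows "(\<integral>e. \<bar>proj G i k \<omega> e\<bar> powr q \<partial>\<mu>) \<le> (8 * noise_moment * K * weight i) powr q"
proof -
  let ?m = "\<lambda>e. min 1 \<bar>b i * e\<bar>"
  define m0 where "m0 = (\<integral>e. ?m e \<partial>\<mu>)"
  note K = bdd_lipD(3)[OF G]
  have m0: "0 \<le> m0" unfolding m0_def by simp
  have imq: "integrable \<mu> (\<lambda>e. ?m e powr q)"
    by (rule mu.integrable_const_bound[where B = 1]) (use q in \<open>auto intro!: powr_le1\<close>)
  have m0q: "m0 powr q \<le> (\<integral>e. ?m e powr q \<partial>\<mu>)"
    unfolding m0_def by (rule mu.integral_powr_le[where B = 1]) (use q in auto)
  have le: "\<bar>proj G i k \<omega> e\<bar> powr q \<le> (4 * K) powr q * (?m e powr q + m0 powr q)" for e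
  proof -
    have "\<bar>proj G i k \<omega> e\<bar> \<le> 2 * K * (?m e + m0)"
      using proj_pointwise[OF G] by (simp add: m0_def)
    also have "\<dots> \<le> 2 * K * (2 * max (?m e) m0)" using K by (intro mult_left_mono) auto
    finally have "\<bar>proj G i k \<omega> e\<bar> powr q \<le> (4 * K * max (?m e) m0) powr q"
      using q by (intro powr_mono2) auto
    also have "\<dots> = (4 * K) powr q * max (?m e) m0 powr q"
      using K m0 by (subst powr_mult) auto
    also have "\<dots> \<le> (4 * K) powr q * (?m e powr q + m0 powr q)"
      by (intro mult_left_mono) (auto simp: max_def)
    finally show ?thesis .
  qed
  have "(\<integral>e. \<bar>proj G i k \<omega> e\<bar> powr q \<partial>\<mu>) \<le> (\<integral>e. (4 * K) powr q * (?m e powr q + m0 powr q) \<partial>\<mu>)"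
    by (intro integral_mono' le) (use imq in auto)
  also have "\<dots> = (4 * K) powr q * ((\<integral>e. ?m e powr q \<partial>\<mu>) + m0 powr q)"
    using imq by simp
  also have "\<dots> \<le> (4 * K) powr q * (2 * (weight i powr q * noise_moment))"
    using truncated_moment[of i] m0q by (intro mult_left_mono) auto
  also have "\<dots> = (4 * K * weight i) powr q * (2 * noise_moment)"
    using K weight_pos[of i] by (subst powr_mult) auto
  also have "\<dots> \<le> (4 * K * weight i) powr q * (2 * noise_moment) powr q"
  proof (rule mult_left_mono)
    have "(2 * noise_moment) powr 1 \<le> (2 * noise_moment) powr q"
      using noise_moment_ge q by (intro powr_mono) auto
    then show "2 * noise_moment \<le> (2 * noise_moment) powr q" using noise_moment_ge by simp
  qed simp
  also have "\<dots> = (8 * noise_moment * K * weight i) powr q"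
    using K weight_pos[of i] noise_moment_ge by (subst powr_mult[symmetric]) (auto simp: mult_ac)
  finally show ?thesis .
qed

definition level_const :: real where
  "level_const = moment_const q * (2 powr (q / 2) + 1) * (8 * noise_moment) powr q"

lemma level_const_nonneg: "0 \<le> level_const"
  using q moment_const_nonneg by (simp add: level_const_def)

text \<open>For a fixed lag i, the terms ordered by the time of their fresh noise are martingale
  increments of a common scale.\<close>

lemma level_moment:
  assumes G: "bdd_lip K G" and K: "0 < K"
  shows "(\<integral>\<omega>. \<bar>\<Sum>j<n. proj G i (k + int j) \<omega> (\<epsilon> (k + int j - int i) \<omega>)\<bar> powr q \<partial>M)
    \<le> level_const * (K * weight i) powr q * real n powr (q / 2)"
proof (cases "n = 0")
  case False
  define c where "c = 8 * noise_moment * K * weight i"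
  have c: "c > 0" using K noise_moment_ge weight_pos[of i] by (simp add: c_def)
  have int_q: "integrable \<mu> (\<lambda>e. \<bar>proj G i k \<omega> e\<bar> powr q)" for k \<omega>
    using proj_section_measurable[OF G, of i k \<omega>] proj_bound[OF G, of i k \<omega>] q
    by (intro mu.integrable_const_bound[where B = "(2 * K) powr q"]) (auto intro!: powr_mono2)
  have "(\<integral>\<omega>. \<bar>\<Sum>j<n. proj G i (k + int j) \<omega> (\<epsilon> (k - int i + int j) \<omega>)\<bar> powr q \<partial>M)
    \<le> moment_const q * ((real n * (2 * c\<^sup>2)) powr (q / 2) + real n * c powr q)"
  proof (rule martingale_moment[where B = "2 * K"])
    show "(\<lambda>(\<omega>, e). proj G i (k + int j) \<omega> e) \<in> borel_measurable (past (k - int i + int j) \<Otimes>\<^sub>M borel)" for j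
      using proj_measurable[OF G, of i "k + int j"] by (simp add: algebra_simps)
    \<comment> \<open>The second moment is obtained from the q-th by \<open>powr_le_add_powr\<close>
      at the scale c, at the price of the factor 2.\<close>
    show "(\<integral>e. (proj G i (k + int j) \<omega> e)\<^sup>2 \<partial>\<mu>) \<le> 2 * c\<^sup>2" for j \<omega>
    proof -
      have "(\<integral>e. (proj G i (k + int j) \<omega> e)\<^sup>2 \<partial>\<mu>)
          \<le> (\<integral>e. c\<^sup>2 * (1 + \<bar>proj G i (k + int j) \<omega> e\<bar> powr q / c powr q) \<partial>\<mu>)"
      proof (rule integral_mono')
        show "(proj G i (k + int j) \<omega> e)\<^sup>2 \<le> c\<^sup>2 * (1 + \<bar>proj G i (k + int j) \<omega> e\<bar> powr q / c powr q)" for e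
          using powr_le_add_powr[of c "\<bar>proj G i (k + int j) \<omega> e\<bar>" 2 q] c q by simp
      qed (use int_q in auto)
      also have "\<dots> = c\<^sup>2 * (1 + (\<integral>e. \<bar>proj G i (k + int j) \<omega> e\<bar> powr q \<partial>\<mu>) / c powr q)"
        using int_q by simp
      also have "\<dots> \<le> c\<^sup>2 * (1 + c powr q / c powr q)"
        unfolding c_def
        by (intro mult_left_mono add_left_mono divide_right_mono proj_moment[OF G]) auto
      also have "\<dots> = 2 * c\<^sup>2" using c by simp
      finally show ?thesis .
    qed
  qed (use proj_bound[OF G] proj_mean[OF G] proj_moment[OF G] q c in \<open>auto simp: c_def\<close>)
  also have "\<dots> \<le> moment_const q * (2 powr (q / 2) * c powr q * real n powr (q / 2) + real n powr (q / 2) * c powr q)"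
  proof (intro mult_left_mono add_mono mult_right_mono moment_const_nonneg q)
    have "(c\<^sup>2) powr (q / 2) = c powr q" using c by (simp add: powr_powr flip: powr_numeral)
    then show "(real n * (2 * c\<^sup>2)) powr (q / 2) \<le> 2 powr (q / 2) * c powr q * real n powr (q / 2)"
      by (simp add: powr_mult)
    have "real n powr 1 \<le> real n powr (q / 2)" using False q by (intro powr_mono) auto
    then show "real n \<le> real n powr (q / 2)" by simp
  qed simp
  also have "\<dots> = moment_const q * (2 powr (q / 2) + 1) * c powr q * real n powr (q / 2)"
    by (simp add: algebra_simps)
  also have "c powr q = (8 * noise_moment) powr q * (K * weight i) powr q"
    using K weight_pos[of i] noise_moment_ge by (subst powr_mult[symmetric]) (auto simp: c_def mult_ac)
  finally show ?thesis by (simp add: level_const_def algebra_simps)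
qed (use level_const_nonneg q in auto)

definition pred_const :: real where
  "pred_const = level_const * (\<Sum>i. weight i) powr q"

text \<open>Minkowski's inequality over the lags in disguise: the i-th martingale has q-th moment
  proportional to \<open>weight i powr q\<close>, and Hoelder with the same weights turns each term
  back into \<open>weight i\<close>, which is summable.\<close>

lemma predictor_moment:
  assumes G: "bdd_lip K G"
  shows "(\<integral>\<omega>. \<bar>\<Sum>j<n. G (tail (k + int j) 0 \<omega>) - pred_mean G\<bar> powr q \<partial>M)
    \<le> pred_const * K powr q * real n powr (q / 2)"
proof (cases "K = 0")
  \<comment> \<open>The moment bound for a single lag assumes a positive constant, so zero is
    treated apart.\<close>
  case True
  have G0: "G t = 0" for t using bdd_lipD(1)[OF G, of t] True by linarith
  have "pred_mean G = 0" unfolding pred_mean_def G0 by simp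
  then show ?thesis unfolding G0 using q True by simp
next
  case False
  then have K: "K > 0" using bdd_lipD(3)[OF G] by simp
  note [measurable] = bdd_lip_measurable[OF G]
  define L where "L i \<omega> = (\<Sum>j<n. proj G i (k + int j) \<omega> (\<epsilon> (k + int j - int i) \<omega>))" for i \<omega>
  have L [measurable]: "L i \<in> borel_measurable M" for i
    unfolding L_def
  proof (rule borel_measurable_sum)
    fix j
    show "(\<lambda>\<omega>. proj G i (k + int j) \<omega> (\<epsilon> (k + int j - int i) \<omega>)) \<in> borel_measurable M"
      by (rule measurable_pastD, rule eval_measurable_past[where \<phi> = "proj G i (k + int j)"
            and k = "k + int j - int i" and l = "k + int j - int i + 1"])
         (use proj_measurable[OF G, of i "k + int j"] in auto)
  qed
  have tele: "AE \<omega> in M. \<forall>m. (\<Sum>i<m. L i \<omega>) = (\<Sum>j<n. G (tail (k + int j) 0 \<omega>) - smooth G m (tail (k + int j) m \<omega>))"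
  proof -
    have "AE \<omega> in M. \<forall>j i. tail (k + int j) i \<omega> = b i * \<epsilon> (k + int j - int i) \<omega> + tail (k + int j) (Suc i) \<omega>"
      using tail_split unfolding AE_all_countable by blast
    then show ?thesis
    proof eventually_elim
      case (elim \<omega>)
      have one: "(\<Sum>i<m. proj G i (k + int j) \<omega> (\<epsilon> (k + int j - int i) \<omega>))
          = G (tail (k + int j) 0 \<omega>) - smooth G m (tail (k + int j) m \<omega>)" for m j
      proof -
        have "proj G i (k + int j) \<omega> (\<epsilon> (k + int j - int i) \<omega>)
          = smooth G i (tail (k + int j) i \<omega>) - smooth G (Suc i) (tail (k + int j) (Suc i) \<omega>)" for i
          unfolding proj_def elim[rule_format, of j i, symmetric] ..
        then show ?thesis
          using sum_lessThan_telescope'[of "\<lambda>i. smooth G i (tail (k + int j) i \<omega>)" m]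
          by (simp only: smooth.simps(1))
      qed
      show ?case unfolding L_def by (subst sum.swap) (simp add: one)
    qed
  qed
  have lim: "AE \<omega> in M. (\<lambda>m. \<Sum>i<m. L i \<omega>) \<longlonglongrightarrow> (\<Sum>j<n. G (tail (k + int j) 0 \<omega>) - pred_mean G)"
  proof -
    have "AE \<omega> in M. \<forall>j. (\<lambda>m. tail (k + int j) m \<omega>) \<longlonglongrightarrow> 0"
      unfolding AE_all_countable using tail_tendsto by blast
    with tele show ?thesis
    proof eventually_elim
      case (elim \<omega>)
      have "(\<lambda>m. smooth G m (tail (k + int j) m \<omega>)) \<longlonglongrightarrow> pred_mean G" for j
      proof -
        have "(\<lambda>m. K * \<bar>tail (k + int j) m \<omega> - 0\<bar>) \<longlonglongrightarrow> K * \<bar>0 - 0\<bar>"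
          by (intro tendsto_intros elim(2)[rule_format])
        then have l0: "(\<lambda>m. K * \<bar>tail (k + int j) m \<omega> - 0\<bar>) \<longlonglongrightarrow> 0" by simp
        have "(\<lambda>m. smooth G m (tail (k + int j) m \<omega>) - smooth G m 0) \<longlonglongrightarrow> 0"
        proof (rule Lim_null_comparison[OF always_eventually l0], rule allI)
          show "norm (smooth G m (tail (k + int j) m \<omega>) - smooth G m 0) \<le> K * \<bar>tail (k + int j) m \<omega> - 0\<bar>" for m
            unfolding real_norm_def by (rule bdd_lipD(2)[OF bdd_lip_smooth[OF G]])
        qed
        from tendsto_add[OF this smooth_tendsto[OF G, of 0]] show ?thesis
          by (simp add: pred_mean_def)
      qed
      then show ?case unfolding elim(1)[rule_format] by (intro tendsto_intros)
    qed
  qed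
  have lim_q: "(\<lambda>m. \<integral>\<omega>. \<bar>\<Sum>i<m. L i \<omega>\<bar> powr q \<partial>M) \<longlonglongrightarrow>
      (\<integral>\<omega>. \<bar>\<Sum>j<n. G (tail (k + int j) 0 \<omega>) - pred_mean G\<bar> powr q \<partial>M)"
  proof (rule integral_dominated_convergence[where w = "\<lambda>_. (real n * (2 * K)) powr q"])
    show "AE \<omega> in M. (\<lambda>m. \<bar>\<Sum>i<m. L i \<omega>\<bar> powr q) \<longlonglongrightarrow> \<bar>\<Sum>j<n. G (tail (k + int j) 0 \<omega>) - pred_mean G\<bar> powr q"
      using lim by eventually_elim (use q in \<open>auto intro!: tendsto_powr' tendsto_rabs\<close>)
    \<comment> \<open>The telescoped form is bounded by n * (2 * K) for every m, whereas bounding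
      the levels one by one gives a bound that grows with m.\<close>
    show "AE \<omega> in M. norm (\<bar>\<Sum>i<m. L i \<omega>\<bar> powr q) \<le> (real n * (2 * K)) powr q" for m
      using tele
    proof eventually_elim
      case (elim \<omega>)
      have "\<bar>G (tail (k + int j) 0 \<omega>) - smooth G m (tail (k + int j) m \<omega>)\<bar> \<le> 2 * K" for j
        using bdd_lipD(1)[OF G, of "tail (k + int j) 0 \<omega>"]
          bdd_lipD(1)[OF bdd_lip_smooth[OF G], of m "tail (k + int j) m \<omega>"] by linarith
      then have "\<bar>\<Sum>i<m. L i \<omega>\<bar> \<le> (\<Sum>j<n. 2 * K)"
        unfolding elim[rule_format] by (intro order_trans[OF sum_abs] sum_mono)
      then show ?case using q by (auto intro!: powr_mono2)
    qed
  qed auto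
  have int_L: "integrable M (\<lambda>\<omega>. \<bar>L i \<omega>\<bar> powr q)" for i
  proof (rule integrable_const_bound[where B = "(real n * (2 * K)) powr q"])
    have "\<bar>L i \<omega>\<bar> \<le> (\<Sum>j<n. 2 * K)" for \<omega>
      unfolding L_def by (intro order_trans[OF sum_abs] sum_mono proj_bound[OF G])
    then show "AE \<omega> in M. norm (\<bar>L i \<omega>\<bar> powr q) \<le> (real n * (2 * K)) powr q"
      using q by (auto intro!: powr_mono2)
  qed measurable
  have "(\<integral>\<omega>. \<bar>\<Sum>i<m. L i \<omega>\<bar> powr q \<partial>M) \<le> pred_const * K powr q * real n powr (q / 2)" for m
  proof -
    define W where "W = (\<Sum>i<m. weight i)"
    have W0: "0 \<le> W" unfolding W_def using weight_pos by (intro sum_nonneg less_imp_le)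
    have WW: "W \<le> (\<Sum>i. weight i)"
      unfolding W_def using weight_pos by (intro sum_le_suminf summable_weight) (auto intro: less_imp_le)
    have "(\<integral>\<omega>. \<bar>\<Sum>i<m. L i \<omega>\<bar> powr q \<partial>M)
        \<le> (\<integral>\<omega>. W powr (q - 1) * (\<Sum>i<m. weight i powr (1 - q) * \<bar>L i \<omega>\<bar> powr q) \<partial>M)"
    proof (rule integral_mono')
      fix \<omega>
      have "\<bar>\<Sum>i<m. L i \<omega>\<bar> powr q \<le> (\<Sum>i<m. \<bar>L i \<omega>\<bar>) powr q"
        using q by (intro powr_mono2 sum_abs) auto
      also have "\<dots> \<le> W powr (q - 1) * (\<Sum>i<m. weight i powr (1 - q) * \<bar>L i \<omega>\<bar> powr q)"
        unfolding W_def by (rule sum_powr_le_weighted) (use q weight_pos in auto)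
      finally show "\<bar>\<Sum>i<m. L i \<omega>\<bar> powr q \<le> W powr (q - 1) * (\<Sum>i<m. weight i powr (1 - q) * \<bar>L i \<omega>\<bar> powr q)" .
    qed (use int_L in \<open>auto intro!: sum_nonneg mult_nonneg_nonneg\<close>)
    also have "\<dots> = W powr (q - 1) * (\<Sum>i<m. weight i powr (1 - q) * (\<integral>\<omega>. \<bar>L i \<omega>\<bar> powr q \<partial>M))"
      using int_L by simp
    also have "\<dots> \<le> W powr (q - 1) * (\<Sum>i<m. weight i powr (1 - q) * (level_const * (K * weight i) powr q * real n powr (q / 2)))"
      unfolding L_def by (intro mult_left_mono sum_mono level_moment[OF G K]) auto
    also have "\<dots> = W powr (q - 1) * (\<Sum>i<m. level_const * K powr q * real n powr (q / 2) * weight i)"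
    proof -
      have "weight i powr (1 - q) * (level_const * (K * weight i) powr q * real n powr (q / 2))
          = level_const * K powr q * real n powr (q / 2) * weight i" for i
        using K weight_pos[of i] by (simp add: powr_mult powr_diff)
      then show ?thesis by (simp only:)
    qed
    also have "\<dots> = level_const * K powr q * real n powr (q / 2) * (W powr (q - 1) * W)"
      unfolding sum_distrib_left[symmetric] W_def[symmetric] by simp
    also have "W powr (q - 1) * W = W powr q" using W0 q by (cases "W = 0") (auto simp: powr_diff)
    also have "level_const * K powr q * real n powr (q / 2) * W powr q
        \<le> level_const * K powr q * real n powr (q / 2) * (\<Sum>i. weight i) powr q"
      using W0 WW q level_const_nonneg by (intro mult_left_mono powr_mono2) auto
    finally show ?thesis by (simp add: pred_const_def mult_ac)
  qed
  then show ?thesis by (intro LIMSEQ_le_const2[OF lim_q]) auto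
qed

end

subsection \<open>Almost sure uniform rates by chaining\<close>

lemma powr_le_imp_le:
  fixes x y q :: real
  assumes "x powr q \<le> y powr q" "0 < q" "0 \<le> y"
  shows "x \<le> y"
  using powr_less_mono2[of q y x] assms by (meson leI not_le)

text \<open>The loss in the chaining over n, whose exponent q / 2 is critical exactly when q =
  2.\<close>

definition level_count :: "real \<Rightarrow> nat \<Rightarrow> real" where
  "level_count q L = (if q = 2 then (real L + 1) powr 2 else 1)"

text \<open>With geometric weights the chaining loses only a constant as soon as the increments at
  scale \<open>2\<^sup>-\<^sup>l\<close> decay faster than their number grows; at the critical exponent
  (only needed for \<open>q = 2\<close>) a power of the number of levels is lost.\<close>

lemma dyadic_weights:
  fixes q \<kappa> :: real
  assumes q: "1 < q" and \<kappa>: "1 < \<kappa> \<or> \<kappa> = 1 \<and> q = 2"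
  obtains C :: real and \<rho> :: "nat \<Rightarrow> nat \<Rightarrow> real" where "0 \<le> C" "\<And>L l. 0 \<le> \<rho> L l"
    "\<And>L (s :: nat \<Rightarrow> real) j. j \<le> 2 ^ L \<Longrightarrow> \<bar>s j - s 0\<bar> powr q \<le>
      (\<Sum>l\<le>L. \<rho> L l * (\<Sum>i<2 ^ l. \<bar>s (Suc i * 2 ^ (L - l)) - s (i * 2 ^ (L - l))\<bar> powr q))"
    "\<And>L. (\<Sum>l\<le>L. \<rho> L l * 2 ^ l * (2 ^ l) powr - \<kappa>) \<le> C * (if 1 < \<kappa> then 1 else (real L + 1) powr 2)"
proof (cases "1 < \<kappa>")
  case True
  \<comment> \<open>Level l has 2^l increments of moment 2^(- l * \<kappa>), a surplus of 2^(- l *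
    (\<kappa> - 1)). The weights 2^(- l * \<eta>), raised to the power 1 - q, consume half of it;
    the other half is the geometric series in y.\<close>
  define \<eta> where "\<eta> = (\<kappa> - 1) / (2 * (q - 1))"
  have \<eta>: "\<eta> > 0" using True q by (simp add: \<eta>_def)
  define x where "x = (2::real) powr - \<eta>"
  define y where "y = (2::real) powr - ((\<kappa> - 1) / 2)"
  have x: "0 < x" "x < 1" unfolding x_def using \<eta> by (auto simp: powr_less_one)
  have y: "0 < y" "y < 1" unfolding y_def using True by (auto simp: powr_less_one)
  define \<rho> where "\<rho> L l = (1 / (1 - x)) powr (q - 1) * (x ^ l) powr (1 - q)" for L l :: nat
  have geom: "(\<Sum>l\<le>L. z ^ l) \<le> 1 / (1 - z)" if "0 < z" "z < 1" for z :: real and L :: nat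
  proof -
    have "(\<Sum>l\<le>L. z ^ l) \<le> (\<Sum>l. z ^ l)"
      using that by (intro sum_le_suminf summable_geometric) auto
    then show ?thesis using that by (simp add: suminf_geometric)
  qed
  have c: "(x ^ l) powr (1 - q) * 2 ^ l * (2 ^ l) powr - \<kappa> = y ^ l" for l
  proof -
    have "x ^ l = 2 powr (- \<eta> * real l)" "y ^ l = 2 powr (- ((\<kappa> - 1) / 2) * real l)"
      unfolding x_def y_def by (simp_all add: powr_powr flip: powr_realpow)
    moreover have "(2::real) ^ l = 2 powr real l" by (simp add: powr_realpow)
    moreover have "- \<eta> * real l * (1 - q) + real l + real l * - \<kappa> = - ((\<kappa> - 1) / 2) * real l"
    proof -
      have "q - 1 \<noteq> 0" using q by simp
      then have "\<eta> * (q - 1) = (\<kappa> - 1) / 2" unfolding \<eta>_def by (metis divide_divide_eq_left nonzero_eq_divide_eq)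
      moreover have "- \<eta> * real l * (1 - q) = \<eta> * (q - 1) * real l" by algebra
      ultimately have "- \<eta> * real l * (1 - q) + real l + real l * - \<kappa> = (\<kappa> - 1) / 2 * real l + real l + real l * - \<kappa>"
        by (simp only:)
      also have "\<dots> = - ((\<kappa> - 1) / 2) * real l" by (simp add: field_simps)
      finally show ?thesis .
    qed
    ultimately show ?thesis by (simp add: powr_powr flip: powr_add)
  qed
  show ?thesis
  proof (rule that[of "(1 / (1 - x)) powr (q - 1) * (1 / (1 - y))" \<rho>])
    fix L j :: nat and s :: "nat \<Rightarrow> real" assume j: "j \<le> 2 ^ L"
    define S where "S l = (\<Sum>i<2 ^ l. \<bar>s (Suc i * 2 ^ (L - l)) - s (i * 2 ^ (L - l))\<bar> powr q)" for l
    have "\<bar>s j - s 0\<bar> powr q \<le> (\<Sum>l\<le>L. x ^ l) powr (q - 1) * (\<Sum>l\<le>L. (x ^ l) powr (1 - q) * S l)"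
      unfolding S_def by (rule dyadic_chain_powr[OF _ _ j]) (use q x in auto)
    also have "\<dots> \<le> (1 / (1 - x)) powr (q - 1) * (\<Sum>l\<le>L. (x ^ l) powr (1 - q) * S l)"
      using x q by (intro mult_right_mono powr_mono2 geom sum_nonneg mult_nonneg_nonneg) (auto simp: S_def sum_nonneg)
    also have "\<dots> = (\<Sum>l\<le>L. \<rho> L l * S l)" by (simp add: \<rho>_def sum_distrib_left mult.assoc)
    finally show "\<bar>s j - s 0\<bar> powr q \<le>
      (\<Sum>l\<le>L. \<rho> L l * (\<Sum>i<2 ^ l. \<bar>s (Suc i * 2 ^ (L - l)) - s (i * 2 ^ (L - l))\<bar> powr q))"
      by (simp add: S_def)
  next
    fix L
    have "(\<Sum>l\<le>L. \<rho> L l * 2 ^ l * (2 ^ l) powr - \<kappa>) = (\<Sum>l\<le>L. (1 / (1 - x)) powr (q - 1) * y ^ l)"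
      by (intro sum.cong refl) (simp add: \<rho>_def mult.assoc flip: c)
    also have "\<dots> \<le> (1 / (1 - x)) powr (q - 1) * (1 / (1 - y))"
      unfolding sum_distrib_left[symmetric] by (intro mult_left_mono geom y) auto
    finally show "(\<Sum>l\<le>L. \<rho> L l * 2 ^ l * (2 ^ l) powr - \<kappa>)
      \<le> (1 / (1 - x)) powr (q - 1) * (1 / (1 - y)) * (if 1 < \<kappa> then 1 else (real L + 1) powr 2)"
      using True by simp
  qed (use y in \<open>auto simp: \<rho>_def\<close>)
next
  case False
  then have \<kappa>1: "\<kappa> = 1" "q = 2" using \<kappa> by auto
  show ?thesis
  \<comment> \<open>Unit weights: one factor L + 1 comes from Hoelder with q = 2, the other from
    adding L + 1 levels of equal size.\<close>
  proof (rule that[of 1 "\<lambda>L l. real L + 1"])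
    fix L j :: nat and s :: "nat \<Rightarrow> real" assume j: "j \<le> 2 ^ L"
    have "\<bar>s j - s 0\<bar> powr q \<le> (\<Sum>l\<le>L. 1) powr (q - 1) *
      (\<Sum>l\<le>L. 1 powr (1 - q) * (\<Sum>i<2 ^ l. \<bar>s (Suc i * 2 ^ (L - l)) - s (i * 2 ^ (L - l))\<bar> powr q))"
      by (rule dyadic_chain_powr[OF _ _ j]) (use q in auto)
    then show "\<bar>s j - s 0\<bar> powr q \<le>
      (\<Sum>l\<le>L. (real L + 1) * (\<Sum>i<2 ^ l. \<bar>s (Suc i * 2 ^ (L - l)) - s (i * 2 ^ (L - l))\<bar> powr q))"
      using \<kappa>1 by (simp add: sum_distrib_left add.commute)
  next
    fix L
    have "(real L + 1) * 2 ^ l * (2 ^ l) powr - \<kappa> = real L + 1" for l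
      using \<kappa>1 by (simp add: powr_minus)
    then show "(\<Sum>l\<le>L. (real L + 1) * 2 ^ l * (2 ^ l) powr - \<kappa>) \<le> 1 * (if 1 < \<kappa> then 1 else (real L + 1) powr 2)"
      using \<kappa>1 by (simp add: power2_eq_square algebra_simps)
  qed auto
qed

section \<open>Growth and summability of the logarithmic rate\<close>

lemma iota_rate_mono:
  assumes q: "2 \<le> q" and nm: "4 \<le> n" "n \<le> m"
  shows "0 < iota_rate q n" "iota_rate q n \<le> iota_rate q m"
proof -
  \<comment> \<open>From 4 on the logarithm exceeds 1, so the iterated logarithm is positive and the
    powers are monotone.\<close>
  have "ln 4 = 2 * ln (2::real)" using ln_realpow[of 2 2] by simp
  then have "1 < ln (4::real)" using ln2_ge_two_thirds by simp
  also have "ln 4 \<le> ln (real n)" using nm by (subst ln_le_cancel_iff) auto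
  finally have n: "1 < ln (real n)" .
  have le: "ln (real n) \<le> ln (real m)" using nm by (subst ln_le_cancel_iff) auto
  have lln: "0 < ln (ln (real n))" using n by simp
  have lle: "ln (ln (real n)) \<le> ln (ln (real m))" using n le by (subst ln_le_cancel_iff) auto
  show "0 < iota_rate q n" using n lln by (simp add: iota_rate_def)
  show "iota_rate q n \<le> iota_rate q m"
    unfolding iota_rate_def using n le lln lle q by (auto intro!: mult_mono powr_mono2)
qed

text \<open>Cauchy condensation leaves terms of order 1 / n^2. The shift inside the logarithm keeps
  it positive at n = 1; at n = 0 the quotient is 0 by convention, so monotonicity starts at
  1.\<close>

lemma summable_inverse_ln_square: "summable (\<lambda>n. 1 / (real n * (ln (real n + 1))\<^sup>2))"
proof -
  define f where "f n = 1 / (real n * (ln (real n + 1))\<^sup>2)" for n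
  have "summable (\<lambda>n. 2 ^ n * f (2 ^ n))"
  proof (rule summable_comparison_test_bigo)
    show "summable (\<lambda>n. norm (real n powr - 2))" by (simp add: summable_real_powr_iff)
    show "(\<lambda>n. 2 ^ n * f (2 ^ n)) \<in> O(\<lambda>n. real n powr - 2)"
      unfolding f_def by real_asymp
  qed
  moreover have "f (Suc m) \<le> f m" if "0 < m" for m
    unfolding f_def using that by (intro divide_left_mono mult_mono power_mono mult_pos_pos zero_less_power) auto
  ultimately have "summable f"
    by (subst condensation_test) (auto simp: f_def)
  then show ?thesis by (simp add: f_def[abs_def])
qed

text \<open>The rate is made for this series: the terms have order 1 / (d * (ln d)^2). For q = 2 the
  extra d^2 from \<open>level_count\<close> is paid by the cube of the logarithm in the squared
  rate.\<close>

lemma summable_rate: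
  assumes q: "2 \<le> q"
  shows "summable (\<lambda>d. level_count q (Suc d) / iota_rate q (2 ^ d) powr q)"
proof -
  have summ: "summable (\<lambda>n. norm (1 / (real n * (ln (real n + 1))\<^sup>2)))"
    using summable_inverse_ln_square by simp
  show ?thesis
  proof (cases "q = 2")
    case True
    show ?thesis
    proof (rule summable_comparison_test_bigo[OF summ])
      show "(\<lambda>d. level_count q (Suc d) / iota_rate q (2 ^ d) powr q) \<in> O(\<lambda>n. 1 / (real n * (ln (real n + 1))\<^sup>2))"
        unfolding level_count_def iota_rate_def True if_P[OF refl] by real_asymp
    qed
  next
    case False
    then have q2: "q > 2" using q by simp
    show ?thesis
    proof (rule summable_comparison_test_bigo[OF summ])
      have "(\<lambda>d. 1 / (ln (real (2 ^ d)) * ln (ln (real (2 ^ d))) powr 2)) \<in> O(\<lambda>n. 1 / (real n * (ln (real n + 1))\<^sup>2))"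
        by real_asymp
      moreover have "\<forall>\<^sub>F d in sequentially. 1 / (ln (real (2 ^ d)) * ln (ln (real (2 ^ d))) powr 2)
          = level_count q (Suc d) / iota_rate q (2 ^ d) powr q"
        using eventually_ge_at_top[of 2]
      proof eventually_elim
        case (elim d)
        have "(2::real) ^ 2 \<le> 2 ^ d" using elim by (intro power_increasing) auto
        then have d: "4 \<le> (2::real) ^ d" by simp
        have "ln 4 = 2 * ln (2::real)" using ln_realpow[of 2 2] by simp
        then have "1 < ln (4::real)" using ln2_ge_two_thirds by simp
        also have "ln 4 \<le> ln (real (2 ^ d))" using d by simp
        finally have 1: "1 < ln (real (2 ^ d))" .
        then have "0 < ln (ln (real (2 ^ d)))" by (rule ln_gt_zero)
        with 1 show ?case using False q2 unfolding level_count_def iota_rate_def if_not_P[OF False]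
          by (subst powr_mult) (simp_all add: powr_powr del: of_nat_power)
      qed
      ultimately show "(\<lambda>d. level_count q (Suc d) / iota_rate q (2 ^ d) powr q) \<in> O(\<lambda>n. 1 / (real n * (ln (real n + 1))\<^sup>2))"
        by (subst (asm) landau_o.big.in_cong) 
    qed
  qed
qed

lemma grid_cell:
  fixes A B x :: real
  assumes "A < B" "0 < N" "A \<le> x" "x \<le> B"
  obtains j where "j < N" "A + (B - A) * real j / real N \<le> x" "x \<le> A + (B - A) * real (Suc j) / real N"
proof (cases "x = B")
  \<comment> \<open>Rounding down would put the right end point into cell N, which does not
    exist.\<close>
  case True
  show ?thesis
    by (rule that[of "N - 1"]) (use assms True in \<open>auto simp: field_simps\<close>)
next
  case False
  define z where "z = (x - A) / (B - A) * real N"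
  have z: "0 \<le> z" "z < real N" using assms False by (auto simp: z_def field_simps)
  define j where "j = nat \<lfloor>z\<rfloor>"
  have j: "real j \<le> z" "z \<le> real (Suc j)" using z unfolding j_def by linarith+
  have x: "x = A + (B - A) * z / real N" using assms by (simp add: z_def)
  show ?thesis
  proof (rule that[of j])
    show "j < N" using j z by linarith
    show "A + (B - A) * real j / real N \<le> x"
      unfolding x using j assms by (intro add_left_mono divide_right_mono mult_left_mono) auto
    show "x \<le> A + (B - A) * real (Suc j) / real N"
      unfolding x using j assms by (intro add_left_mono divide_right_mono mult_left_mono) auto
  qed
qed

context prob_space
begin

text \<open>In place of Markov and Borel-Cantelli: the series of the \<open>Y d\<close> has finite
  expectation, so it converges almost surely.\<close>

lemma AE_tendsto_0_if_summable_expectation: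
  fixes Y :: "nat \<Rightarrow> 'a \<Rightarrow> real"
  assumes int: "\<And>d. integrable M (Y d)" and nonneg: "\<And>d \<omega>. 0 \<le> Y d \<omega>"
    and summ: "summable (\<lambda>d. \<integral>\<omega>. Y d \<omega> \<partial>M)"
  shows "AE \<omega> in M. (\<lambda>d. Y d \<omega>) \<longlonglongrightarrow> 0"
proof -
  have [measurable]: "Y d \<in> borel_measurable M" for d using int by auto
  have "(\<integral>\<^sup>+\<omega>. (\<Sum>d. ennreal (Y d \<omega>)) \<partial>M) = (\<Sum>d. \<integral>\<^sup>+\<omega>. ennreal (Y d \<omega>) \<partial>M)"
    by (rule nn_integral_suminf) measurable
  also have "\<dots> = (\<Sum>d. ennreal (\<integral>\<omega>. Y d \<omega> \<partial>M))"
    using int nonneg by (simp add: nn_integral_eq_integral)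
  also have "\<dots> \<noteq> \<infinity>"
    using summ nonneg by (simp add: suminf_ennreal2 integral_nonneg)
  finally have "AE \<omega> in M. (\<Sum>d. ennreal (Y d \<omega>)) \<noteq> \<infinity>"
    by (intro nn_integral_PInf_AE) auto
  then show ?thesis
  proof eventually_elim
    case (elim \<omega>)
    then have "summable (\<lambda>d. Y d \<omega>)" using nonneg by (intro summable_suminf_not_top) auto
    then show ?case by (rule summable_LIMSEQ_zero)
  qed
qed

text \<open>\<open>incr\<close> is asked only for separations of order at least 1 / sqrt n; at
  smaller ones the term linear in n of the martingale inequality takes over. \<open>cell\<close>
  bridges the final mesh, at a cost of order sqrt n.\<close>

context
  fixes \<xi> :: "nat \<Rightarrow> real \<Rightarrow> 'a \<Rightarrow> real" and A B q \<kappa> C D :: real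
  assumes AB: "A < B" and q: "2 \<le> q" and \<kappa>: "1 < \<kappa>" and C: "0 \<le> C"
    and meas [measurable]: "\<And>k x. \<xi> k x \<in> borel_measurable M"
    and bound: "\<And>k x \<omega>. \<bar>\<xi> k x \<omega>\<bar> \<le> D"
    and base: "\<And>a n. (\<integral>\<omega>. \<bar>\<Sum>k<n. \<xi> (a + k) A \<omega>\<bar> powr q \<partial>M) \<le> C * real n powr (q / 2)"
    and incr: "\<And>a n x y. 1 \<le> n \<Longrightarrow> A \<le> x \<Longrightarrow> x \<le> y \<Longrightarrow> y \<le> B \<Longrightarrow> B - A \<le> 2 * sqrt (real n) * (y - x) \<Longrightarrow>
      (\<integral>\<omega>. \<bar>(\<Sum>k<n. \<xi> (a + k) y \<omega>) - (\<Sum>k<n. \<xi> (a + k) x \<omega>)\<bar> powr q \<partial>M) \<le> C * real n powr (q / 2) * (y - x) powr \<kappa>"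
    and cell: "\<And>a n x u v \<omega>. A \<le> u \<Longrightarrow> u \<le> x \<Longrightarrow> x \<le> v \<Longrightarrow> v \<le> B \<Longrightarrow>
      \<bar>\<Sum>k<n. \<xi> (a + k) x \<omega>\<bar> \<le> \<bar>\<Sum>k<n. \<xi> (a + k) u \<omega>\<bar> + \<bar>\<Sum>k<n. \<xi> (a + k) v \<omega>\<bar> + C * real n * (v - u)"
begin

lemma integrable_sum_powr:
  "integrable M (\<lambda>\<omega>. \<bar>(\<Sum>k<n. \<xi> (a + k) y \<omega>) - (\<Sum>k<n. \<xi> (a + k) x \<omega>)\<bar> powr q)"
  "integrable M (\<lambda>\<omega>. \<bar>\<Sum>k<n. \<xi> (a + k) x \<omega>\<bar> powr q)"
proof -
  have b: "\<bar>\<Sum>k<n. \<xi> (a + k) x \<omega>\<bar> \<le> real n * D" for x \<omega>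
  proof -
    have "\<bar>\<Sum>k<n. \<xi> (a + k) x \<omega>\<bar> \<le> (\<Sum>k<n. D)"
      by (rule order_trans[OF sum_abs]) (rule sum_mono[OF bound])
    then show ?thesis by simp
  qed
  have b2: "\<bar>(\<Sum>k<n. \<xi> (a + k) y \<omega>) - (\<Sum>k<n. \<xi> (a + k) x \<omega>)\<bar> \<le> 2 * (real n * D)" for \<omega>
    using b[of y \<omega>] b[of x \<omega>] by linarith
  show "integrable M (\<lambda>\<omega>. \<bar>\<Sum>k<n. \<xi> (a + k) x \<omega>\<bar> powr q)"
    by (rule integrable_const_bound[where B = "(real n * D) powr q"])
       (use b q in \<open>auto intro!: powr_mono2\<close>)
  show "integrable M (\<lambda>\<omega>. \<bar>(\<Sum>k<n. \<xi> (a + k) y \<omega>) - (\<Sum>k<n. \<xi> (a + k) x \<omega>)\<bar> powr q)"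
    by (rule integrable_const_bound[where B = "(2 * (real n * D)) powr q"])
       (use b2 q in \<open>auto intro!: powr_mono2\<close>)
qed

text \<open>\<open>R\<close> is an integrable majorant of the supremum over the uncountably many x,
  so nothing has to be known about the measurability of that supremum.\<close>

lemma uniform_moment:
  obtains K :: real and R :: "nat \<Rightarrow> nat \<Rightarrow> 'a \<Rightarrow> real" where
    "\<And>a n. 1 \<le> n \<Longrightarrow> integrable M (R a n)" "\<And>a n \<omega>. 0 \<le> R a n \<omega>"
    "\<And>a n \<omega> x. 1 \<le> n \<Longrightarrow> x \<in> {A..B} \<Longrightarrow> \<bar>\<Sum>k<n. \<xi> (a + k) x \<omega>\<bar> powr q \<le> R a n \<omega>"
    "\<And>a n. 1 \<le> n \<Longrightarrow> (\<integral>\<omega>. R a n \<omega> \<partial>M) \<le> K * real n powr (q / 2)" "0 \<le> K"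
proof -
  have q1: "1 < q" using q by simp
  obtain C' :: real and \<rho> :: "nat \<Rightarrow> nat \<Rightarrow> real" where C': "0 \<le> C'" and \<rho>: "\<And>L l. 0 \<le> \<rho> L l"
    and chain: "\<And>L (s :: nat \<Rightarrow> real) j. j \<le> 2 ^ L \<Longrightarrow> \<bar>s j - s 0\<bar> powr q \<le>
      (\<Sum>l\<le>L. \<rho> L l * (\<Sum>i<2 ^ l. \<bar>s (Suc i * 2 ^ (L - l)) - s (i * 2 ^ (L - l))\<bar> powr q))"
    and sum\<rho>: "\<And>L. (\<Sum>l\<le>L. \<rho> L l * 2 ^ l * (2 ^ l) powr - \<kappa>) \<le> C' * (if 1 < \<kappa> then 1 else (real L + 1) powr 2)"
    by (rule dyadic_weights[of q \<kappa>, OF q1 disjI1[OF \<kappa>]]) (rule that)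
  define S where "S a n x \<omega> = (\<Sum>k<n. \<xi> (a + k) x \<omega>)" for a n x \<omega>
  \<comment> \<open>The mesh (B - A) / 2^L lies between half of (B - A) / sqrt n and all of it:
    coarse enough for \<open>incr\<close>, fine enough for \<open>cell\<close>.\<close>
  have "\<exists>L. sqrt (real n) \<le> 2 ^ L \<and> 2 ^ L \<le> 2 * sqrt (real n)" if "1 \<le> n" for n
  proof -
    define L where "L = (LEAST L. sqrt (real n) \<le> 2 ^ L)"
    have ex: "\<exists>L. sqrt (real n) \<le> 2 ^ L" using real_arch_pow[of 2 "sqrt (real n)"] by (auto intro: less_imp_le)
    have 1: "sqrt (real n) \<le> 2 ^ L" unfolding L_def using ex by (rule LeastI_ex)
    have "2 ^ L \<le> 2 * sqrt (real n)"
    proof (cases L)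
      case 0
      have "1 \<le> sqrt (real n)" using that by simp
      then have "1 \<le> 2 * sqrt (real n)" by linarith
      then show ?thesis using 0 by simp
    next
      case (Suc m)
      then have "\<not> sqrt (real n) \<le> 2 ^ m" using not_less_Least[of m "\<lambda>L. sqrt (real n) \<le> 2 ^ L"] by (simp add: L_def)
      then show ?thesis using Suc by simp
    qed
    with 1 show ?thesis by blast
  qed
  then obtain L where L: "\<And>n. 1 \<le> n \<Longrightarrow> sqrt (real n) \<le> 2 ^ L n" "\<And>n. 1 \<le> n \<Longrightarrow> 2 ^ L n \<le> 2 * sqrt (real n)"
    by metis
  define x where "x n j = A + (B - A) * real j / real (2 ^ L n)" for n j :: nat
  define W where "W a n l i \<omega> = \<bar>S a n (x n (Suc i * 2 ^ (L n - l))) \<omega> - S a n (x n (i * 2 ^ (L n - l))) \<omega>\<bar> powr q" for a n l i \<omega>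
  define Q where "Q a n \<omega> = (\<Sum>l\<le>L n. \<rho> (L n) l * (\<Sum>i<2 ^ l. W a n l i \<omega>))" for a n \<omega>
  define c where "c = C * (B - A)"
  \<comment> \<open>Four contributions, hence \<open>4 powr q\<close>: the value at A, counted for
    both ends of a cell, the two chains leading to these ends, and the interpolation error.\<close>
  define R where "R a n \<omega> = 4 powr q * (2 powr q * \<bar>S a n A \<omega>\<bar> powr q + 2 * Q a n \<omega> + c powr q * real n powr (q / 2))" for a n \<omega>
  define K where "K = 4 powr q * (2 powr q * C + 2 * (C * (B - A) powr \<kappa> * C') + c powr q)"
  have c0: "0 \<le> c" using C AB by (simp add: c_def)
  have intQ: "integrable M (Q a n)" for a n
    unfolding Q_def W_def S_def
    by (intro Bochner_Integration.integrable_sum integrable_mult_right integrable_sum_powr)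
  have EQ: "(\<integral>\<omega>. Q a n \<omega> \<partial>M) \<le> C * real n powr (q / 2) * (B - A) powr \<kappa> * C'" if n: "1 \<le> n" for a n
  proof -
    have one: "(\<integral>\<omega>. W a n l i \<omega> \<partial>M)
       \<le> C * real n powr (q / 2) * ((B - A) powr \<kappa> * (2 ^ l) powr - \<kappa>)" if l: "l \<le> L n" and i: "i < 2 ^ l" for l i
    proof -
      have pw: "(2::real) ^ L n = 2 ^ l * 2 ^ (L n - l)" using l by (simp flip: power_add)
      have xj: "x n (j * 2 ^ (L n - l)) = A + (B - A) * (real j / 2 ^ l)" for j
        unfolding x_def by (simp add: pw)
      have d: "x n (Suc i * 2 ^ (L n - l)) - x n (i * 2 ^ (L n - l)) = (B - A) / 2 ^ l"
        unfolding xj by (simp add: field_simps)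
      have "(\<integral>\<omega>. W a n l i \<omega> \<partial>M)
        \<le> C * real n powr (q / 2) * (x n (Suc i * 2 ^ (L n - l)) - x n (i * 2 ^ (L n - l))) powr \<kappa>"
        unfolding W_def S_def
      proof (rule incr[OF n])
        show "A \<le> x n (i * 2 ^ (L n - l))" unfolding xj using AB by simp
        have "0 \<le> (B - A) / 2 ^ l" using AB by simp
        then show "x n (i * 2 ^ (L n - l)) \<le> x n (Suc i * 2 ^ (L n - l))" using d by linarith
        have "real (Suc i) \<le> 2 ^ l" using i by (metis Suc_leI of_nat_le_iff of_nat_numeral of_nat_power)
        then have "(B - A) * (real (Suc i) / 2 ^ l) \<le> (B - A) * 1" using AB by (intro mult_left_mono) auto
        then show "x n (Suc i * 2 ^ (L n - l)) \<le> B" unfolding xj by simp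
        have "(2::real) ^ l \<le> 2 ^ L n" using l by (intro power_increasing) auto
        then have "2 ^ l \<le> 2 * sqrt (real n)" using L(2)[OF n] by linarith
        then have "(B - A) * 1 \<le> (B - A) * (2 * sqrt (real n) / 2 ^ l)"
          using AB by (intro mult_left_mono) auto
        then show "B - A \<le> 2 * sqrt (real n) * (x n (Suc i * 2 ^ (L n - l)) - x n (i * 2 ^ (L n - l)))"
          unfolding d by (simp add: mult_ac)
      qed
      also have "(x n (Suc i * 2 ^ (L n - l)) - x n (i * 2 ^ (L n - l))) powr \<kappa> = (B - A) powr \<kappa> * (2 ^ l) powr - \<kappa>"
        unfolding d powr_divide powr_minus_divide by simp
      finally show ?thesis .
    qed
    have "(\<integral>\<omega>. Q a n \<omega> \<partial>M) = (\<Sum>l\<le>L n. \<rho> (L n) l * (\<Sum>i<2 ^ l. \<integral>\<omega>. W a n l i \<omega> \<partial>M))"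
      unfolding Q_def W_def S_def using integrable_sum_powr by (simp add: Bochner_Integration.integral_sum)
    also have "\<dots> \<le> (\<Sum>l\<le>L n. \<rho> (L n) l * (\<Sum>i<(2::nat) ^ l. C * real n powr (q / 2) * ((B - A) powr \<kappa> * (2 ^ l) powr - \<kappa>)))"
      using \<rho> by (intro sum_mono mult_left_mono one) auto
    also have "\<dots> = (C * real n powr (q / 2) * (B - A) powr \<kappa>) * (\<Sum>l\<le>L n. \<rho> (L n) l * 2 ^ l * (2 ^ l) powr - \<kappa>)"
      by (simp add: sum_distrib_left mult_ac)
    also have "\<dots> \<le> (C * real n powr (q / 2) * (B - A) powr \<kappa>) * C'"
      using sum\<rho>[of "L n"] \<kappa> C by (intro mult_left_mono) auto
    finally show ?thesis .
  qed
  show ?thesis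
  proof (rule that[of R K])
    show "integrable M (R a n)" if "1 \<le> n" for a n
      unfolding R_def using intQ integrable_sum_powr(2) by (simp add: S_def)
    show "0 \<le> R a n \<omega>" for a n \<omega>
      unfolding R_def Q_def W_def using \<rho> by (intro mult_nonneg_nonneg add_nonneg_nonneg sum_nonneg) auto
    show "0 \<le> K" unfolding K_def using C C' c0 by simp
    show "(\<integral>\<omega>. R a n \<omega> \<partial>M) \<le> K * real n powr (q / 2)" if n: "1 \<le> n" for a n
    proof -
      have "(\<integral>\<omega>. R a n \<omega> \<partial>M) = 4 powr q * (2 powr q * (\<integral>\<omega>. \<bar>S a n A \<omega>\<bar> powr q \<partial>M) + 2 * (\<integral>\<omega>. Q a n \<omega> \<partial>M) + c powr q * real n powr (q / 2))"
        unfolding R_def using intQ[of a n] integrable_sum_powr(2)[where n = n and a = a and x = A] by (simp add: S_def prob_space)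
      also have "\<dots> \<le> 4 powr q * (2 powr q * (C * real n powr (q / 2)) + 2 * (C * real n powr (q / 2) * (B - A) powr \<kappa> * C') + c powr q * real n powr (q / 2))"
        using base[of a n] by (intro mult_left_mono add_mono EQ[OF n]) (auto simp: S_def)
      also have "\<dots> = K * real n powr (q / 2)" by (simp add: K_def algebra_simps)
      finally show ?thesis .
    qed
    show "\<bar>\<Sum>k<n. \<xi> (a + k) z \<omega>\<bar> powr q \<le> R a n \<omega>" if n: "1 \<le> n" and z: "z \<in> {A..B}" for a n \<omega> z
    proof -
      obtain j where j: "j < 2 ^ L n" "x n j \<le> z" "z \<le> x n (Suc j)"
        using grid_cell[OF AB, of "2 ^ L n" z] z unfolding x_def by auto
      have jb: "A \<le> x n j" "x n (Suc j) \<le> B" "x n 0 = A"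
      proof -
        show "A \<le> x n j" "x n 0 = A" using AB by (auto simp: x_def)
        have "real (Suc j) \<le> 2 ^ L n" using j(1) by (metis Suc_leI of_nat_le_iff of_nat_numeral of_nat_power)
        then have "(B - A) * (real (Suc j) / 2 ^ L n) \<le> (B - A) * 1" using AB by (intro mult_left_mono) auto
        then show "x n (Suc j) \<le> B" by (simp add: x_def)
      qed
      have gap: "C * real n * (x n (Suc j) - x n j) \<le> c * sqrt (real n)"
      proof -
        have "x n (Suc j) - x n j = (B - A) / 2 ^ L n" by (simp add: x_def field_simps)
        also have "\<dots> \<le> (B - A) / sqrt (real n)" using L(1)[OF n] n AB by (intro divide_left_mono) auto
        finally have "C * real n * (x n (Suc j) - x n j) \<le> C * real n * ((B - A) / sqrt (real n))"
          using C by (intro mult_left_mono) auto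
        also have "\<dots> = c * (real n / sqrt (real n))" by (simp add: c_def)
        also have "real n / sqrt (real n) = sqrt (real n)" by (rule real_div_sqrt) simp
        finally show ?thesis .
      qed
      have q1: "\<bar>S a n (x n i) \<omega> - S a n A \<omega>\<bar> powr q \<le> Q a n \<omega>" if "i \<le> 2 ^ L n" for i
        using chain[OF that, of "\<lambda>i. S a n (x n i) \<omega>"] jb(3) by (simp add: Q_def W_def)
      define m where "m = max (max (2 * \<bar>S a n A \<omega>\<bar>) (c * sqrt (real n)))
        (max \<bar>S a n (x n j) \<omega> - S a n A \<omega>\<bar> \<bar>S a n (x n (Suc j)) \<omega> - S a n A \<omega>\<bar>)"
      have "\<bar>S a n z \<omega>\<bar> \<le> \<bar>S a n (x n j) \<omega>\<bar> + \<bar>S a n (x n (Suc j)) \<omega>\<bar> + C * real n * (x n (Suc j) - x n j)"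
        unfolding S_def by (rule cell) (use jb j in auto)
      moreover have "2 * \<bar>S a n A \<omega>\<bar> \<le> m" "c * sqrt (real n) \<le> m" "\<bar>S a n (x n j) \<omega> - S a n A \<omega>\<bar> \<le> m"
        "\<bar>S a n (x n (Suc j)) \<omega> - S a n A \<omega>\<bar> \<le> m"
        by (simp_all add: m_def)
      ultimately have "\<bar>S a n z \<omega>\<bar> \<le> 4 * m" using gap by linarith
      then have "\<bar>S a n z \<omega>\<bar> powr q \<le> (4 * m) powr q" using q by (intro powr_mono2) auto
      also have "\<dots> = 4 powr q * m powr q" by (rule powr_mult)
      also have "m powr q \<le> 2 powr q * \<bar>S a n A \<omega>\<bar> powr q + 2 * Q a n \<omega> + c powr q * real n powr (q / 2)"
      proof -
        have a1: "\<bar>S a n (x n j) \<omega> - S a n A \<omega>\<bar> powr q \<le> Q a n \<omega>" "\<bar>S a n (x n (Suc j)) \<omega> - S a n A \<omega>\<bar> powr q \<le> Q a n \<omega>"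
          using j(1) by (auto intro!: q1)
        have a2: "(c * sqrt (real n)) powr q = c powr q * real n powr (q / 2)"
          by (simp add: powr_mult powr_powr flip: powr_half_sqrt)
        have a3: "(2 * \<bar>S a n A \<omega>\<bar>) powr q = 2 powr q * \<bar>S a n A \<omega>\<bar> powr q" by (simp add: powr_mult)
        have nn: "0 \<le> Q a n \<omega>" using order_trans[OF powr_ge_zero a1(1)] .
        have nn2: "0 \<le> 2 powr q * \<bar>S a n A \<omega>\<bar> powr q" "0 \<le> c powr q * real n powr (q / 2)" by auto
        have "m = 2 * \<bar>S a n A \<omega>\<bar> \<or> m = c * sqrt (real n) \<or> m = \<bar>S a n (x n j) \<omega> - S a n A \<omega>\<bar> \<or> m = \<bar>S a n (x n (Suc j)) \<omega> - S a n A \<omega>\<bar>"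
          unfolding m_def max_def by auto
        then show ?thesis
          using a1 a2 a3 nn nn2 by (elim disjE; simp only:; linarith)
      qed
      finally show ?thesis by (simp add: R_def S_def)
    qed
  qed
qed

theorem uniform_rate:
  "AE \<omega> in M. \<forall>e>0. \<forall>\<^sub>F n in sequentially. \<forall>x\<in>{A..B}. \<bar>\<Sum>k<n. \<xi> k x \<omega>\<bar> \<le> e * (sqrt (real n) * iota_rate q n)"
proof -
  obtain K :: real and R :: "nat \<Rightarrow> nat \<Rightarrow> 'a \<Rightarrow> real" where
    R: "\<And>a n. 1 \<le> n \<Longrightarrow> integrable M (R a n)" "\<And>a n \<omega>. 0 \<le> R a n \<omega>"
    "\<And>a n \<omega> x. 1 \<le> n \<Longrightarrow> x \<in> {A..B} \<Longrightarrow> \<bar>\<Sum>k<n. \<xi> (a + k) x \<omega>\<bar> powr q \<le> R a n \<omega>"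
    "\<And>a n. 1 \<le> n \<Longrightarrow> (\<integral>\<omega>. R a n \<omega> \<partial>M) \<le> K * real n powr (q / 2)" and K: "0 \<le> K"
    by (rule uniform_moment) (rule that)
  have q1: "1 < q" "1 < q / 2 \<or> q / 2 = 1 \<and> q = 2" using q by auto
  \<comment> \<open>The second chaining runs over n. Level l has 2^l blocks of length 2^(d - l),
    with moments proportional to the length to the power q / 2, so here \<kappa> = q / 2.\<close>
  obtain C' :: real and \<rho> :: "nat \<Rightarrow> nat \<Rightarrow> real" where C': "0 \<le> C'" and \<rho>: "\<And>L l. 0 \<le> \<rho> L l"
    and chain: "\<And>L (s :: nat \<Rightarrow> real) j. j \<le> 2 ^ L \<Longrightarrow> \<bar>s j - s 0\<bar> powr q \<le>
      (\<Sum>l\<le>L. \<rho> L l * (\<Sum>i<2 ^ l. \<bar>s (Suc i * 2 ^ (L - l)) - s (i * 2 ^ (L - l))\<bar> powr q))"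
    and sum\<rho>: "\<And>L. (\<Sum>l\<le>L. \<rho> L l * 2 ^ l * (2 ^ l) powr - (q / 2)) \<le> C' * (if 1 < q / 2 then 1 else (real L + 1) powr 2)"
    by (rule dyadic_weights[OF q1]) (rule that)
  have lc: "(if 1 < q / 2 then 1 else (real L + 1) powr 2) = level_count q L" for L
    using q by (auto simp: level_count_def)
  define V where "V d \<omega> = (\<Sum>l\<le>d. \<rho> d l * (\<Sum>i<2 ^ l. R (i * 2 ^ (d - l)) (2 ^ (d - l)) \<omega>))" for d \<omega>
  have V0: "0 \<le> V d \<omega>" for d \<omega>
    unfolding V_def using \<rho> R(2) by (intro sum_nonneg mult_nonneg_nonneg) auto
  have V: "\<bar>\<Sum>k<n. \<xi> k x \<omega>\<bar> powr q \<le> V d \<omega>" if "n \<le> 2 ^ d" "x \<in> {A..B}" for n d x \<omega>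
  proof -
    have split: "(\<Sum>k<c + m. \<xi> k x \<omega>) = (\<Sum>k<c. \<xi> k x \<omega>) + (\<Sum>k<m. \<xi> (c + k) x \<omega>)" for c m
      by (induction m) (simp_all add: add.assoc)
    have block: "(\<Sum>k<Suc i * m. \<xi> k x \<omega>) - (\<Sum>k<i * m. \<xi> k x \<omega>) = (\<Sum>k<m. \<xi> (i * m + k) x \<omega>)" for i m
    proof -
      have "(\<Sum>k<Suc i * m. \<xi> k x \<omega>) = (\<Sum>k<i * m + m. \<xi> k x \<omega>)" by (simp add: add.commute)
      also have "\<dots> = (\<Sum>k<i * m. \<xi> k x \<omega>) + (\<Sum>k<m. \<xi> (i * m + k) x \<omega>)"
        by (rule split)
      finally show ?thesis by simp
    qed
    have "\<bar>(\<Sum>k<n. \<xi> k x \<omega>) - (\<Sum>k<0. \<xi> k x \<omega>)\<bar> powr q \<le> (\<Sum>l\<le>d. \<rho> d l *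
       (\<Sum>i<2 ^ l. \<bar>(\<Sum>k<Suc i * 2 ^ (d - l). \<xi> k x \<omega>) - (\<Sum>k<i * 2 ^ (d - l). \<xi> k x \<omega>)\<bar> powr q))"
      by (rule chain[OF that(1)])
    also have "\<dots> \<le> V d \<omega>"
      unfolding V_def block by (intro sum_mono mult_left_mono R(3) \<rho> that(2)) simp
    finally show ?thesis by simp
  qed
  have Vint: "integrable M (V d)" for d
    unfolding V_def by (intro Bochner_Integration.integrable_sum integrable_mult_right R(1)) simp
  have EV: "(\<integral>\<omega>. V d \<omega> \<partial>M) \<le> K * C' * (2 ^ d) powr (q / 2) * level_count q d" for d
  proof -
    have "(\<integral>\<omega>. V d \<omega> \<partial>M) = (\<Sum>l\<le>d. \<rho> d l * (\<Sum>i<2 ^ l. \<integral>\<omega>. R (i * 2 ^ (d - l)) (2 ^ (d - l)) \<omega> \<partial>M))"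
      unfolding V_def using R(1) by (simp add: Bochner_Integration.integral_sum)
    also have "\<dots> \<le> (\<Sum>l\<le>d. \<rho> d l * (\<Sum>i<(2::nat) ^ l. K * real (2 ^ (d - l)) powr (q / 2)))"
      by (intro sum_mono mult_left_mono R(4) \<rho>) simp
    also have "\<dots> = (\<Sum>l\<le>d. (K * (2 ^ d) powr (q / 2)) * (\<rho> d l * 2 ^ l * (2 ^ l) powr - (q / 2)))"
    proof (intro sum.cong refl)
      fix l assume "l \<in> {..d}"
      then have "(2::real) ^ (d - l) = 2 ^ d / 2 ^ l" by (simp add: power_diff)
      then have "real (2 ^ (d - l)) powr (q / 2) = (2 ^ d / 2 ^ l) powr (q / 2)" by simp
      also have "\<dots> = (2 ^ d) powr (q / 2) * (2 ^ l) powr - (q / 2)"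
        unfolding powr_divide powr_minus_divide by simp
      finally have "real (2 ^ (d - l)) powr (q / 2) = (2 ^ d) powr (q / 2) * (2 ^ l) powr - (q / 2)" .
      then show "\<rho> d l * (\<Sum>i<(2::nat) ^ l. K * real (2 ^ (d - l)) powr (q / 2))
         = (K * (2 ^ d) powr (q / 2)) * (\<rho> d l * 2 ^ l * (2 ^ l) powr - (q / 2))"
        by (simp only: sum_constant card_lessThan of_nat_power of_nat_numeral mult_ac)
    qed
    also have "\<dots> \<le> (K * (2 ^ d) powr (q / 2)) * (C' * level_count q d)"
      unfolding sum_distrib_left[symmetric] using K by (intro mult_left_mono sum\<rho>[unfolded lc]) auto
    finally show ?thesis by (simp add: mult_ac)
  qed
  define N where "N d = sqrt (2 ^ d) * iota_rate q (2 ^ d)" for d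
  \<comment> \<open>For n between 2^d and 2^(d + 1), \<open>V (Suc d)\<close> dominates the sum
    uniformly in x, while the normalisation is taken at the lower end and is therefore the smaller
    one.\<close>
  define Y where "Y d \<omega> = V (Suc d) \<omega> / N d powr q" for d \<omega>
  have "AE \<omega> in M. (\<lambda>d. Y d \<omega>) \<longlonglongrightarrow> 0"
  proof (rule AE_tendsto_0_if_summable_expectation)
    show "integrable M (Y d)" for d unfolding Y_def using Vint by simp
    show "0 \<le> Y d \<omega>" for d \<omega> unfolding Y_def using V0 by simp
    show "summable (\<lambda>d. \<integral>\<omega>. Y d \<omega> \<partial>M)"
    proof (rule summable_comparison_test_ev)
      show "summable (\<lambda>d. K * C' * 2 powr (q / 2) * (level_count q (Suc d) / iota_rate q (2 ^ d) powr q))"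
        by (intro summable_mult summable_rate q)
      show "\<forall>\<^sub>F d in sequentially. norm (\<integral>\<omega>. Y d \<omega> \<partial>M)
          \<le> K * C' * 2 powr (q / 2) * (level_count q (Suc d) / iota_rate q (2 ^ d) powr q)"
        using eventually_ge_at_top[of 2]
      proof eventually_elim
        case (elim d)
        have "(2::nat) ^ 2 \<le> 2 ^ d" using elim by (intro power_increasing) auto
        then have i: "0 < iota_rate q (2 ^ d)" using iota_rate_mono(1)[OF q, of "2 ^ d" "2 ^ d"] by simp
        have N: "N d powr q = (2 ^ d) powr (q / 2) * iota_rate q (2 ^ d) powr q"
          using i by (simp add: N_def powr_mult powr_powr flip: powr_half_sqrt)
        have "(\<integral>\<omega>. Y d \<omega> \<partial>M) = (\<integral>\<omega>. V (Suc d) \<omega> \<partial>M) / N d powr q"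
          using Vint by (simp add: Y_def)
        also have "\<dots> \<le> (K * C' * (2 ^ Suc d) powr (q / 2) * level_count q (Suc d)) / N d powr q"
          by (intro divide_right_mono EV) simp
        also have "\<dots> = K * C' * 2 powr (q / 2) * (level_count q (Suc d) / iota_rate q (2 ^ d) powr q)"
          using i by (simp add: N powr_mult)
        finally have le: "(\<integral>\<omega>. Y d \<omega> \<partial>M) \<le> K * C' * 2 powr (q / 2) * (level_count q (Suc d) / iota_rate q (2 ^ d) powr q)" .
        have "0 \<le> (\<integral>\<omega>. Y d \<omega> \<partial>M)" unfolding Y_def using V0 by (intro Bochner_Integration.integral_nonneg) auto
        with le show ?case by simp
      qed
    qed
  qed
  then show ?thesis
  proof eventually_elim
    case (elim \<omega>)
    show ?case
    proof (intro allI impI)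
      fix e :: real assume e: "0 < e"
      then have "0 < e powr q" by simp
      with elim have "\<forall>\<^sub>F d in sequentially. Y d \<omega> < e powr q" by (rule order_tendstoD(2))
      then obtain d0 where d0: "\<And>d. d0 \<le> d \<Longrightarrow> Y d \<omega> < e powr q"
        unfolding eventually_sequentially by blast
      \<comment> \<open>The added 2 makes 2^d at least 4, where \<open>iota_rate\<close> is positive
        and monotone.\<close>
      have "\<forall>x\<in>{A..B}. \<bar>\<Sum>k<n. \<xi> k x \<omega>\<bar> \<le> e * (sqrt (real n) * iota_rate q n)" if n: "2 ^ (d0 + 2) \<le> n" for n
      proof -
        have "1 \<le> n" using n by (meson one_le_numeral one_le_power order_trans)
        then obtain d where d: "2 ^ d \<le> n" "n < 2 ^ (d + 1)"
          using ex_power_ivl1[of 2 n] by auto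
        have "(2::nat) ^ (d0 + 2) < 2 ^ (d + 1)" using n d by linarith
        then have dd: "d0 + 2 < d + 1" by (rule power_less_imp_less_exp[rotated]) simp
        have "(2::nat) ^ 2 \<le> 2 ^ d" using dd by (intro power_increasing) auto
        then have d4: "4 \<le> (2::nat) ^ d" by simp
        note i = iota_rate_mono[OF q d4 d(1)]
        have rd: "2 ^ d \<le> real n" using d(1) by (metis of_nat_le_iff of_nat_numeral of_nat_power)
        have N: "0 < N d" "N d \<le> sqrt (real n) * iota_rate q n"
          unfolding N_def using i rd by (auto intro!: mult_mono)
        show ?thesis
        proof
          fix x assume x: "x \<in> {A..B}"
          have "\<bar>\<Sum>k<n. \<xi> k x \<omega>\<bar> powr q \<le> V (Suc d) \<omega>"
            by (rule V[OF _ x]) (use d in simp)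
          also have "V (Suc d) \<omega> = Y d \<omega> * N d powr q" using N by (simp add: Y_def)
          also have "\<dots> \<le> e powr q * N d powr q"
            using d0[of d] dd by (intro mult_right_mono) auto
          also have "\<dots> = (e * N d) powr q" by (simp add: powr_mult)
          finally have "\<bar>\<Sum>k<n. \<xi> k x \<omega>\<bar> \<le> e * N d"
            by (rule powr_le_imp_le) (use q e N in auto)
          also have "\<dots> \<le> e * (sqrt (real n) * iota_rate q n)" using N e by (intro mult_left_mono) auto
          finally show "\<bar>\<Sum>k<n. \<xi> k x \<omega>\<bar> \<le> e * (sqrt (real n) * iota_rate q n)" .
        qed
      qed
      then show "\<forall>\<^sub>F n in sequentially. \<forall>x\<in>{A..B}. \<bar>\<Sum>k<n. \<xi> k x \<omega>\<bar> \<le> e * (sqrt (real n) * iota_rate q n)"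
        unfolding eventually_sequentially by blast
    qed
  qed
qed

end

end

subsection \<open>Empirical process of the innovations\<close>

text \<open>The upper bound does not involve q, so comparisons with powers of n concern one explicit
  function. The second part returns from the exponent q + 1 of the martingale part to q.\<close>

lemma iota_rate_bounds:
  assumes q: "2 \<le> q"
  shows "\<forall>\<^sub>F n in sequentially. 1 \<le> iota_rate q n \<and> iota_rate q n \<le> ln (real n) powr (3 / 2) * ln (ln (real n))"
    and "\<forall>\<^sub>F n in sequentially. iota_rate (q + 1) n \<le> iota_rate q n"
proof -
  have ev: "\<forall>\<^sub>F n in sequentially. 1 \<le> ln (real n) \<and> 1 \<le> ln (ln (real n))"
    by (intro eventually_conj) real_asymp+
  show "\<forall>\<^sub>F n in sequentially. 1 \<le> iota_rate q n \<and> iota_rate q n \<le> ln (real n) powr (3 / 2) * ln (ln (real n))"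
    using ev
  proof eventually_elim
    case (elim n)
    have "1 * 1 \<le> ln (real n) powr s * ln (ln (real n)) powr t" if "0 \<le> s" "0 \<le> t" for s t
      using elim that by (intro mult_mono ge_one_powr_ge_zero) auto
    from this[of "3 / 2" 1] this[of "1 / q" "2 / q"] have 1: "1 \<le> iota_rate q n"
      using elim q by (auto simp: iota_rate_def)
    have "iota_rate q n \<le> ln (real n) powr (3 / 2) * ln (ln (real n))"
    proof (cases "q = 2")
      case False
      have "ln (real n) powr (1 / q) * ln (ln (real n)) powr (2 / q) \<le> ln (real n) powr (3 / 2) * ln (ln (real n)) powr 1"
        using elim q by (intro mult_mono powr_mono) (auto simp: field_simps)
      then show ?thesis using False elim by (simp add: iota_rate_def)
    qed (simp add: iota_rate_def)
    with 1 show ?case ..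
  qed
  show "\<forall>\<^sub>F n in sequentially. iota_rate (q + 1) n \<le> iota_rate q n"
    using ev
  proof eventually_elim
    case (elim n)
    show ?case
    proof (cases "q = 2")
      case True
      have "ln (real n) powr (1 / 3) * ln (ln (real n)) powr (2 / 3) \<le> ln (real n) powr (3 / 2) * ln (ln (real n)) powr 1"
        using elim by (intro mult_mono powr_mono) auto
      then show ?thesis using True elim by (simp add: iota_rate_def)
    next
      case False
      have "ln (real n) powr (1 / (q + 1)) * ln (ln (real n)) powr (2 / (q + 1)) \<le> ln (real n) powr (1 / q) * ln (ln (real n)) powr (2 / q)"
        using elim q by (intro mult_mono powr_mono) (auto intro!: divide_left_mono)
      then show ?thesis using False q by (simp add: iota_rate_def)
    qed
  qed
qed

context linear_noise
begin

text \<open>In the application this is almost surely X at time k + 1: the shift lets sums over k < n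
  run through the sample, and \<open>tail (int k) 0\<close> is known at time k.\<close>

definition obs :: "nat \<Rightarrow> 'a \<Rightarrow> real" where
  "obs k \<omega> = \<epsilon> (int k + 1) \<omega> + tail (int k) 0 \<omega>"

text \<open>The conditional probability that the next observation lies in S when its predictable
  part equals t.\<close>

definition cprob :: "real set \<Rightarrow> real \<Rightarrow> real" where
  "cprob S t = (\<integral>e. indicator S (e + t) \<partial>\<mu>)"

definition innov :: "real set \<Rightarrow> nat \<Rightarrow> 'a \<Rightarrow> real" where
  "innov S k \<omega> = indicator S (obs k \<omega>) - cprob S (tail (int k) 0 \<omega>)"

lemma obs_measurable [measurable]: "obs k \<in> borel_measurable M"
  unfolding obs_def by measurable

lemma integrable_indicator_shift [simp]:
  "S \<in> sets borel \<Longrightarrow> integrable \<mu> (\<lambda>e. indicator S (e + t) :: real)"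
  by (rule mu.integrable_const_bound[where B = 1]) (auto simp: indicator_def)

lemma cprob_bounds: "S \<in> sets borel \<Longrightarrow> 0 \<le> cprob S t" "S \<in> sets borel \<Longrightarrow> cprob S t \<le> 1"
proof -
  show "0 \<le> cprob S t" unfolding cprob_def by (rule Bochner_Integration.integral_nonneg) simp
  assume S: "S \<in> sets borel"
  have "cprob S t \<le> (\<integral>e. 1 \<partial>\<mu>)"
    unfolding cprob_def
    by (rule integral_mono[OF integrable_indicator_shift[OF S] mu.integrable_const]) (rule indicator_le_1)
  then show "cprob S t \<le> 1" by simp
qed

lemma cprob_atMost: "cprob {..x} t = cdf \<mu> (x - t)"
proof -
  have "cprob {..x} t = (\<integral>e. indicator {..x - t} e \<partial>\<mu>)"
    unfolding cprob_def by (rule Bochner_Integration.integral_cong) (auto simp: indicator_def)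
  then show ?thesis by (simp add: cdf_def)
qed

lemma innov_diff:
  assumes "x \<le> y"
  shows "innov {x<..y} k \<omega> = innov {..y} k \<omega> - innov {..x} k \<omega>"
proof -
  have ind: "indicator {x<..y} z = (indicator {..y} z - indicator {..x} z :: real)" for z
    using assms by (auto simp: indicator_def)
  show ?thesis unfolding innov_def cprob_def ind by simp
qed

context
  fixes S :: "real set" and v :: real
  assumes S [measurable]: "S \<in> sets borel" and v: "\<And>t. cprob S t \<le> v"
begin

text \<open>\<open>innov S k\<close> with the fresh noise split off as e, the form in which the
  martingale inequalities apply.\<close>

definition inc :: "nat \<Rightarrow> 'a \<Rightarrow> real \<Rightarrow> real" where
  "inc k \<omega> e = indicator S (e + tail (int k) 0 \<omega>) - cprob S (tail (int k) 0 \<omega>)"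

lemma inc_measurable:
  assumes "int k < l"
  shows "(\<lambda>(\<omega>, e). inc k \<omega> e) \<in> borel_measurable (past l \<Otimes>\<^sub>M borel)"
proof -
  note [measurable] = tail_measurable_past[of "int k" 0 l, simplified, OF assms]
  have 1: "(\<lambda>(\<omega>, e). indicator S (e + tail (int k) 0 \<omega>) :: real) \<in> borel_measurable (past l \<Otimes>\<^sub>M borel)"
    by measurable
  have [measurable]: "(\<lambda>\<omega>. cprob S (tail (int k) 0 \<omega>)) \<in> borel_measurable (past l)"
    unfolding cprob_def by (rule integral_past(2)[OF 1, where B = 1]) (simp add: indicator_def)
  show ?thesis unfolding inc_def by measurable
qed

lemma inc_bound: "\<bar>inc k \<omega> e\<bar> \<le> 1"
  using cprob_bounds[OF S, of "tail (int k) 0 \<omega>"] by (auto simp: inc_def indicator_def)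

lemma inc_mean: "(\<integral>e. inc k \<omega> e \<partial>\<mu>) = 0"
  unfolding inc_def by (simp add: cprob_def S)

lemma inc_integrable: "integrable \<mu> (inc k \<omega>)"
  unfolding inc_def by (simp add: S)

lemma inc_var: "(\<integral>e. (inc k \<omega> e)\<^sup>2 \<partial>\<mu>) \<le> v"
proof -
  let ?t = "tail (int k) 0 \<omega>"
  \<comment> \<open>An indicator is its own square, so integration leaves the Bernoulli variance P -
    P^2, which is at most P.\<close>
  have "(inc k \<omega> e)\<^sup>2 = (1 - 2 * cprob S ?t) * indicator S (e + ?t) + (cprob S ?t)\<^sup>2" for e
    by (auto simp: inc_def indicator_def power2_eq_square algebra_simps)
  then have "(\<integral>e. (inc k \<omega> e)\<^sup>2 \<partial>\<mu>) = (1 - 2 * cprob S ?t) * cprob S ?t + (cprob S ?t)\<^sup>2"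
    by (simp add: cprob_def[of S ?t] S)
  also have "\<dots> = cprob S ?t - (cprob S ?t)\<^sup>2" by (simp add: algebra_simps power2_eq_square)
  also have "\<dots> \<le> v" using v[of ?t] zero_le_power2[of "cprob S ?t"] by linarith
  finally show ?thesis .
qed

text \<open>The increments are bounded by 1, so every higher moment is below the variance and the
  exponent p is free.\<close>

lemma inc_powr:
  assumes p: "2 \<le> p"
  shows "(\<integral>e. \<bar>inc k \<omega> e\<bar> powr p \<partial>\<mu>) \<le> v"
proof -
  have "\<bar>inc k \<omega> e\<bar> powr p \<le> (inc k \<omega> e)\<^sup>2" for e
  proof -
    have "\<bar>inc k \<omega> e\<bar> powr p \<le> \<bar>inc k \<omega> e\<bar> powr 2"
      by (rule powr_mono') (use p inc_bound in auto)
    then show ?thesis by simp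
  qed
  moreover have "integrable \<mu> (\<lambda>e. (inc k \<omega> e)\<^sup>2)"
    by (rule mu.integrable_const_bound[where B = 1])
       (use inc_bound inc_integrable in \<open>auto simp: abs_square_le_1\<close>)
  ultimately have "(\<integral>e. \<bar>inc k \<omega> e\<bar> powr p \<partial>\<mu>) \<le> (\<integral>e. (inc k \<omega> e)\<^sup>2 \<partial>\<mu>)"
    by (intro integral_mono') auto
  also have "\<dots> \<le> v" by (rule inc_var)
  finally show ?thesis .
qed

lemma innov_eq_inc: "innov S (a + j) \<omega> = inc (a + j) \<omega> (\<epsilon> (int a + 1 + int j) \<omega>)"
  by (simp add: innov_def inc_def obs_def add_ac)

lemma innov_moment:
  assumes p: "2 \<le> p" and v0: "0 < v"
  shows "(\<integral>\<omega>. \<bar>\<Sum>j<n. innov S (a + j) \<omega>\<bar> powr p \<partial>M)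
    \<le> moment_const p * ((real n * v) powr (p / 2) + real n * v)"
  unfolding innov_eq_inc
  by (rule martingale_moment[where B = 1])
     (use inc_measurable inc_bound inc_mean inc_var inc_powr p v0 in auto)

lemma innov_exp_moment:
  assumes r: "\<bar>r\<bar> \<le> 1"
  shows "(\<integral>\<omega>. exp (r * (\<Sum>j<n. innov S (a + j) \<omega>)) \<partial>M) \<le> exp (real n * r\<^sup>2 * v)"
  unfolding innov_eq_inc
  by (rule martingale_exp_moment[where B = 1])
     (use inc_measurable inc_bound inc_mean inc_var r in auto)

end

lemma innov_measurable [measurable]:
  assumes [measurable]: "S \<in> sets borel"
  shows "innov S k \<in> borel_measurable M"
proof -
  have "innov S (k + 0) \<in> borel_measurable M"
    unfolding innov_eq_inc[OF assms cprob_bounds(2)[OF assms], of k 0]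
    by (rule measurable_pastD, rule eval_measurable_past[where k = "int k + 1 + int 0" and l = "int k + 2"])
       (use inc_measurable[OF assms cprob_bounds(2)[OF assms]] in auto)
  then show ?thesis by simp
qed

lemma innov_bound: "S \<in> sets borel \<Longrightarrow> \<bar>innov S k \<omega>\<bar> \<le> 1"
  using cprob_bounds[of S "tail (int k) 0 \<omega>"] by (auto simp: innov_def indicator_def)

lemma sum_innov_bound: "S \<in> sets borel \<Longrightarrow> \<bar>\<Sum>k<n. innov S k \<omega>\<bar> \<le> real n"
  using sum_mono[of "{..<n}" "\<lambda>k. \<bar>innov S k \<omega>\<bar>" "\<lambda>_. 1"] innov_bound[of S _ \<omega>]
  by (intro order_trans[OF sum_abs]) auto

lemma bdd_lip_shift:
  assumes g: "bdd_lip K g"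
  shows "bdd_lip K (\<lambda>t. g (x - t))"
  unfolding bdd_lip_def
proof (intro conjI allI)
  show "\<bar>g (x - t)\<bar> \<le> K" for t by (rule bdd_lipD(1)[OF g])
  show "\<bar>g (x - s) - g (x - t)\<bar> \<le> K * \<bar>s - t\<bar>" for s t
    using bdd_lipD(2)[OF g, of "x - s" "x - t"] by (simp add: abs_minus_commute)
qed

lemma integrable_tail:
  assumes g: "bdd_lip K g"
  shows "integrable M (\<lambda>\<omega>. g (x - tail k 0 \<omega>))"
proof (rule integrable_const_bound[where B = K])
  note [measurable] = bdd_lip_measurable[OF g]
  show "(\<lambda>\<omega>. g (x - tail k 0 \<omega>)) \<in> borel_measurable M" by measurable
  show "AE \<omega> in M. norm (g (x - tail k 0 \<omega>)) \<le> K" using bdd_lipD(1)[OF g] by simp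
qed

lemma bdd_lip_pred_mean:
  assumes g: "bdd_lip K g"
  shows "bdd_lip K (\<lambda>x. pred_mean (\<lambda>t. g (x - t)))"
proof -
  note int = integrable_tail[OF g]
  have "\<bar>pred_mean (\<lambda>t. g (x - t))\<bar> \<le> K" for x
  proof -
    have "\<bar>pred_mean (\<lambda>t. g (x - t))\<bar> \<le> (\<integral>\<omega>. \<bar>g (x - tail 0 0 \<omega>)\<bar> \<partial>M)"
      unfolding pred_mean_def by (rule integral_abs_bound)
    also have "\<dots> \<le> (\<integral>\<omega>. K \<partial>M)"
      by (rule integral_mono) (use int bdd_lipD(1)[OF g] in auto)
    finally show ?thesis by (simp add: prob_space)
  qed
  moreover have "\<bar>pred_mean (\<lambda>t. g (x - t)) - pred_mean (\<lambda>t. g (y - t))\<bar> \<le> K * \<bar>x - y\<bar>" for x y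
  proof -
    have eq: "pred_mean (\<lambda>t. g (x - t)) - pred_mean (\<lambda>t. g (y - t)) = (\<integral>\<omega>. g (x - tail 0 0 \<omega>) - g (y - tail 0 0 \<omega>) \<partial>M)"
      unfolding pred_mean_def using int by simp
    have "\<bar>\<integral>\<omega>. g (x - tail 0 0 \<omega>) - g (y - tail 0 0 \<omega>) \<partial>M\<bar> \<le> (\<integral>\<omega>. \<bar>g (x - tail 0 0 \<omega>) - g (y - tail 0 0 \<omega>)\<bar> \<partial>M)"
      by (rule integral_abs_bound)
    also have "\<dots> \<le> (\<integral>\<omega>. K * \<bar>x - y\<bar> \<partial>M)"
    proof (rule integral_mono)
      show "\<bar>g (x - tail 0 0 \<omega>) - g (y - tail 0 0 \<omega>)\<bar> \<le> K * \<bar>x - y\<bar>" for \<omega>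
        using bdd_lipD(2)[OF g, of "x - tail 0 0 \<omega>" "y - tail 0 0 \<omega>"] by simp
    qed (use int in auto)
    finally show ?thesis unfolding eq by (simp add: prob_space)
  qed
  ultimately show ?thesis by (simp add: bdd_lip_def)
qed

text \<open>As a function of t, the difference g (y - t) - g (x - t) has \<open>bdd_lip\<close>
  constant K * (y - x): its size is controlled by the slope of g and its slope by that of g'. The
  moment inequality therefore gains \<open>(y - x) powr q\<close>, and the chaining in x has
  \<kappa> = q.\<close>

lemma predictor_rate:
  fixes g g' :: "real \<Rightarrow> real" and A B :: real
  assumes AB: "A < B" and deriv: "\<And>x. (g has_real_derivative g' x) (at x)"
    and g: "bdd_lip K g" and g': "bdd_lip K g'"
  shows "AE \<omega> in M. \<forall>e>0. \<forall>\<^sub>F n in sequentially. \<forall>x\<in>{A..B}.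
    \<bar>\<Sum>k<n. g (x - tail (int k) 0 \<omega>) - pred_mean (\<lambda>t. g (x - t))\<bar> \<le> e * (sqrt (real n) * iota_rate q n)"
proof -
  define C where "C = max (2 * K) (pred_const * K powr q)"
  note K = bdd_lipD(3)[OF g]
  have C: "0 \<le> C" "2 * K \<le> C" "pred_const * K powr q \<le> C" using K by (auto simp: C_def)
  note [measurable] = bdd_lip_measurable[OF g]
  note shift = bdd_lip_shift[OF g] and int = integrable_tail[OF g] and mean = bdd_lipD[OF bdd_lip_pred_mean[OF g]]
  have "AE \<omega> in M. \<forall>e>0. \<forall>\<^sub>F n in sequentially. \<forall>x\<in>{A..B}.
    \<bar>\<Sum>k<n. (\<lambda>k x \<omega>. g (x - tail (int k) 0 \<omega>) - pred_mean (\<lambda>t. g (x - t))) k x \<omega>\<bar> \<le> e * (sqrt (real n) * iota_rate q n)"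
  proof (rule uniform_rate[where \<kappa> = q and C = C and D = "2 * K"])
    show "(\<lambda>\<omega>. g (x - tail (int k) 0 \<omega>) - pred_mean (\<lambda>t. g (x - t))) \<in> borel_measurable M" for k x
      by measurable
    show "\<bar>g (x - tail (int k) 0 \<omega>) - pred_mean (\<lambda>t. g (x - t))\<bar> \<le> 2 * K" for k x \<omega>
      using mean(1)[of x] bdd_lipD(1)[OF g, of "x - tail (int k) 0 \<omega>"] by linarith
    show "(\<integral>\<omega>. \<bar>\<Sum>k<n. g (A - tail (int (a + k)) 0 \<omega>) - pred_mean (\<lambda>t. g (A - t))\<bar> powr q \<partial>M) \<le> C * real n powr (q / 2)" for a n
    proof -
      have "(\<integral>\<omega>. \<bar>\<Sum>k<n. g (A - tail (int a + int k) 0 \<omega>) - pred_mean (\<lambda>t. g (A - t))\<bar> powr q \<partial>M) \<le> pred_const * K powr q * real n powr (q / 2)"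
        by (rule predictor_moment[OF shift])
      also have "\<dots> \<le> C * real n powr (q / 2)" by (rule mult_right_mono[OF C(3)]) simp
      finally show ?thesis by simp
    qed
    show "(\<integral>\<omega>. \<bar>(\<Sum>k<n. g (y - tail (int (a + k)) 0 \<omega>) - pred_mean (\<lambda>t. g (y - t)))
        - (\<Sum>k<n. g (x - tail (int (a + k)) 0 \<omega>) - pred_mean (\<lambda>t. g (x - t)))\<bar> powr q \<partial>M)
        \<le> C * real n powr (q / 2) * (y - x) powr q" if "x \<le> y" for a n x y
    proof -
      define G where "G t = g (y - t) - g (x - t)" for t
      have G: "bdd_lip (K * (y - x)) G"
        unfolding bdd_lip_def
      proof (intro conjI allI)
        show "\<bar>G t\<bar> \<le> K * (y - x)" for t
          using bdd_lipD(2)[OF g, of "y - t" "x - t"] that by (simp add: G_def)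
        fix s t
        show "\<bar>G s - G t\<bar> \<le> K * (y - x) * \<bar>s - t\<bar>"
        proof (cases "x = y")
          case False
          \<comment> \<open>With s and t fixed, the mean value theorem in z turns the double
            difference of g into y - x times a difference of g' at distance |s - t|.\<close>
          define h where "h z = g (z - s) - g (z - t)" for z
          have "(h has_real_derivative g' (z - s) - g' (z - t)) (at z)" for z
            unfolding h_def by (auto intro!: derivative_eq_intros deriv DERIV_chain'[where f = "\<lambda>z. z - _"])
          moreover have "x < y" using that False by simp
          ultimately obtain z where "h y - h x = (y - x) * (g' (z - s) - g' (z - t))"
            using MVT2[of x y h "\<lambda>z. g' (z - s) - g' (z - t)"] by blast
          then have "\<bar>h y - h x\<bar> = (y - x) * \<bar>g' (z - s) - g' (z - t)\<bar>" using that by (simp add: abs_mult)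
          also have "\<dots> \<le> (y - x) * (K * \<bar>s - t\<bar>)"
            using bdd_lipD(2)[OF g', of "z - s" "z - t"] that by (intro mult_left_mono) (auto simp: abs_minus_commute)
          finally show ?thesis by (simp add: G_def h_def algebra_simps)
        qed (simp add: G_def)
      qed
      have "pred_mean G = pred_mean (\<lambda>t. g (y - t)) - pred_mean (\<lambda>t. g (x - t))"
        unfolding pred_mean_def G_def using int by simp
      then have eq: "(\<Sum>k<n. g (y - tail (int (a + k)) 0 \<omega>) - pred_mean (\<lambda>t. g (y - t)))
        - (\<Sum>k<n. g (x - tail (int (a + k)) 0 \<omega>) - pred_mean (\<lambda>t. g (x - t))) = (\<Sum>k<n. G (tail (int a + int k) 0 \<omega>) - pred_mean G)" for \<omega>
        unfolding sum_subtractf[symmetric] by (intro sum.cong refl) (simp add: G_def)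
      have "(\<integral>\<omega>. \<bar>\<Sum>k<n. G (tail (int a + int k) 0 \<omega>) - pred_mean G\<bar> powr q \<partial>M)
          \<le> pred_const * (K * (y - x)) powr q * real n powr (q / 2)"
        by (rule predictor_moment[OF G])
      also have "\<dots> = pred_const * K powr q * (real n powr (q / 2) * (y - x) powr q)"
        by (simp add: powr_mult)
      also have "\<dots> \<le> C * (real n powr (q / 2) * (y - x) powr q)"
        by (rule mult_right_mono[OF C(3)]) simp
      finally show ?thesis unfolding eq by (simp add: mult.assoc)
    qed
    show "\<bar>\<Sum>k<n. g (x - tail (int (a + k)) 0 \<omega>) - pred_mean (\<lambda>t. g (x - t))\<bar>
      \<le> \<bar>\<Sum>k<n. g (u - tail (int (a + k)) 0 \<omega>) - pred_mean (\<lambda>t. g (u - t))\<bar>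
        + \<bar>\<Sum>k<n. g (v - tail (int (a + k)) 0 \<omega>) - pred_mean (\<lambda>t. g (v - t))\<bar> + C * real n * (v - u)"
      if uv: "u \<le> x" "x \<le> v" for a n x u v \<omega>
    proof -
      have one: "\<bar>(g (x - tail (int (a + k)) 0 \<omega>) - pred_mean (\<lambda>t. g (x - t))) - (g (u - tail (int (a + k)) 0 \<omega>) - pred_mean (\<lambda>t. g (u - t)))\<bar> \<le> C * (v - u)" for k
      proof -
        have "\<bar>(g (x - tail (int (a + k)) 0 \<omega>) - pred_mean (\<lambda>t. g (x - t))) - (g (u - tail (int (a + k)) 0 \<omega>) - pred_mean (\<lambda>t. g (u - t)))\<bar> \<le> K * (x - u) + K * (x - u)"
          using mean(2)[of x u] bdd_lipD(2)[OF g, of "x - tail (int (a + k)) 0 \<omega>" "u - tail (int (a + k)) 0 \<omega>"] uv by simp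
        also have "\<dots> = 2 * K * (x - u)" by simp
        also have "\<dots> \<le> C * (v - u)" using C uv K by (intro mult_mono) auto
        finally show ?thesis .
      qed
      have "\<bar>(\<Sum>k<n. g (x - tail (int (a + k)) 0 \<omega>) - pred_mean (\<lambda>t. g (x - t))) - (\<Sum>k<n. g (u - tail (int (a + k)) 0 \<omega>) - pred_mean (\<lambda>t. g (u - t)))\<bar> \<le> (\<Sum>k<n. C * (v - u))"
        unfolding sum_subtractf[symmetric] by (intro order_trans[OF sum_abs] sum_mono one)
      then show ?thesis by (simp add: mult_ac)
    qed
  qed (use AB q C in auto)
  then show ?thesis by simp
qed

end

locale bounded_density_noise = linear_noise M \<epsilon> \<mu> b \<alpha> q
  for M :: "'a measure" and \<epsilon> \<mu> b \<alpha> q +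
  fixes c :: real
  assumes c: "1 \<le> c" and cdf_lip: "\<And>x y. x \<le> y \<Longrightarrow> cdf \<mu> y - cdf \<mu> x \<le> c * (y - x)"
begin

lemma cprob_atMost_mono:
  assumes "x \<le> y"
  shows "cprob {..x} t \<le> cprob {..y} t" "cprob {..y} t - cprob {..x} t \<le> c * (y - x)"
proof -
  interpret finite_borel_measure \<mu>
    by unfold_locales simp
  show "cprob {..x} t \<le> cprob {..y} t" unfolding cprob_atMost by (rule cdf_nondecreasing) (use assms in simp)
  show "cprob {..y} t - cprob {..x} t \<le> c * (y - x)" unfolding cprob_atMost using cdf_lip[of "x - t" "y - t"] assms by simp
qed

lemma cprob_interval:
  assumes "x \<le> y"
  shows "cprob {x<..y} t \<le> c * (y - x)"
proof -
  have ind: "indicator {x<..y} z = (indicator {..y} z - indicator {..x} z :: real)" for z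
    using assms by (auto simp: indicator_def)
  have "cprob {x<..y} t = cprob {..y} t - cprob {..x} t" unfolding cprob_def ind by simp
  then show ?thesis using cprob_atMost_mono(2)[OF assms] by simp
qed

text \<open>The indicator is monotone in x and the compensator moves by at most c * (v - u), so the
  values at grid points control everything between them.\<close>

lemma sum_innov_le:
  assumes "finite I" "u \<le> x" "x \<le> v"
  shows "(\<Sum>k\<in>I. innov {..x} k \<omega>) \<le> (\<Sum>k\<in>I. innov {..v} k \<omega>) + c * real (card I) * (v - u)"
    and "(\<Sum>k\<in>I. innov {..u} k \<omega>) - c * real (card I) * (v - u) \<le> (\<Sum>k\<in>I. innov {..x} k \<omega>)"
proof -
  have lip: "cprob {..v} t - cprob {..u} t \<le> c * (v - u)" "cprob {..u} t \<le> cprob {..x} t" "cprob {..x} t \<le> cprob {..v} t" for t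
    using cprob_atMost_mono[of u v t] cprob_atMost_mono(1)[of u x t] cprob_atMost_mono(1)[of x v t] assms by auto
  have 1: "innov {..x} k \<omega> \<le> innov {..v} k \<omega> + c * (v - u)" for k
    using lip[of "tail (int k) 0 \<omega>"] assms by (auto simp: innov_def indicator_def)
  have 2: "innov {..u} k \<omega> - c * (v - u) \<le> innov {..x} k \<omega>" for k
    using lip[of "tail (int k) 0 \<omega>"] assms by (auto simp: innov_def indicator_def)
  show "(\<Sum>k\<in>I. innov {..x} k \<omega>) \<le> (\<Sum>k\<in>I. innov {..v} k \<omega>) + c * real (card I) * (v - u)"
    using sum_mono[where K = I, OF 1] by (simp add: sum.distrib mult_ac)
  show "(\<Sum>k\<in>I. innov {..u} k \<omega>) - c * real (card I) * (v - u) \<le> (\<Sum>k\<in>I. innov {..x} k \<omega>)"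
    using sum_mono[where K = I, OF 2] by (simp add: sum_subtractf mult_ac)
qed

lemma innov_rate:
  assumes AB: "2 \<le> B - A"
  shows "AE \<omega> in M. \<forall>e>0. \<forall>\<^sub>F n in sequentially. \<forall>x\<in>{A..B}. \<bar>\<Sum>k<n. innov {..x} k \<omega>\<bar> \<le> e * (sqrt (real n) * iota_rate q n)"
proof -
  \<comment> \<open>For q = 2 the exponent q itself would give the critical \<kappa> = q / 2 = 1 in
    the chaining over x. Bounded increments allow the larger p, and the resulting rate is eventually
    no larger.\<close>
  define p where "p = q + 1"
  have p: "2 < p" using q by (simp add: p_def)
  define C where "C = max c (2 * moment_const p * c powr (p / 2))"
  have mc: "0 \<le> moment_const p" using p by (intro moment_const_nonneg) simp
  have C: "c \<le> C" "2 * moment_const p * c powr (p / 2) \<le> C" by (auto simp: C_def)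
  have "1 \<le> c powr (p / 2)" using c p by (intro ge_one_powr_ge_zero) auto
  then have "2 * moment_const p * 1 \<le> 2 * moment_const p * c powr (p / 2)"
    using mc by (intro mult_left_mono) auto
  then have C2: "2 * moment_const p \<le> C" using C(2) by simp
  have "AE \<omega> in M. \<forall>e>0. \<forall>\<^sub>F n in sequentially. \<forall>x\<in>{A..B}. \<bar>\<Sum>k<n. (\<lambda>k x. innov {..x} k) k x \<omega>\<bar> \<le> e * (sqrt (real n) * iota_rate p n)"
  proof (rule uniform_rate[where \<kappa> = "p / 2" and C = C and D = 1])
    show "(\<integral>\<omega>. \<bar>\<Sum>k<n. innov {..A} (a + k) \<omega>\<bar> powr p \<partial>M) \<le> C * real n powr (p / 2)" for a n
    proof (cases "n = 0")
      case False
      have "(\<integral>\<omega>. \<bar>\<Sum>k<n. innov {..A} (a + k) \<omega>\<bar> powr p \<partial>M) \<le> moment_const p * ((real n * 1) powr (p / 2) + real n * 1)"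
        by (rule innov_moment) (use p cprob_bounds in auto)
      also have "\<dots> \<le> moment_const p * (real n powr (p / 2) + real n powr (p / 2))"
      proof (intro mult_left_mono add_mono mc)
        have "real n powr 1 \<le> real n powr (p / 2)" using False p by (intro powr_mono) auto
        then show "real n * 1 \<le> real n powr (p / 2)" by simp
      qed simp
      also have "\<dots> = 2 * moment_const p * real n powr (p / 2)" by simp
      also have "\<dots> \<le> C * real n powr (p / 2)" by (rule mult_right_mono[OF C2]) simp
      finally show ?thesis .
    qed (use p in simp)
    show "(\<integral>\<omega>. \<bar>(\<Sum>k<n. innov {..y} (a + k) \<omega>) - (\<Sum>k<n. innov {..x} (a + k) \<omega>)\<bar> powr p \<partial>M)
      \<le> C * real n powr (p / 2) * (y - x) powr (p / 2)"
      if n: "1 \<le> n" and xy: "x \<le> y" and gap: "B - A \<le> 2 * sqrt (real n) * (y - x)" for a n x y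
    proof -
      define v where "v = c * (y - x)"
      \<comment> \<open>Together with c \<ge> 1 this makes n * v at least 1, so that the linear term
        of the martingale inequality is dominated by its power p / 2.\<close>
      have sq: "1 \<le> sqrt (real n) * (y - x)" using gap AB by simp
      have ne: "x \<noteq> y" using sq by auto
      have v0: "0 < v" using c xy ne by (simp add: v_def)
      have sn: "1 \<le> sqrt (real n)" using n by simp
      have "sqrt (real n) * (y - x) * 1 \<le> sqrt (real n) * (y - x) * (sqrt (real n) * c)"
        using sq sn c mult_mono[of 1 "sqrt (real n)" 1 c] by (intro mult_left_mono) auto
      also have "\<dots> = (sqrt (real n) * sqrt (real n)) * v" unfolding v_def by (simp only: mult_ac)
      also have "\<dots> = real n * v" by simp
      finally have nv: "1 \<le> real n * v" using sq by linarith
      have eq: "(\<Sum>k<n. innov {..y} (a + k) \<omega>) - (\<Sum>k<n. innov {..x} (a + k) \<omega>) = (\<Sum>k<n. innov {x<..y} (a + k) \<omega>)" for \<omega>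
        unfolding innov_diff[OF xy] by (simp add: sum_subtractf)
      have "(\<integral>\<omega>. \<bar>\<Sum>k<n. innov {x<..y} (a + k) \<omega>\<bar> powr p \<partial>M) \<le> moment_const p * ((real n * v) powr (p / 2) + real n * v)"
        by (rule innov_moment) (use p v0 cprob_interval[OF xy] in \<open>auto simp: v_def\<close>)
      also have "\<dots> \<le> moment_const p * ((real n * v) powr (p / 2) + (real n * v) powr (p / 2))"
      proof (intro mult_left_mono add_mono mc)
        have "(real n * v) powr 1 \<le> (real n * v) powr (p / 2)" using nv p by (intro powr_mono) auto
        then show "real n * v \<le> (real n * v) powr (p / 2)" using nv by simp
      qed simp
      also have "\<dots> = 2 * moment_const p * c powr (p / 2) * (real n powr (p / 2) * (y - x) powr (p / 2))"
        by (simp add: v_def powr_mult)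
      also have "\<dots> \<le> C * (real n powr (p / 2) * (y - x) powr (p / 2))"
        by (rule mult_right_mono[OF C(2)]) simp
      finally show ?thesis unfolding eq by (simp add: mult.assoc)
    qed
    show "\<bar>\<Sum>k<n. innov {..x} (a + k) \<omega>\<bar> \<le> \<bar>\<Sum>k<n. innov {..u} (a + k) \<omega>\<bar> + \<bar>\<Sum>k<n. innov {..v} (a + k) \<omega>\<bar> + C * real n * (v - u)"
      if uv: "u \<le> x" "x \<le> v" for a n x u v \<omega>
    proof -
      have re: "(\<Sum>k<n. innov S (a + k) \<omega>) = (\<Sum>k\<in>(+) a ` {..<n}. innov S k \<omega>)" for S
        by (simp add: sum.reindex)
      have card: "card ((+) a ` {..<n}) = n" by (simp add: card_image)
      have "c * real n * (v - u) \<le> C * real n * (v - u)" using C uv by (intro mult_right_mono) auto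
      then show ?thesis
        unfolding re using sum_innov_le[of "(+) a ` {..<n}" u x v \<omega>] uv unfolding card by simp
    qed
  qed (use AB p c C innov_bound in auto)
  then have *: "AE \<omega> in M. \<forall>e>0. \<forall>\<^sub>F n in sequentially. \<forall>x\<in>{A..B}. \<bar>\<Sum>k<n. innov {..x} k \<omega>\<bar> \<le> e * (sqrt (real n) * iota_rate p n)"
    by simp
  then show ?thesis
  proof eventually_elim
    case (elim \<omega>)
    show ?case
    proof (intro allI impI)
      fix e :: real assume e: "0 < e"
      then have "\<forall>\<^sub>F n in sequentially. \<forall>x\<in>{A..B}. \<bar>\<Sum>k<n. innov {..x} k \<omega>\<bar> \<le> e * (sqrt (real n) * iota_rate p n)"
        using elim by blast
      then show "\<forall>\<^sub>F n in sequentially. \<forall>x\<in>{A..B}. \<bar>\<Sum>k<n. innov {..x} k \<omega>\<bar> \<le> e * (sqrt (real n) * iota_rate q n)"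
        using iota_rate_bounds(2)[OF q]
      proof eventually_elim
        case (elim n)
        have "e * (sqrt (real n) * iota_rate p n) \<le> e * (sqrt (real n) * iota_rate q n)"
          using elim(2) e by (intro mult_left_mono) (auto simp: p_def)
        then show ?case using elim(1) by force
      qed
    qed
  qed
qed

text \<open>The conditional variance of n increments over an interval of length iota / sqrt n has
  order sqrt n * iota; the logarithm pays for the union over the grid.\<close>

definition osc_rate :: "nat \<Rightarrow> real" where
  "osc_rate n = sqrt (sqrt (real n) * iota_rate q n * ln (real n))"

text \<open>An exponential bound for all pairs of grid points at once. The distance is twice the one
  finally needed, because points are replaced by the ends of their cells.\<close>

lemma innov_oscillation_grid:
  fixes x :: "nat \<Rightarrow> nat \<Rightarrow> real"
  assumes mono: "\<And>n i j. i \<le> j \<Longrightarrow> x n i \<le> x n j"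
  shows "AE \<omega> in M. \<forall>\<^sub>F n in sequentially. \<forall>i\<le>n. \<forall>j\<le>n. \<bar>x n i - x n j\<bar> \<le> 2 * (iota_rate q n / sqrt (real n)) \<longrightarrow>
    \<bar>(\<Sum>k<n. innov {..x n i} k \<omega>) - (\<Sum>k<n. innov {..x n j} k \<omega>)\<bar> \<le> (2 * c + 4) * osc_rate n"
proof -
  \<comment> \<open>Chosen so that both sides balance: with v = 2 * c * iota / sqrt n the
    exponential moment is at most n^(2 * c), and ln n / r is \<open>osc_rate n\<close>.\<close>
  define r where "r n = sqrt (ln (real n) / (sqrt (real n) * iota_rate q n))" for n
  define P where "P n = {(i, j). i \<le> j \<and> j \<le> n \<and> x n j - x n i \<le> 2 * (iota_rate q n / sqrt (real n))}" for n
  have P: "P n \<subseteq> {..n} \<times> {..n}" "finite (P n)" for n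
  proof -
    show "P n \<subseteq> {..n} \<times> {..n}" by (auto simp: P_def)
    then show "finite (P n)" by (rule finite_subset) simp
  qed
  define S where "S n ij \<omega> = (\<Sum>k<n. innov {x n (fst ij)<..x n (snd ij)} k \<omega>)" for n ij \<omega>
  have S [measurable]: "S n ij \<in> borel_measurable M" for n ij unfolding S_def by measurable
  have Sb: "\<bar>S n ij \<omega>\<bar> \<le> real n" for n ij \<omega> unfolding S_def by (rule sum_innov_bound) simp
  have int: "integrable M (\<lambda>\<omega>. exp (s * S n ij \<omega>))" for s n ij
  proof (rule integrable_const_bound[where B = "exp (\<bar>s\<bar> * real n)"])
    have "s * S n ij \<omega> \<le> \<bar>s\<bar> * real n" for \<omega>
    proof -
      have "s * S n ij \<omega> \<le> \<bar>s\<bar> * \<bar>S n ij \<omega>\<bar>" by (metis abs_ge_self abs_mult)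
      also have "\<dots> \<le> \<bar>s\<bar> * real n" by (intro mult_left_mono Sb) simp
      finally show ?thesis .
    qed
    then show "AE \<omega> in M. norm (exp (s * S n ij \<omega>)) \<le> exp (\<bar>s\<bar> * real n)" by simp
  qed measurable
  \<comment> \<open>Two signs, at most 4 * n^2 pairs and moments n^(2 * c) against the factor n^(- 2
    * c - 4) leave 8 / n^2, which is summable.\<close>
  define Y where "Y n \<omega> = real n powr - (2 * c + 4) * (\<Sum>ij\<in>P n. exp (r n * S n ij \<omega>) + exp (- r n * S n ij \<omega>))" for n \<omega>
  have iota1: "\<forall>\<^sub>F n in sequentially. 1 \<le> iota_rate q n"
    using iota_rate_bounds(1)[OF q] by eventually_elim simp
  have good: "\<forall>\<^sub>F n in sequentially. 1 \<le> iota_rate q n \<and> ln (real n) \<le> sqrt (real n) \<and> 1 \<le> ln (real n) \<and> 1 \<le> n"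
    by (intro eventually_conj iota1 eventually_ge_at_top; real_asymp)
  have "AE \<omega> in M. (\<lambda>n. Y n \<omega>) \<longlonglongrightarrow> 0"
  proof (rule AE_tendsto_0_if_summable_expectation)
    show "integrable M (Y n)" for n
      unfolding Y_def by (intro integrable_mult_right Bochner_Integration.integrable_sum Bochner_Integration.integrable_add int)
    show "0 \<le> Y n \<omega>" for n \<omega>
      unfolding Y_def by (intro mult_nonneg_nonneg sum_nonneg add_nonneg_nonneg) auto
    show "summable (\<lambda>n. \<integral>\<omega>. Y n \<omega> \<partial>M)"
    proof (rule summable_comparison_test_ev)
      show "summable (\<lambda>n. 8 * real n powr - 2)" by (intro summable_mult) (simp add: summable_real_powr_iff)
      show "\<forall>\<^sub>F n in sequentially. norm (\<integral>\<omega>. Y n \<omega> \<partial>M) \<le> 8 * real n powr - 2"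
        using good
      proof eventually_elim
        case (elim n)
        have r: "0 \<le> r n" "r n \<le> 1"
        proof -
          show "0 \<le> r n" unfolding r_def using elim by simp
          have "sqrt (real n) * 1 \<le> sqrt (real n) * iota_rate q n" using elim by (intro mult_left_mono) auto
          then have "ln (real n) \<le> sqrt (real n) * iota_rate q n" using elim by linarith
          then show "r n \<le> 1" unfolding r_def using elim by simp
        qed
        have one: "(\<integral>\<omega>. exp (s * S n ij \<omega>) \<partial>M) \<le> real n powr (2 * c)" if ij: "ij \<in> P n" and s: "\<bar>s\<bar> = r n" for s ij
        proof -
          define v where "v = c * (2 * (iota_rate q n / sqrt (real n)))"
          have xx: "x n (fst ij) \<le> x n (snd ij)" using ij by (intro mono) (auto simp: P_def)
          have "cprob {x n (fst ij)<..x n (snd ij)} t \<le> v" for t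
          proof -
            have "cprob {x n (fst ij)<..x n (snd ij)} t \<le> c * (x n (snd ij) - x n (fst ij))" by (rule cprob_interval[OF xx])
            also have "\<dots> \<le> v" unfolding v_def using ij c by (intro mult_left_mono) (auto simp: P_def)
            finally show ?thesis .
          qed
          then have "(\<integral>\<omega>. exp (s * (\<Sum>k<n. innov {x n (fst ij)<..x n (snd ij)} (0 + k) \<omega>)) \<partial>M) \<le> exp (real n * s\<^sup>2 * v)"
            using s r by (intro innov_exp_moment) auto
          also have "real n * s\<^sup>2 * v = 2 * c * ln (real n)"
          proof -
            have "s\<^sup>2 = (r n)\<^sup>2" using s by (metis power2_abs)
            also have "\<dots> = ln (real n) / (sqrt (real n) * iota_rate q n)" unfolding r_def using elim by simp
            finally have "real n * s\<^sup>2 * v = 2 * c * ln (real n) * (real n / (sqrt (real n) * sqrt (real n)))"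
              using elim by (simp add: v_def)
            then show ?thesis using elim by simp
          qed
          also have "exp (2 * c * ln (real n)) = real n powr (2 * c)" using elim by (simp add: powr_def)
          finally show ?thesis by (simp add: S_def)
        qed
        have "(\<integral>\<omega>. Y n \<omega> \<partial>M) = real n powr - (2 * c + 4) * (\<Sum>ij\<in>P n. (\<integral>\<omega>. exp (r n * S n ij \<omega>) \<partial>M) + (\<integral>\<omega>. exp (- r n * S n ij \<omega>) \<partial>M))"
          unfolding Y_def using int[of "r n" n] int[of "- r n" n] by (simp add: Bochner_Integration.integral_sum)
        also have "\<dots> \<le> real n powr - (2 * c + 4) * (\<Sum>ij\<in>P n. real n powr (2 * c) + real n powr (2 * c))"
          using r by (intro mult_left_mono sum_mono add_mono one) auto
        also have "\<dots> = 2 * real (card (P n)) * (real n powr - (2 * c + 4) * real n powr (2 * c))" by simp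
        also have "real n powr - (2 * c + 4) * real n powr (2 * c) = real n powr - 4" by (simp flip: powr_add)
        also have "2 * real (card (P n)) * real n powr - 4 \<le> 2 * (4 * (real n)\<^sup>2) * real n powr - 4"
        proof (intro mult_right_mono mult_left_mono)
          have "card (P n) \<le> card ({..n} \<times> {..n})" by (rule card_mono[OF _ P(1)]) simp
          also have "\<dots> = Suc n * Suc n" by (simp add: card_cartesian_product)
          also have "\<dots> \<le> (2 * n) * (2 * n)" using elim by (intro mult_mono) auto
          finally have "real (card (P n)) \<le> real ((2 * n) * (2 * n))" by (rule of_nat_mono)
          then show "real (card (P n)) \<le> 4 * (real n)\<^sup>2" by (simp add: power2_eq_square)
        qed auto
        also have "\<dots> = 8 * real n powr - 2"
        proof -
          have "(real n)\<^sup>2 * real n powr - 4 = real n powr 2 * real n powr - 4" using elim by simp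
          also have "\<dots> = real n powr - 2" by (subst powr_add[symmetric]) simp
          finally show ?thesis by simp
        qed
        finally have le: "(\<integral>\<omega>. Y n \<omega> \<partial>M) \<le> 8 * real n powr - 2" .
        have "0 \<le> (\<integral>\<omega>. Y n \<omega> \<partial>M)"
          unfolding Y_def by (intro Bochner_Integration.integral_nonneg mult_nonneg_nonneg sum_nonneg add_nonneg_nonneg) auto
        with le show ?case by simp
      qed
    qed
  qed
  then show ?thesis
  proof eventually_elim
    case (elim \<omega>)
    then have "\<forall>\<^sub>F n in sequentially. Y n \<omega> < 1" by (rule order_tendstoD(2)) simp
    with good show ?case
    proof eventually_elim
      case (elim n)
      have "0 < ln (real n)" using elim by linarith
      moreover have "0 < sqrt (real n) * iota_rate q n" using elim by (auto intro!: mult_pos_pos)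
      ultimately have rpos: "0 < r n" unfolding r_def by simp
      have bound: "\<bar>S n ij \<omega>\<bar> \<le> (2 * c + 4) * osc_rate n" if ij: "ij \<in> P n" for ij
      proof -
        have npos: "0 < real n powr - (2 * c + 4)" using elim by simp
        have "exp (r n * \<bar>S n ij \<omega>\<bar>) \<le> exp (r n * S n ij \<omega>) + exp (- r n * S n ij \<omega>)"
          by (simp add: abs_if add_increasing add_increasing2)
        also have "\<dots> \<le> (\<Sum>ij\<in>P n. exp (r n * S n ij \<omega>) + exp (- r n * S n ij \<omega>))"
          by (rule member_le_sum[OF ij]) (auto simp: P add_nonneg_nonneg)
        finally have "real n powr - (2 * c + 4) * exp (r n * \<bar>S n ij \<omega>\<bar>) \<le> Y n \<omega>"
          unfolding Y_def using npos by (intro mult_left_mono) auto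
        then have "real n powr - (2 * c + 4) * exp (r n * \<bar>S n ij \<omega>\<bar>) < 1" using elim by linarith
        then have "exp (r n * \<bar>S n ij \<omega>\<bar>) < real n powr (2 * c + 4)"
          using npos by (simp only: powr_minus) (simp add: field_simps)
        also have "\<dots> = exp ((2 * c + 4) * ln (real n))" using elim by (simp add: powr_def)
        finally have "r n * \<bar>S n ij \<omega>\<bar> < (2 * c + 4) * ln (real n)" by simp
        then have "\<bar>S n ij \<omega>\<bar> \<le> (2 * c + 4) * (ln (real n) / r n)" using rpos by (simp add: field_simps)
        also have "ln (real n) / r n = osc_rate n"
        proof -
          have "r n * osc_rate n = sqrt (ln (real n) / (sqrt (real n) * iota_rate q n) * (sqrt (real n) * iota_rate q n * ln (real n)))"
            unfolding r_def osc_rate_def by (simp only: real_sqrt_mult)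
          also have "ln (real n) / (sqrt (real n) * iota_rate q n) * (sqrt (real n) * iota_rate q n * ln (real n)) = (ln (real n))\<^sup>2"
            using elim by (simp add: power2_eq_square)
          finally have "r n * osc_rate n = ln (real n)" using elim by simp
          then show ?thesis using rpos by (simp add: field_simps)
        qed
        finally show ?thesis .
      qed
      have ordered: "\<bar>(\<Sum>k<n. innov {..x n j} k \<omega>) - (\<Sum>k<n. innov {..x n i} k \<omega>)\<bar> \<le> (2 * c + 4) * osc_rate n"
        if "i \<le> j" "j \<le> n" "\<bar>x n i - x n j\<bar> \<le> 2 * (iota_rate q n / sqrt (real n))" for i j
      proof -
        have "(i, j) \<in> P n" using that by (auto simp: P_def)
        moreover have "S n (i, j) \<omega> = (\<Sum>k<n. innov {..x n j} k \<omega>) - (\<Sum>k<n. innov {..x n i} k \<omega>)"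
          unfolding S_def fst_conv snd_conv innov_diff[OF mono[OF that(1)]] by (simp add: sum_subtractf)
        ultimately show ?thesis using bound[of "(i, j)"] by simp
      qed
      show ?case
      proof (intro allI impI)
        fix i j assume "i \<le> n" "j \<le> n" "\<bar>x n i - x n j\<bar> \<le> 2 * (iota_rate q n / sqrt (real n))"
        then show "\<bar>(\<Sum>k<n. innov {..x n i} k \<omega>) - (\<Sum>k<n. innov {..x n j} k \<omega>)\<bar> \<le> (2 * c + 4) * osc_rate n"
          using ordered[of i j] ordered[of j i] by (cases "i \<le> j") (auto simp: abs_minus_commute)
      qed
    qed
  qed
qed

text \<open>On a grid of n cells rounding costs only the constant 2 * c * (B - A) in total.
  \<open>osc_rate\<close> eventually exceeds it, which raises 2 * c + 4 to 2 * c + 5.\<close>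

lemma innov_oscillation:
  assumes AB: "A < B"
  shows "AE \<omega> in M. \<forall>\<^sub>F n in sequentially. \<forall>x\<in>{A..B}. \<forall>y\<in>{A..B}. \<bar>x - y\<bar> \<le> iota_rate q n / sqrt (real n) \<longrightarrow>
    \<bar>(\<Sum>k<n. innov {..x} k \<omega>) - (\<Sum>k<n. innov {..y} k \<omega>)\<bar> \<le> (2 * c + 5) * osc_rate n"
proof -
  define g where "g n i = A + (B - A) * real i / real n" for n i :: nat
  have "AE \<omega> in M. \<forall>\<^sub>F n in sequentially. \<forall>i\<le>n. \<forall>j\<le>n. \<bar>g n i - g n j\<bar> \<le> 2 * (iota_rate q n / sqrt (real n)) \<longrightarrow>
    \<bar>(\<Sum>k<n. innov {..g n i} k \<omega>) - (\<Sum>k<n. innov {..g n j} k \<omega>)\<bar> \<le> (2 * c + 4) * osc_rate n"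
    by (rule innov_oscillation_grid)
       (use AB in \<open>auto simp: g_def intro!: divide_right_mono mult_left_mono\<close>)
  then show ?thesis
  proof eventually_elim
    case (elim \<omega>)
    have iota1: "\<forall>\<^sub>F n in sequentially. 1 \<le> iota_rate q n"
      using iota_rate_bounds(1)[OF q] by eventually_elim simp
    have ev1: "\<forall>\<^sub>F n in sequentially. 1 \<le> iota_rate q n \<and> 1 \<le> ln (real n) \<and> 1 \<le> n"
      by (intro eventually_conj iota1 eventually_ge_at_top; real_asymp)
    have ev2: "\<forall>\<^sub>F n in sequentially. 2 * (B - A) \<le> sqrt (real n) \<and> 2 * c * (B - A) \<le> sqrt (sqrt (real n))"
    proof (intro eventually_conj)
      have "filterlim (\<lambda>n. sqrt (real n)) at_top sequentially" by real_asymp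
      then show "\<forall>\<^sub>F n in sequentially. 2 * (B - A) \<le> sqrt (real n)" unfolding filterlim_at_top by blast
      have "filterlim (\<lambda>n. sqrt (sqrt (real n))) at_top sequentially" by real_asymp
      then show "\<forall>\<^sub>F n in sequentially. 2 * c * (B - A) \<le> sqrt (sqrt (real n))" unfolding filterlim_at_top by blast
    qed
    show ?case
      using elim ev1 ev2
    proof eventually_elim
      case (elim n)
      define s where "s z = (\<Sum>k<n. innov {..z} k \<omega>)" for z
      define d where "d = iota_rate q n / sqrt (real n)"
      define h where "h = (B - A) / real n"
      have n: "0 < real n" using elim by simp
      have grid: "\<bar>s (g n i) - s (g n j)\<bar> \<le> (2 * c + 4) * osc_rate n" if "i \<le> n" "j \<le> n" "\<bar>g n i - g n j\<bar> \<le> 2 * d" for i j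
        using elim(1) that by (simp add: s_def d_def)
      have gS: "g n (Suc i) = g n i + h" for i using n by (simp add: g_def h_def field_simps)
      have hd: "2 * h \<le> d"
      proof -
        have "2 * h = 2 * (B - A) / sqrt (real n) / sqrt (real n)" unfolding h_def using n by simp
        also have "\<dots> \<le> iota_rate q n / sqrt (real n)"
        proof (rule divide_right_mono)
          have "2 * (B - A) / sqrt (real n) \<le> 1" using elim n by simp
          then show "2 * (B - A) / sqrt (real n) \<le> iota_rate q n" using elim by linarith
        qed simp
        finally show ?thesis by (simp add: d_def)
      qed
      have h0: "0 \<le> h" using AB n by (simp add: h_def)
      have small: "2 * (c * real n * h) \<le> osc_rate n"
      proof -
        have "2 * (c * real n * h) = 2 * c * (B - A)" using n by (simp add: h_def)
        also have "\<dots> \<le> sqrt (sqrt (real n))" using elim by simp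
        also have "\<dots> \<le> osc_rate n"
          unfolding osc_rate_def
        proof (rule real_sqrt_le_mono)
          have "sqrt (real n) * 1 * 1 \<le> sqrt (real n) * iota_rate q n * ln (real n)"
            using elim by (intro mult_mono) auto
          then show "sqrt (real n) \<le> sqrt (real n) * iota_rate q n * ln (real n)" by simp
        qed
        finally show ?thesis .
      qed
      have le: "s z \<le> s v + c * real n * (v - u)" "s u - c * real n * (v - u) \<le> s z" if "u \<le> z" "z \<le> v" for u z v
        using sum_innov_le[of "{..<n}" u z v \<omega>] that by (simp_all add: s_def)
      have up: "\<bar>s y - s x\<bar> \<le> (2 * c + 5) * osc_rate n" if xy: "x \<in> {A..B}" "y \<in> {A..B}" "\<bar>x - y\<bar> \<le> d" for x y
      proof -
        obtain i where i: "i < n" "g n i \<le> x" "x \<le> g n (Suc i)"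
          using grid_cell[OF AB, of n x] xy n unfolding g_def by auto
        obtain j where j: "j < n" "g n j \<le> y" "y \<le> g n (Suc j)"
          using grid_cell[OF AB, of n y] xy n unfolding g_def by auto
        have sx: "s x \<le> s (g n (Suc i)) + c * real n * h" "s (g n i) - c * real n * h \<le> s x"
          using le[OF i(2,3)] by (simp_all add: gS)
        have sy: "s y \<le> s (g n (Suc j)) + c * real n * h" "s (g n j) - c * real n * h \<le> s y"
          using le[OF j(2,3)] by (simp_all add: gS)
        have "\<bar>s (g n (Suc j)) - s (g n i)\<bar> \<le> (2 * c + 4) * osc_rate n"
          by (rule grid) (use i j xy hd h0 gS in auto)
        moreover have "\<bar>s (g n j) - s (g n (Suc i))\<bar> \<le> (2 * c + 4) * osc_rate n"
          by (rule grid) (use i j xy hd h0 gS in auto)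
        ultimately show ?thesis using sx sy small by (simp add: algebra_simps)
      qed
      show ?case
      proof (intro ballI impI)
        fix x y assume "x \<in> {A..B}" "y \<in> {A..B}" "\<bar>x - y\<bar> \<le> iota_rate q n / sqrt (real n)"
        then show "\<bar>(\<Sum>k<n. innov {..x} k \<omega>) - (\<Sum>k<n. innov {..y} k \<omega>)\<bar> \<le> (2 * c + 5) * osc_rate n"
          using up[of y x] by (simp add: s_def d_def abs_minus_commute)
      qed
    qed
  qed
qed

end

subsection \<open>Bahadur representation\<close>

lemma bdd_lip_of_deriv:
  fixes g g' :: "real \<Rightarrow> real"
  assumes "\<And>x. (g has_real_derivative g' x) (at x)" "\<And>x. \<bar>g' x\<bar> \<le> K" "\<And>x. \<bar>g x\<bar> \<le> K"
  shows "bdd_lip K g"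
proof -
  have "norm (g s - g t) \<le> K * norm (s - t)" for s t
    by (rule field_differentiable_bound[where S = UNIV and f' = g']) (use assms in auto)
  then show ?thesis using assms(3) by (simp add: bdd_lip_def)
qed

lemma bdd_lip_taylor:
  fixes g g' :: "real \<Rightarrow> real"
  assumes deriv: "\<And>x. (g has_real_derivative g' x) (at x)" and g': "bdd_lip K g'"
  shows "\<bar>g (u + h) - g u - h * g' u\<bar> \<le> K * h\<^sup>2"
proof -
  have d: "((\<lambda>z. g (u + z) - z * g' u) has_real_derivative g' (u + z) - g' u) (at z within cball 0 \<bar>h\<bar>)" for z :: real
  proof -
    have "((\<lambda>z. g (u + z)) has_real_derivative g' (u + z)) (at z)"
      using DERIV_shift[of g "g' (u + z)" z u] deriv[of "u + z"] by (simp add: add.commute)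
    from has_field_derivative_at_within[OF this, of "cball 0 \<bar>h\<bar>"] show ?thesis
      by (auto intro!: derivative_eq_intros)
  qed
  have "norm ((g (u + h) - h * g' u) - (g (u + 0) - 0 * g' u)) \<le> (K * \<bar>h\<bar>) * norm (h - 0)"
  proof (rule field_differentiable_bound[OF convex_cball d])
    fix z :: real assume "z \<in> cball 0 \<bar>h\<bar>"
    then have "K * \<bar>z\<bar> \<le> K * \<bar>h\<bar>" using bdd_lipD(3)[OF g'] by (intro mult_left_mono) auto
    then show "norm (g' (u + z) - g' u) \<le> K * \<bar>h\<bar>" using bdd_lipD(2)[OF g', of "u + z" u] by simp
  qed auto
  then show ?thesis by (simp add: power2_eq_square algebra_simps)
qed

context linear_noise
begin

text \<open>The quadratic Taylor error is uniform in the tail, so integrating it differentiates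
  under the expectation.\<close>

lemma pred_mean_deriv:
  assumes deriv: "\<And>x. (g has_real_derivative g' x) (at x)" and g: "bdd_lip K g" and g': "bdd_lip K g'"
  shows "((\<lambda>x. pred_mean (\<lambda>t. g (x - t))) has_real_derivative pred_mean (\<lambda>t. g' (x - t))) (at x)"
proof -
  define m where "m x = pred_mean (\<lambda>t. g (x - t))" for x
  define m' where "m' = pred_mean (\<lambda>t. g' (x - t))"
  have taylor: "\<bar>m (x + h) - m x - h * m'\<bar> \<le> K * h\<^sup>2" for h
  proof -
    let ?R = "\<lambda>\<omega>. g (x + h - tail 0 0 \<omega>) - g (x - tail 0 0 \<omega>) - h * g' (x - tail 0 0 \<omega>)"
    have int: "integrable M ?R"
      by (intro Bochner_Integration.integrable_diff integrable_mult_right integrable_tail[OF g] integrable_tail[OF g'])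
    have eq: "m (x + h) - m x - h * m' = (\<integral>\<omega>. ?R \<omega> \<partial>M)"
      unfolding m_def m'_def pred_mean_def using integrable_tail[OF g] integrable_tail[OF g'] by simp
    have "\<bar>\<integral>\<omega>. ?R \<omega> \<partial>M\<bar> \<le> (\<integral>\<omega>. \<bar>?R \<omega>\<bar> \<partial>M)" by (rule integral_abs_bound)
    also have "\<dots> \<le> (\<integral>\<omega>. K * h\<^sup>2 \<partial>M)"
    proof (rule integral_mono)
      show "\<bar>?R \<omega>\<bar> \<le> K * h\<^sup>2" for \<omega>
        using bdd_lip_taylor[OF deriv g', of "x - tail 0 0 \<omega>" h] by (simp add: algebra_simps)
    qed (use int in auto)
    finally show ?thesis unfolding eq by (simp add: prob_space)
  qed
  have "((\<lambda>h. (m (x + h) - m x) / h - m') \<longlongrightarrow> 0) (at 0)"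
  proof (rule Lim_null_comparison)
    show "\<forall>\<^sub>F h in at 0. norm ((m (x + h) - m x) / h - m') \<le> K * \<bar>h\<bar>"
    proof (rule eventually_at_filter[THEN iffD2], intro always_eventually allI impI)
      fix h :: real assume h: "h \<noteq> 0"
      have "(m (x + h) - m x) / h - m' = (m (x + h) - m x - h * m') / h" using h by (simp add: field_simps)
      also have "norm \<dots> \<le> K * h\<^sup>2 / \<bar>h\<bar>"
        using taylor[of h] by (simp add: divide_right_mono)
      also have "\<dots> = K * \<bar>h\<bar>" using h by (simp add: power2_eq_square abs_if)
      finally show "norm ((m (x + h) - m x) / h - m') \<le> K * \<bar>h\<bar>" .
    qed
    show "((\<lambda>h. K * \<bar>h\<bar>) \<longlongrightarrow> 0) (at 0)" by (auto intro!: tendsto_eq_intros)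
  qed
  then have "(m has_real_derivative m') (at x)"
    unfolding DERIV_def by (simp add: LIM_zero_iff)
  then show ?thesis by (simp add: m_def[abs_def] m'_def)
qed

text \<open>Integrating out the fresh noise averages \<open>cdf \<mu>\<close> over the predictable
  part, which makes the distribution function of X as smooth as that of the noise.\<close>

lemma expectation_indicator_obs:
  assumes F: "bdd_lip K (cdf \<mu>)"
  shows "(\<integral>\<omega>. indicator {..x} (\<epsilon> (k + 1) \<omega> + tail k 0 \<omega>) \<partial>M) = pred_mean (\<lambda>t. cdf \<mu> (x - t))"
proof -
  have [measurable]: "tail k 0 \<in> borel_measurable (past (k + 1))"
    by (rule tail_measurable_past) simp
  have meas: "(\<lambda>(\<omega>, e). indicator {..x} (e + tail k 0 \<omega>) :: real) \<in> borel_measurable (past (k + 1) \<Otimes>\<^sub>M borel)"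
    by measurable
  have "(\<integral>\<omega>. indicator {..x} (\<epsilon> (k + 1) \<omega> + tail k 0 \<omega>) \<partial>M :: real)
      = (\<integral>\<omega>. (\<integral>e. indicator {..x} (e + tail k 0 \<omega>) \<partial>\<mu>) \<partial>M)"
    by (rule integral_past(1)[where B = 1 and \<phi> = "\<lambda>\<omega> e. indicator {..x} (e + tail k 0 \<omega>)"])
       (rule meas, simp add: indicator_def)
  also have "\<dots> = (\<integral>\<omega>. cdf \<mu> (x - tail k 0 \<omega>) \<partial>M)"
    using cprob_atMost by (simp only: cprob_def)
  also have "\<dots> = pred_mean (\<lambda>t. cdf \<mu> (x - t))"
    by (rule expectation_tail_eq[OF bdd_lip_shift[OF F]])
  finally show ?thesis .
qed

end

definition bahadur_rate :: "real \<Rightarrow> nat \<Rightarrow> real" where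
  "bahadur_rate q n = real n powr (- 3 / 4) * (iota_rate q n * ln (real n)) powr (1 / 2)"

text \<open>Quadratic errors are negligible: iota is bounded by powers of logarithms, and n powr (-
  3 / 4) exceeds 1 / n by a power of n.\<close>

lemma rate_facts:
  assumes q: "2 \<le> q"
  shows "\<forall>\<^sub>F n in sequentially. 1 \<le> iota_rate q n \<and> 1 \<le> ln (real n) \<and> 1 \<le> n \<and> (iota_rate q n)\<^sup>2 / real n \<le> bahadur_rate q n"
    and "(\<lambda>n. iota_rate q n / sqrt (real n)) \<longlonglongrightarrow> 0"
proof -
  define U where "U n = ln (real n) powr (3 / 2) * ln (ln (real n))" for n :: nat
  have iota: "\<forall>\<^sub>F n in sequentially. 1 \<le> iota_rate q n \<and> iota_rate q n \<le> U n"
    unfolding U_def by (rule iota_rate_bounds(1)[OF q])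
  have 1: "\<forall>\<^sub>F n in sequentially. U n powr (3 / 2) \<le> real n powr (1 / 4) * ln (real n) powr (1 / 2)"
    unfolding U_def by real_asymp
  have 2: "\<forall>\<^sub>F n in sequentially. 1 \<le> ln (real n)" by real_asymp
  show "\<forall>\<^sub>F n in sequentially. 1 \<le> iota_rate q n \<and> 1 \<le> ln (real n) \<and> 1 \<le> n \<and> (iota_rate q n)\<^sup>2 / real n \<le> bahadur_rate q n"
    using iota 1 2 eventually_ge_at_top[of 1]
  proof eventually_elim
    case (elim n)
    define i where "i = iota_rate q n"
    have i: "1 \<le> i" "i \<le> U n" using elim by (auto simp: i_def)
    have "i powr (3 / 2) \<le> U n powr (3 / 2)" using i by (intro powr_mono2) auto
    then have i32: "i powr (3 / 2) \<le> real n powr (1 / 4) * ln (real n) powr (1 / 2)" using elim by linarith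
    \<comment> \<open>The target contains i^(1/2); the remaining i^(3/2) is paid by n^(1/4).\<close>
    have "i\<^sup>2 = i powr (1 / 2) * i powr (3 / 2)" using i by (simp flip: powr_add)
    also have "\<dots> \<le> i powr (1 / 2) * (real n powr (1 / 4) * ln (real n) powr (1 / 2))"
      using i32 by (intro mult_left_mono) auto
    finally have "i\<^sup>2 / real n \<le> i powr (1 / 2) * (real n powr (1 / 4) * ln (real n) powr (1 / 2)) / real n"
      by (intro divide_right_mono) auto
    also have "\<dots> = (real n powr (1 / 4) / real n powr 1) * (i * ln (real n)) powr (1 / 2)"
      using elim by (simp add: powr_mult)
    also have "real n powr (1 / 4) / real n powr 1 = real n powr (- 3 / 4)"
      by (subst powr_diff[symmetric]) simp
    finally show ?case using elim by (simp add: bahadur_rate_def i_def)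
  qed
  show "(\<lambda>n. iota_rate q n / sqrt (real n)) \<longlonglongrightarrow> 0"
  proof (rule Lim_null_comparison)
    show "(\<lambda>n. U n / sqrt (real n)) \<longlonglongrightarrow> 0" unfolding U_def by real_asymp
    show "\<forall>\<^sub>F n in sequentially. norm (iota_rate q n / sqrt (real n)) \<le> U n / sqrt (real n)"
      using iota by eventually_elim (auto intro!: divide_right_mono)
  qed
qed

context bounded_density_noise
begin

lemma osc_rate_bahadur:
  assumes "1 \<le> n" "0 \<le> iota_rate q n" "0 \<le> ln (real n)"
  shows "osc_rate n / real n = bahadur_rate q n"
proof -
  have "osc_rate n = (real n powr (1 / 2) * (iota_rate q n * ln (real n))) powr (1 / 2)"
    using assms by (simp add: osc_rate_def powr_half_sqrt mult.assoc)
  also have "\<dots> = real n powr (1 / 4) * (iota_rate q n * ln (real n)) powr (1 / 2)"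
    unfolding powr_mult[of "real n powr (1 / 2)"] powr_powr by simp
  finally have "osc_rate n / real n = (real n powr (1 / 4) / real n powr 1) * (iota_rate q n * ln (real n)) powr (1 / 2)"
    using assms by simp
  also have "real n powr (1 / 4) / real n powr 1 = real n powr (- 3 / 4)"
    by (subst powr_diff[symmetric]) simp
  finally show ?thesis by (simp add: bahadur_rate_def)
qed

text \<open>Both parts of the empirical process obey the uniform rate. Locally the innovations
  oscillate by \<open>osc_rate\<close>, whereas the smooth part has a small derivative and adds only
  iota^2 / n, the last unit in the factor 2 * c + 6.\<close>

lemma empirical_rates:
  fixes g g' :: "real \<Rightarrow> real" and A B K :: real
  assumes AB: "2 \<le> B - A"
    and deriv: "\<And>x. (cdf \<mu> has_real_derivative g x) (at x)" "\<And>x. (g has_real_derivative g' x) (at x)"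
    and lip: "bdd_lip K (cdf \<mu>)" "bdd_lip K g" "bdd_lip K g'"
  defines "F \<equiv> \<lambda>x. pred_mean (\<lambda>t. cdf \<mu> (x - t))"
    and "G \<equiv> \<lambda>n \<omega> x. (\<Sum>k<n. indicator {..x} (obs k \<omega>)) / real n"
  shows "AE \<omega> in M. (\<forall>e>0. \<forall>\<^sub>F n in sequentially. \<forall>x\<in>{A..B}. \<bar>G n \<omega> x - F x\<bar> \<le> e * (iota_rate q n / sqrt (real n))) \<and>
    (\<exists>C\<ge>0. \<forall>\<^sub>F n in sequentially. \<forall>x\<in>{A..B}. \<forall>y\<in>{A..B}. \<bar>x - y\<bar> \<le> iota_rate q n / sqrt (real n) \<longrightarrow>
      \<bar>(G n \<omega> x - F x) - (G n \<omega> y - F y)\<bar> \<le> C * bahadur_rate q n)"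
proof -
  have AB': "A < B" using AB by simp
  define f where "f x = pred_mean (\<lambda>t. g (x - t))" for x
  have F': "(F has_real_derivative f x) (at x)" for x
    unfolding F_def f_def by (rule pred_mean_deriv[OF deriv(1) lip(1,2)])
  define N where "N n \<omega> x = (\<Sum>k<n. cdf \<mu> (x - tail (int k) 0 \<omega>) - F x)" for n \<omega> x
  have split: "G n \<omega> x - F x = (\<Sum>k<n. innov {..x} k \<omega>) / real n + N n \<omega> x / real n" if "1 \<le> n" for n \<omega> x
  proof -
    have "(\<Sum>k<n. innov {..x} k \<omega>) + N n \<omega> x = (\<Sum>k<n. indicator {..x} (obs k \<omega>)) - real n * F x"
      unfolding innov_def cprob_atMost N_def by (simp add: sum_subtractf)
    then show ?thesis using that unfolding G_def by (simp add: field_simps)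
  qed
  show ?thesis
    using innov_rate[OF AB] innov_oscillation[OF AB'] predictor_rate[OF AB' deriv(1) lip(1,2)] predictor_rate[OF AB' deriv(2) lip(2,3)]
  proof eventually_elim
    case (elim \<omega>)
    have first: "\<forall>\<^sub>F n in sequentially. \<forall>x\<in>{A..B}. \<bar>G n \<omega> x - F x\<bar> \<le> e * (iota_rate q n / sqrt (real n))" if e: "0 < e" for e
    proof -
      have half: "z / 2 / w + z / 2 / w = z / w" for z w :: real by (simp add: field_simps)
      have "\<forall>\<^sub>F n in sequentially. \<forall>x\<in>{A..B}. \<bar>\<Sum>k<n. innov {..x} k \<omega>\<bar> \<le> (e / 2) * (sqrt (real n) * iota_rate q n)"
        "\<forall>\<^sub>F n in sequentially. \<forall>x\<in>{A..B}. \<bar>N n \<omega> x\<bar> \<le> (e / 2) * (sqrt (real n) * iota_rate q n)"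
        using elim(1)[rule_format, of "e / 2"] elim(3)[rule_format, of "e / 2"] e unfolding N_def F_def by simp_all
      then show ?thesis using eventually_ge_at_top[of 1]
      proof eventually_elim
        case (elim n)
        show ?case
        proof
          fix x assume x: "x \<in> {A..B}"
          have n: "0 < real n" using elim by simp
          have "\<bar>G n \<omega> x - F x\<bar> \<le> \<bar>\<Sum>k<n. innov {..x} k \<omega>\<bar> / real n + \<bar>N n \<omega> x\<bar> / real n"
            unfolding split[OF elim(3)] using abs_triangle_ineq[of "(\<Sum>k<n. innov {..x} k \<omega>) / real n" "N n \<omega> x / real n"] by simp
          also have "\<dots> \<le> (e / 2) * (sqrt (real n) * iota_rate q n) / real n + (e / 2) * (sqrt (real n) * iota_rate q n) / real n"
            using elim x by (intro add_mono divide_right_mono) auto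
          also have "\<dots> = e * iota_rate q n * (sqrt (real n) / real n)"
            using half[of "e * (iota_rate q n * sqrt (real n))" "real n"]
            by (simp only: times_divide_eq_left times_divide_eq_right mult_ac)
          also have "sqrt (real n) / real n = 1 / sqrt (real n)"
            using nonzero_divide_mult_cancel_left[of "sqrt (real n)" "sqrt (real n)"] n by simp
          also have "e * iota_rate q n * (1 / sqrt (real n)) = e * (iota_rate q n / sqrt (real n))"
            by (simp only: times_divide_eq_right mult_1_right)
          finally show "\<bar>G n \<omega> x - F x\<bar> \<le> e * (iota_rate q n / sqrt (real n))" .
        qed
      qed
    qed
    have "\<forall>\<^sub>F n in sequentially. \<forall>x\<in>{A..B}. \<forall>y\<in>{A..B}. \<bar>x - y\<bar> \<le> iota_rate q n / sqrt (real n) \<longrightarrow>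
      \<bar>(G n \<omega> x - F x) - (G n \<omega> y - F y)\<bar> \<le> (2 * c + 6) * bahadur_rate q n"
    proof -
      have "\<forall>\<^sub>F n in sequentially. \<forall>x\<in>{A..B}. \<bar>\<Sum>k<n. g (x - tail (int k) 0 \<omega>) - f x\<bar> \<le> 1 * (sqrt (real n) * iota_rate q n)"
        using spec[OF elim(4), of 1] unfolding f_def by simp
      with elim(2) rate_facts(1)[OF q] show ?thesis
      proof eventually_elim
        case (elim n)
        have n: "1 \<le> n" "0 < real n" and i: "1 \<le> iota_rate q n" and l: "1 \<le> ln (real n)" using elim by auto
        show ?case
        proof (intro ballI impI)
          fix x y assume x: "x \<in> {A..B}" and y: "y \<in> {A..B}" and xy: "\<bar>x - y\<bar> \<le> iota_rate q n / sqrt (real n)"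
          \<comment> \<open>The derivative of N is a centred sum of the same kind with g in place of
            the distribution function, so it is at most sqrt n * iota; multiply by the distance iota
            / sqrt n.\<close>
          have dN: "\<bar>N n \<omega> x - N n \<omega> y\<bar> \<le> (iota_rate q n)\<^sup>2"
          proof -
            have d: "((\<lambda>x. N n \<omega> x) has_real_derivative (\<Sum>k<n. g (z - tail (int k) 0 \<omega>) - f z)) (at z within {A..B})" for z
            proof -
              have "((\<lambda>x. cdf \<mu> (x - t)) has_real_derivative g (z - t)) (at z)" for t
                using DERIV_shift[of "cdf \<mu>" "g (z - t)" z "- t"] deriv(1)[of "z - t"] by simp
              then have "((\<lambda>x. N n \<omega> x) has_real_derivative (\<Sum>k<n. g (z - tail (int k) 0 \<omega>) - f z)) (at z)"
                unfolding N_def by (intro DERIV_sum DERIV_diff F')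
              then show ?thesis by (rule has_field_derivative_at_within)
            qed
            have "norm (N n \<omega> x - N n \<omega> y) \<le> (sqrt (real n) * iota_rate q n) * norm (x - y)"
            proof (rule field_differentiable_bound[OF _ d])
              show "norm (\<Sum>k<n. g (z - tail (int k) 0 \<omega>) - f z) \<le> sqrt (real n) * iota_rate q n" if "z \<in> {A..B}" for z
                using elim(3) that by simp
            qed (use x y in auto)
            also have "\<dots> \<le> (sqrt (real n) * iota_rate q n) * (iota_rate q n / sqrt (real n))"
              using xy i by (intro mult_left_mono) auto
            also have "\<dots> = (iota_rate q n)\<^sup>2" using n by (simp add: power2_eq_square)
            finally show ?thesis by simp
          qed
          have dM: "\<bar>(\<Sum>k<n. innov {..x} k \<omega>) - (\<Sum>k<n. innov {..y} k \<omega>)\<bar> \<le> (2 * c + 5) * osc_rate n"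
            using elim(1) x y xy by blast
          have "(G n \<omega> x - F x) - (G n \<omega> y - F y) = ((\<Sum>k<n. innov {..x} k \<omega>) - (\<Sum>k<n. innov {..y} k \<omega>)) / real n + (N n \<omega> x - N n \<omega> y) / real n"
            unfolding split[OF n(1)] by (simp add: diff_divide_distrib)
          then have "\<bar>(G n \<omega> x - F x) - (G n \<omega> y - F y)\<bar> \<le> \<bar>(\<Sum>k<n. innov {..x} k \<omega>) - (\<Sum>k<n. innov {..y} k \<omega>)\<bar> / real n + \<bar>N n \<omega> x - N n \<omega> y\<bar> / real n"
            using abs_triangle_ineq[of "((\<Sum>k<n. innov {..x} k \<omega>) - (\<Sum>k<n. innov {..y} k \<omega>)) / real n" "(N n \<omega> x - N n \<omega> y) / real n"] by simp
          also have "\<dots> \<le> (2 * c + 5) * osc_rate n / real n + (iota_rate q n)\<^sup>2 / real n"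
            by (intro add_mono divide_right_mono dM dN) auto
          also have "(2 * c + 5) * osc_rate n / real n = (2 * c + 5) * bahadur_rate q n"
            using osc_rate_bahadur[OF n(1)] i l by (simp add: mult.assoc[symmetric] flip: times_divide_eq_right)
          also have "(2 * c + 5) * bahadur_rate q n + (iota_rate q n)\<^sup>2 / real n \<le> (2 * c + 6) * bahadur_rate q n"
            using elim by (simp add: algebra_simps)
          finally show "\<bar>(G n \<omega> x - F x) - (G n \<omega> y - F y)\<bar> \<le> (2 * c + 6) * bahadur_rate q n" .
        qed
      qed
    qed
    moreover have "0 \<le> 2 * c + 6" using c by simp
    ultimately show ?case using first by blast
  qed
qed

end

section \<open>Deterministic bounds for quantiles of a monotone function\<close>

lemma quantile_le:
  assumes "\<And>x. p \<le> G x \<Longrightarrow> l \<le> x" "p \<le> G t"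
  shows "quantile G p \<le> t"
  unfolding quantile_def by (rule cInf_lower) (use assms in \<open>auto simp: bdd_below_def\<close>)

text \<open>\<open>Inf\<close> is meaningful on the reals for nonempty sets that are bounded below:
  u witnesses the first here, as l witnesses the second in \<open>quantile_le\<close>.\<close>

lemma quantile_ge:
  assumes "mono G" "G t < p" "p \<le> G u"
  shows "t \<le> quantile G p"
  unfolding quantile_def
proof (rule cInf_greatest)
  fix x assume "x \<in> {x. p \<le> G x}"
  then have "\<not> x \<le> t" using monoD[OF assms(1), of x t] assms(2) by auto
  then show "t \<le> x" by simp
qed (use assms(3) in auto)

context
  fixes F f :: "real \<Rightarrow> real" and G :: "real \<Rightarrow> real" and A B K m p x0 :: real
  assumes F': "\<And>x. (F has_real_derivative f x) (at x)" and f: "bdd_lip K f"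
    and G: "mono G" and x0: "F x0 = p" "A + 1 \<le> x0" "x0 \<le> B - 1" and m: "0 < m" "m \<le> f x0"
begin

text \<open>Over a distance t, F moves by at least 3 * m * t / 4, namely m * t less the Taylor
  error. A perturbation by m * t / 4 cannot undo this, so G crosses p within t of x0.\<close>

lemma quantile_close:
  assumes t: "0 < t" "t \<le> 1" "K * t \<le> m / 4"
    and close: "\<And>x. x \<in> {A..B} \<Longrightarrow> \<bar>G x - F x\<bar> \<le> m * t / 4"
  shows "\<bar>quantile G p - x0\<bar> \<le> t" "G (x0 - t) < p" "p < G (x0 + t)"
proof -
  have Kt: "K * t\<^sup>2 \<le> m * t / 4" using mult_right_mono[OF t(3), of t] t(1) by (simp add: power2_eq_square)
  have mt: "m * t \<le> t * f x0" using m t by simp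
  have mt0: "0 < m * t" using m t by simp
  have T: "\<bar>F (x0 + t) - F x0 - t * f x0\<bar> \<le> K * t\<^sup>2" "\<bar>F (x0 - t) - F x0 + t * f x0\<bar> \<le> K * t\<^sup>2"
    using bdd_lip_taylor[OF F' f, of x0 t] bdd_lip_taylor[OF F' f, of x0 "- t"] by simp_all
  have C: "\<bar>G (x0 + t) - F (x0 + t)\<bar> \<le> m * t / 4" "\<bar>G (x0 - t) - F (x0 - t)\<bar> \<le> m * t / 4"
    by (rule close, use x0 t in simp)+
  show up: "p < G (x0 + t)" and lo: "G (x0 - t) < p"
    using T C Kt mt mt0 x0(1) by linarith+
  have "quantile G p \<le> x0 + t"
  proof (rule quantile_le)
    fix x assume "p \<le> G x"
    then have "\<not> x \<le> x0 - t" using monoD[OF G, of x "x0 - t"] lo by auto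
    then show "x0 - t \<le> x" by simp
  qed (use up in simp)
  moreover have "x0 - t \<le> quantile G p" by (rule quantile_ge[OF G lo less_imp_le[OF up]])
  ultimately show "\<bar>quantile G p - x0\<bar> \<le> t" by (simp add: abs_le_iff)
qed

text \<open>G may jump at its quantile and miss p. Its value there lies between those at distance s
  on either side, which differ by at most D plus an increment of F; a second D carries the error of
  G from the quantile to x0.\<close>

lemma quantile_linearization:
  assumes r: "0 < r" "r \<le> 1 / 2" and near: "\<bar>quantile G p - x0\<bar> \<le> r"
    and bounds: "G (x0 - 1 / 2) < p" "p < G (x0 + 1 / 2)"
    and osc: "\<And>x y. x \<in> {A..B} \<Longrightarrow> y \<in> {A..B} \<Longrightarrow> \<bar>x - y\<bar> \<le> r \<Longrightarrow> \<bar>(G x - F x) - (G y - F y)\<bar> \<le> D"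
    and F_lip: "\<And>x y. \<bar>F x - F y\<bar> \<le> K * \<bar>x - y\<bar>"
    and s: "0 < s" "2 * s \<le> r"
  shows "\<bar>quantile G p - x0 - (p - G x0) / f x0\<bar> \<le> (2 * D + K * r\<^sup>2 + 2 * K * s) / m"
proof -
  define \<eta> where "\<eta> = quantile G p"
  have \<eta>: "\<bar>\<eta> - x0\<bar> \<le> r" using near by (simp add: \<eta>_def)
  have in_AB: "z \<in> {A..B}" if "\<bar>z - \<eta>\<bar> \<le> s" for z using that \<eta> r s x0 by auto
  \<comment> \<open>Otherwise the infimum would be smaller. \<open>bounds\<close> makes the set
    nonempty and bounded below.\<close>
  have below: "G (\<eta> - s) < p"
  proof (rule ccontr)
    assume "\<not> G (\<eta> - s) < p"
    then have "quantile G p \<le> \<eta> - s"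
    proof (intro quantile_le)
      fix x assume "p \<le> G x"
      then have "\<not> x \<le> x0 - 1 / 2" using monoD[OF G, of x "x0 - 1 / 2"] bounds by auto
      then show "x0 - 1 / 2 \<le> x" by simp
    qed simp
    then show False using s by (simp add: \<eta>_def)
  qed
  have above: "p \<le> G (\<eta> + s)"
  proof (rule ccontr)
    assume "\<not> p \<le> G (\<eta> + s)"
    then have "\<eta> + s \<le> quantile G p"
      by (intro quantile_ge[OF G _ less_imp_le[OF bounds(2)]]) simp
    then show False using s by (simp add: \<eta>_def)
  qed
  have "\<bar>G \<eta> - p\<bar> \<le> G (\<eta> + s) - G (\<eta> - s)"
    using below above monoD[OF G, of "\<eta> - s" \<eta>] monoD[OF G, of \<eta> "\<eta> + s"] s by auto
  also have "\<dots> \<le> D + K * (2 * s)"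
    using osc[of "\<eta> + s" "\<eta> - s"] in_AB[of "\<eta> + s"] in_AB[of "\<eta> - s"] F_lip[of "\<eta> + s" "\<eta> - s"] s by auto
  finally have G\<eta>: "\<bar>G \<eta> - p\<bar> \<le> D + K * (2 * s)" .
  have osc\<eta>: "\<bar>(G \<eta> - F \<eta>) - (G x0 - F x0)\<bar> \<le> D"
    by (rule osc) (use in_AB[of \<eta>] s x0 \<eta> in auto)
  have "\<bar>F \<eta> - F x0 - (\<eta> - x0) * f x0\<bar> \<le> K * (\<eta> - x0)\<^sup>2"
    using bdd_lip_taylor[OF F' f, of x0 "\<eta> - x0"] by simp
  also have "\<dots> \<le> K * r\<^sup>2"
    using \<eta> r bdd_lipD(3)[OF f] by (intro mult_left_mono) (auto simp: abs_le_square_iff[symmetric])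
  finally have lin: "\<bar>F \<eta> - F x0 - (\<eta> - x0) * f x0\<bar> \<le> K * r\<^sup>2" .
  have num: "\<bar>(\<eta> - x0) * f x0 - (p - G x0)\<bar> \<le> 2 * D + K * r\<^sup>2 + 2 * K * s"
    using G\<eta> osc\<eta> lin x0(1) by linarith
  have f0: "0 < f x0" using m by linarith
  have "\<bar>\<eta> - x0 - (p - G x0) / f x0\<bar> = \<bar>(\<eta> - x0) * f x0 - (p - G x0)\<bar> / f x0"
  proof -
    have "\<eta> - x0 - (p - G x0) / f x0 = ((\<eta> - x0) * f x0 - (p - G x0)) / f x0"
      using f0 by (simp add: field_simps)
    then show ?thesis using f0 by simp
  qed
  also have "\<dots> \<le> (2 * D + K * r\<^sup>2 + 2 * K * s) / f x0"
    using num f0 by (intro divide_right_mono) auto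
  also have "\<dots> \<le> (2 * D + K * r\<^sup>2 + 2 * K * s) / m"
    using m f0 num by (intro divide_left_mono) auto
  finally show ?thesis by (simp add: \<eta>_def)
qed

end

text \<open>The argument on a single path, with nothing random left: closeness locates the quantile
  within r n, and the oscillation bound at this distance gives the linearization.\<close>

lemma bahadur_asymptotics:
  fixes F f :: "real \<Rightarrow> real" and G :: "nat \<Rightarrow> real \<Rightarrow> real" and \<xi> :: "real \<Rightarrow> real" and A B K m C q :: real
  assumes q: "2 \<le> q" and F': "\<And>x. (F has_real_derivative f x) (at x)" and f: "bdd_lip K f" and F: "bdd_lip K F"
    and G: "\<And>n. mono (G n)" and m: "0 < m"
    and \<xi>: "\<And>p. p \<in> P \<Longrightarrow> F (\<xi> p) = p" "\<And>p. p \<in> P \<Longrightarrow> A + 1 \<le> \<xi> p" "\<And>p. p \<in> P \<Longrightarrow> \<xi> p \<le> B - 1" "\<And>p. p \<in> P \<Longrightarrow> m \<le> f (\<xi> p)"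
    and close: "\<And>e. 0 < e \<Longrightarrow> \<forall>\<^sub>F n in sequentially. \<forall>x\<in>{A..B}. \<bar>G n x - F x\<bar> \<le> e * (iota_rate q n / sqrt (real n))"
    and C: "0 \<le> C" and osc: "\<forall>\<^sub>F n in sequentially. \<forall>x\<in>{A..B}. \<forall>y\<in>{A..B}. \<bar>x - y\<bar> \<le> iota_rate q n / sqrt (real n) \<longrightarrow>
      \<bar>(G n x - F x) - (G n y - F y)\<bar> \<le> C * bahadur_rate q n"
  shows "\<And>e. 0 < e \<Longrightarrow> \<forall>\<^sub>F n in sequentially. \<forall>p\<in>P. \<bar>quantile (G n) p - \<xi> p\<bar> \<le> e * (iota_rate q n / sqrt (real n))"
    and "\<forall>\<^sub>F n in sequentially. \<forall>p\<in>P. \<bar>quantile (G n) p - \<xi> p - (p - G n (\<xi> p)) / f (\<xi> p)\<bar> \<le> ((2 * C + 3 * K) / m) * bahadur_rate q n"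
proof -
  define r where "r n = iota_rate q n / sqrt (real n)" for n
  have r0: "r \<longlonglongrightarrow> 0" unfolding r_def by (rule rate_facts(2)[OF q])
  have K: "0 \<le> K" by (rule bdd_lipD(3)[OF f])
  have rpos: "\<forall>\<^sub>F n in sequentially. 0 < r n"
    using rate_facts(1)[OF q] by eventually_elim (auto simp: r_def)
  show q_close: "\<forall>\<^sub>F n in sequentially. \<forall>p\<in>P. \<bar>quantile (G n) p - \<xi> p\<bar> \<le> e * (iota_rate q n / sqrt (real n))" if e: "0 < e" for e
  proof -
    \<comment> \<open>Every t up to d satisfies the condition K * t \<le> m / 4 of
      \<open>quantile_close\<close>; K + 1 avoids division by zero.\<close>
    define d where "d = min 1 (m / 4 / (K + 1))"
    have d: "0 < d" "d \<le> 1" "K * d \<le> m / 4"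
    proof -
      show "0 < d" "d \<le> 1" using m K by (auto simp: d_def)
      have "K * d \<le> (K + 1) * (m / 4 / (K + 1))" using m K by (intro mult_mono) (auto simp: d_def)
      also have "\<dots> = m / 4" using K nonzero_eq_divide_eq[of "K + 1" "m / 4 / (K + 1)" "m / 4"] by (simp only: mult.commute) simp
      finally show "K * d \<le> m / 4" .
    qed
    have "(\<lambda>n. e * r n) \<longlonglongrightarrow> 0" using tendsto_mult_left[OF r0, of e] by simp
    then have small: "\<forall>\<^sub>F n in sequentially. e * r n < d" by (rule order_tendstoD(2)) (rule d(1))
    have "\<forall>\<^sub>F n in sequentially. \<forall>x\<in>{A..B}. \<bar>G n x - F x\<bar> \<le> (m * e / 4) * (iota_rate q n / sqrt (real n))"
      using close[of "m * e / 4"] m e by simp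
    with small rpos show ?thesis
    proof eventually_elim
      case (elim n)
      show ?case
      proof
        fix p assume p: "p \<in> P"
        have "K * (e * r n) \<le> K * d" using elim K by (intro mult_left_mono) auto
        then have Kr: "K * (e * r n) \<le> m / 4" using d by linarith
        have "\<bar>quantile (G n) p - \<xi> p\<bar> \<le> e * r n"
        proof (rule quantile_close(1)[OF F' f G \<xi>(1)[OF p] \<xi>(2)[OF p] \<xi>(3)[OF p] m \<xi>(4)[OF p] _ _ Kr])
          show "0 < e * r n" using elim e by simp
          show "e * r n \<le> 1" using elim d by linarith
          show "\<bar>G n x - F x\<bar> \<le> m * (e * r n) / 4" if "x \<in> {A..B}" for x
            using bspec[OF elim(3) that] unfolding r_def[symmetric] by (simp add: mult_ac)
        qed
        then show "\<bar>quantile (G n) p - \<xi> p\<bar> \<le> e * (iota_rate q n / sqrt (real n))" by (simp add: r_def)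
      qed
    qed
  qed
  show "\<forall>\<^sub>F n in sequentially. \<forall>p\<in>P. \<bar>quantile (G n) p - \<xi> p - (p - G n (\<xi> p)) / f (\<xi> p)\<bar> \<le> ((2 * C + 3 * K) / m) * bahadur_rate q n"
  proof -
    \<comment> \<open>A fixed distance at which G n brackets p for large n; monotonicity extends the
      bracket to distance 1 / 2.\<close>
    define t where "t = min (1 / 2) (m / 4 / (K + 1))"
    have t: "0 < t" "t \<le> 1 / 2" "K * t \<le> m / 4"
    proof -
      show "0 < t" using m K by (auto simp: t_def)
      show "t \<le> 1 / 2" by (simp only: t_def min.cobounded1)
      have "K * t \<le> (K + 1) * (m / 4 / (K + 1))" using m K by (intro mult_mono) (auto simp: t_def)
      also have "\<dots> = m / 4" using K nonzero_eq_divide_eq[of "K + 1" "m / 4 / (K + 1)" "m / 4"] by (simp only: mult.commute) simp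
      finally show "K * t \<le> m / 4" .
    qed
    have small: "\<forall>\<^sub>F n in sequentially. r n < t" using r0 t(1) by (rule order_tendstoD(2))
    have c1: "\<forall>\<^sub>F n in sequentially. \<forall>x\<in>{A..B}. \<bar>G n x - F x\<bar> \<le> (m / 4) * (iota_rate q n / sqrt (real n))"
      using close[of "m / 4"] m by simp
    have two: "\<forall>\<^sub>F n in sequentially. 2 \<le> sqrt (real n)" by real_asymp
    show ?thesis
      using small c1 q_close[OF zero_less_one] osc rpos rate_facts(1)[OF q] two
    proof eventually_elim
      case (elim n)
      define D where "D = C * bahadur_rate q n"
      have n: "0 < real n" and i: "1 \<le> iota_rate q n" and w: "(iota_rate q n)\<^sup>2 / real n \<le> bahadur_rate q n" using elim by auto
      have r2: "(r n)\<^sup>2 \<le> bahadur_rate q n" using w n by (simp add: r_def power_divide)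
      have s1: "1 / real n \<le> bahadur_rate q n"
      proof -
        have "1 / real n \<le> (iota_rate q n)\<^sup>2 / real n" using i n by (intro divide_right_mono) auto
        then show ?thesis using w by linarith
      qed
      \<comment> \<open>The linearization is used with s = 1 / n, small enough to fit twice into r n
        and to stay below the Bahadur rate.\<close>
      have s2: "2 * (1 / real n) \<le> r n"
      proof -
        have "2 * (1 / real n) = (2 / sqrt (real n)) / sqrt (real n)" using n by simp
        also have "\<dots> \<le> iota_rate q n / sqrt (real n)"
        proof (rule divide_right_mono)
          have "2 / sqrt (real n) \<le> 1" using elim n by simp
          then show "2 / sqrt (real n) \<le> iota_rate q n" using i by linarith
        qed simp
        finally show ?thesis by (simp add: r_def)
      qed
      show ?case
      proof
        fix p assume p: "p \<in> P"
        note prem = F' f G \<xi>(1)[OF p] \<xi>(2)[OF p] \<xi>(3)[OF p] m \<xi>(4)[OF p]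
        have cl: "\<bar>G n x - F x\<bar> \<le> m * t / 4" if "x \<in> {A..B}" for x
        proof -
          have "\<bar>G n x - F x\<bar> \<le> (m / 4) * r n" using elim that by (simp add: r_def)
          also have "\<dots> \<le> (m / 4) * t" using elim m by (intro mult_left_mono) auto
          finally show ?thesis by simp
        qed
        have b: "G n (\<xi> p - t) < p" "p < G n (\<xi> p + t)"
          using t by (intro quantile_close(2,3)[OF prem] cl; simp)+
        have "\<bar>quantile (G n) p - \<xi> p - (p - G n (\<xi> p)) / f (\<xi> p)\<bar> \<le> (2 * D + K * (r n)\<^sup>2 + 2 * K * (1 / real n)) / m"
        proof (rule quantile_linearization[OF prem])
          show "\<bar>quantile (G n) p - \<xi> p\<bar> \<le> r n" using elim p by (simp add: r_def)
          show "G n (\<xi> p - 1 / 2) < p" using monoD[OF G, of "\<xi> p - 1 / 2" "\<xi> p - t" n] b t by auto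
          show "p < G n (\<xi> p + 1 / 2)" using monoD[OF G, of "\<xi> p + t" "\<xi> p + 1 / 2" n] b t by auto
          show "\<bar>(G n x - F x) - (G n y - F y)\<bar> \<le> D" if "x \<in> {A..B}" "y \<in> {A..B}" "\<bar>x - y\<bar> \<le> r n" for x y
            using elim that unfolding D_def r_def by blast
          show "\<bar>F x - F y\<bar> \<le> K * \<bar>x - y\<bar>" for x y by (rule bdd_lipD(2)[OF F])
        qed (use elim t n s2 in auto)
        also have "\<dots> \<le> (2 * D + K * bahadur_rate q n + 2 * K * bahadur_rate q n) / m"
          using r2 s1 K m by (intro divide_right_mono add_mono mult_left_mono) auto
        also have "\<dots> = ((2 * C + 3 * K) / m) * bahadur_rate q n"
          by (simp add: D_def algebra_simps add_divide_distrib)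
        finally show "\<bar>quantile (G n) p - \<xi> p - (p - G n (\<xi> p)) / f (\<xi> p)\<bar> \<le> ((2 * C + 3 * K) / m) * bahadur_rate q n" .
      qed
    qed
  qed
qed

lemma quantile_mono:
  assumes "p \<le> p'" "p' \<le> G u" "\<And>x. p \<le> G x \<Longrightarrow> l \<le> x"
  shows "quantile G p \<le> quantile G p'"
  unfolding quantile_def
  by (rule cInf_superset_mono) (use assms in \<open>auto simp: bdd_below_def intro: order_trans\<close>)

text \<open>By continuity the set is closed and contains its infimum, and the intermediate value
  theorem provides a point with value exactly p. The last two claims are the witnesses for
  nonemptiness and a lower bound.\<close>

lemma (in real_distribution) cdf_quantile:
  assumes cont: "continuous_on UNIV (cdf M)" and p: "0 < p" "p < 1"
  shows "cdf M (quantile (cdf M) p) = p" "\<exists>u. p \<le> cdf M u" "\<exists>l. \<forall>x. p \<le> cdf M x \<longrightarrow> l \<le> x"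
proof -
  have "\<forall>\<^sub>F x in at_top. p < cdf M x"
    using cdf_lim_at_top_prob p(2) by (rule order_tendstoD(1))
  then obtain u where u: "p < cdf M u" unfolding eventually_at_top_linorder by blast
  have "\<forall>\<^sub>F x in at_bot. cdf M x < p"
    using cdf_lim_at_bot p(1) by (rule order_tendstoD(2))
  then obtain l where l: "cdf M l < p" unfolding eventually_at_bot_linorder by blast
  have lower: "l \<le> x" if "p \<le> cdf M x" for x
    using cdf_nondecreasing[of x l] l that by (cases "l \<le> x") auto
  show "\<exists>u. p \<le> cdf M u" "\<exists>l. \<forall>x. p \<le> cdf M x \<longrightarrow> l \<le> x"
    using u lower by (auto intro: less_imp_le)
  have "l \<le> u" using lower[of u] u by simp
  then obtain z where z: "cdf M z = p"
    using IVT'[of "cdf M" l p u] l u continuous_on_subset[OF cont] by auto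
  have "closed {x. p \<le> cdf M x}"
    by (intro closed_Collect_le continuous_on_const cont)
  then have "quantile (cdf M) p \<in> {x. p \<le> cdf M x}"
    unfolding quantile_def by (rule closed_contains_Inf[rotated 2]) (use z lower in \<open>auto simp: bdd_below_def\<close>)
  moreover have "quantile (cdf M) p \<le> z" by (rule quantile_le[OF lower]) (use z in auto)
  then have "cdf M (quantile (cdf M) p) \<le> p" using cdf_nondecreasing[of "quantile (cdf M) p" z] z by simp
  ultimately show "cdf M (quantile (cdf M) p) = p" by simp
qed

lemma abs_SUP_abs_le:
  fixes h :: "'b \<Rightarrow> real"
  assumes "P \<noteq> {}" "\<And>p. p \<in> P \<Longrightarrow> \<bar>h p\<bar> \<le> c"
  shows "\<bar>SUP p\<in>P. \<bar>h p\<bar>\<bar> \<le> c"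
proof -
  obtain p where p: "p \<in> P" using assms(1) by auto
  have "bdd_above ((\<lambda>p. \<bar>h p\<bar>) ` P)" using assms(2) by (auto simp: bdd_above_def)
  then have "\<bar>h p\<bar> \<le> (SUP p\<in>P. \<bar>h p\<bar>)" using p by (rule cSUP_upper[rotated])
  moreover have "(SUP p\<in>P. \<bar>h p\<bar>) \<le> c" using assms by (intro cSUP_least)
  ultimately show ?thesis by linarith
qed

lemma empirical_cdf_mono: "mono (empirical_cdf X n \<omega>)"
  unfolding empirical_cdf_def by (intro monoI divide_right_mono sum_mono) auto

theorem theorem2:
  fixes M :: "'a measure" and \<epsilon> :: "int \<Rightarrow> 'a \<Rightarrow> real" and f\<epsilon> :: "real \<Rightarrow> real"
    and a :: "nat \<Rightarrow> real" and X :: "int \<Rightarrow> 'a \<Rightarrow> real" and F f :: "real \<Rightarrow> real"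
    and p0 p1 \<alpha> q :: real
  assumes "prob_space M"
    and "prob_space.indep_vars M (\<lambda>_. borel) \<epsilon> UNIV"
    and "\<And>k. distributed M lborel (\<epsilon> k) (\<lambda>x. ennreal (f\<epsilon> x))"
    and "\<And>x. 0 \<le> f\<epsilon> x"
    and "\<And>x. f\<epsilon> differentiable at x"
    and "\<And>x. deriv f\<epsilon> differentiable at x"
    and "a 0 = 1"
    and "\<And>k. AE \<omega> in M. summable (\<lambda>i. a i * \<epsilon> (k - int i) \<omega>)"
    and X: "X = linear_process a \<epsilon>"
    and F: "F = cdf (distr M borel (X 0))"
    and f: "f = pdf_of M (X 0)"
    and "bdd_above (range (\<lambda>x. f\<epsilon> x + \<bar>deriv f\<epsilon> x\<bar>))"
    and "0 < p0" and "p0 < p1" and "p1 < 1"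
    and "0 < (INF p\<in>{p0..p1}. f (quantile F p))"
    and "bdd_above (range (\<lambda>x. \<bar>deriv (deriv f\<epsilon>) x\<bar>))"
    and "0 < \<alpha>" and "2 \<le> q"
    and "\<And>k. integrable M (\<lambda>\<omega>. \<bar>\<epsilon> k \<omega>\<bar> powr \<alpha>)"
    and "summable (\<lambda>i. \<bar>a (Suc i)\<bar> powr min (\<alpha> / q) 1)"
  shows
    "small_o_as M
       (\<lambda>n \<omega>. SUP p\<in>{p0..p1}. \<bar>quantile (empirical_cdf X n \<omega>) p - quantile F p\<bar>)
       (\<lambda>n. iota_rate q n / sqrt (real n)) \<and>
     big_O_as M
       (\<lambda>n \<omega>. SUP p\<in>{p0..p1}.
          \<bar>quantile (empirical_cdf X n \<omega>) p - quantile F p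
            - (p - empirical_cdf X n \<omega> (quantile F p)) / f (quantile F p)\<bar>)
       (\<lambda>n. real n powr (-3/4) * (iota_rate q n * ln (real n)) powr (1/2))"
proof -
  interpret prob_space M by fact
  note dist = assms(3) and summable_X = assms(8) and p = assms(13-15) and inf_pos = assms(16)
    and \<alpha> = assms(18) and q = assms(19)
  define \<mu> where "\<mu> = distr M borel (\<epsilon> 0)"
  define b where "b i = a (Suc i)" for i
  have eps [measurable]: "\<epsilon> k \<in> borel_measurable M" for k
    using distributed_measurable[OF dist[of k]] by simp
  have distr_eps: "distr M borel (\<epsilon> k) = \<mu>" for k
  proof -
    have "distr M borel (\<epsilon> j) = density lborel (\<lambda>x. ennreal (f\<epsilon> x))" for j
      using distributed_distr_eq_density[OF dist[of j]] by (metis distr_cong sets_lborel)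
    then show ?thesis by (simp add: \<mu>_def)
  qed
  have df: "(f\<epsilon> has_real_derivative deriv f\<epsilon> x) (at x)" "(deriv f\<epsilon> has_real_derivative deriv (deriv f\<epsilon>) x) (at x)" for x
    using assms(5,6) by (simp_all add: DERIV_deriv_iff_real_differentiable)
  have cont: "continuous_on UNIV f\<epsilon>"
    using df(1) by (intro continuous_at_imp_continuous_on ballI) (rule DERIV_isCont)
  have dF: "(cdf \<mu> has_real_derivative f\<epsilon> x) (at x)" for x
    unfolding \<mu>_def by (rule pdf_of_eq_continuous_density(1)[OF assms(1) dist assms(4) cont])
  obtain C1 where C1: "\<And>x. f\<epsilon> x + \<bar>deriv f\<epsilon> x\<bar> \<le> C1" using assms(12) by (auto simp: bdd_above_def)
  obtain C2 where C2: "\<And>x. \<bar>deriv (deriv f\<epsilon>) x\<bar> \<le> C2" using assms(17) by (auto simp: bdd_above_def)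
  \<comment> \<open>One constant for the distribution function, the density and its derivative. It
    is at least 1 to bound the former and to serve as c.\<close>
  define K where "K = max 1 (max C1 C2)"
  have K1: "1 \<le> K" by (simp add: K_def)
  have bound: "\<bar>f\<epsilon> x\<bar> \<le> K" "\<bar>deriv f\<epsilon> x\<bar> \<le> K" "\<bar>deriv (deriv f\<epsilon>) x\<bar> \<le> K" for x
    using C1[of x] C2[of x] assms(4)[of x] by (auto simp: K_def)
  interpret D: real_distribution \<mu>
    unfolding \<mu>_def by (rule real_distribution_distr) simp
  have cdf_bound: "\<bar>cdf \<mu> x\<bar> \<le> K" for x
    using D.cdf_nonneg[of x] D.cdf_bounded_prob[of x] K1 by simp
  have lip: "bdd_lip K (cdf \<mu>)" "bdd_lip K f\<epsilon>" "bdd_lip K (deriv f\<epsilon>)"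
    by (rule bdd_lip_of_deriv[OF dF bound(1) cdf_bound] bdd_lip_of_deriv[OF df(1) bound(2,1)]
        bdd_lip_of_deriv[OF df(2) bound(3,2)])+
  have summable_b: "AE \<omega> in M. summable (\<lambda>i. b i * \<epsilon> (k - int i) \<omega>)" for k
    using summable_X[of "k + 1"]
  proof eventually_elim
    case (elim \<omega>)
    then have "summable (\<lambda>i. a (Suc i) * \<epsilon> (k + 1 - int (Suc i)) \<omega>)" by (subst summable_Suc_iff)
    then show ?case by (simp add: b_def)
  qed
  interpret bounded_density_noise M \<epsilon> \<mu> b \<alpha> q K
  proof unfold_locales
    show "indep_vars (\<lambda>_. borel) \<epsilon> UNIV" by fact
    show "integrable \<mu> (\<lambda>e. \<bar>e\<bar> powr \<alpha>)"
      unfolding \<mu>_def using assms(20)[of 0] by (subst integrable_distr_eq) auto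
    show "summable (\<lambda>i. \<bar>b i\<bar> powr min (\<alpha> / q) 1)" using assms(21) by (simp add: b_def)
    show "cdf \<mu> y - cdf \<mu> x \<le> K * (y - x)" if "x \<le> y" for x y
      using bdd_lipD(2)[OF lip(1), of y x] that by simp
  qed (rule distr_eps \<alpha> q summable_b K1)+
  have X_eq: "AE \<omega> in M. X (k + 1) \<omega> = \<epsilon> (k + 1) \<omega> + tail k 0 \<omega>" for k
    using summable_X[of "k + 1"]
  proof eventually_elim
    case (elim \<omega>)
    show ?case
      using suminf_split_head[OF elim] assms(7) by (simp add: X linear_process_def tail_def b_def)
  qed
  have X_meas: "X k \<in> borel_measurable M" for k
    unfolding X linear_process_def by measurable
  have F_eq: "F x = pred_mean (\<lambda>t. cdf \<mu> (x - t))" for x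
  proof -
    have "F x = prob (X 0 -` {..x} \<inter> space M)"
      unfolding F cdf_def using X_meas by (subst measure_distr) auto
    also have "\<dots> = (\<integral>\<omega>. indicator {..x} (X 0 \<omega>) \<partial>M)"
    proof -
      have "(\<integral>\<omega>. indicator {..x} (X 0 \<omega>) \<partial>M) = (\<integral>\<omega>. indicator (X 0 -` {..x} \<inter> space M) \<omega> \<partial>M :: real)"
        by (rule Bochner_Integration.integral_cong) (auto simp: indicator_def)
      then show ?thesis by simp
    qed
    \<comment> \<open>Time 0 appears as - 1 + 1 because the predictable part of X at time k + 1 is
      \<open>tail k 0\<close>.\<close>
    also have "\<dots> = (\<integral>\<omega>. indicator {..x} (\<epsilon> (- 1 + 1) \<omega> + tail (- 1) 0 \<omega>) \<partial>M)"
    proof (rule integral_cong_AE)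
      show "AE \<omega> in M. indicator {..x} (X 0 \<omega>) = (indicator {..x} (\<epsilon> (- 1 + 1) \<omega> + tail (- 1) 0 \<omega>) :: real)"
        using X_eq[of "- 1"] by eventually_elim simp
    qed (use X_meas in measurable)
    also have "\<dots> = pred_mean (\<lambda>t. cdf \<mu> (x - t))" by (rule expectation_indicator_obs[OF lip(1)])
    finally show ?thesis .
  qed
  have F_eq': "F = (\<lambda>x. pred_mean (\<lambda>t. cdf \<mu> (x - t)))" using F_eq by (rule ext)
  have f_eq: "f x = pred_mean (\<lambda>t. f\<epsilon> (x - t))" and F': "(F has_real_derivative f x) (at x)" for x
  proof -
    have d: "(F has_real_derivative pred_mean (\<lambda>t. f\<epsilon> (x - t))) (at x)"
      unfolding F_eq' by (rule pred_mean_deriv[OF dF lip(1,2)])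
    then show "f x = pred_mean (\<lambda>t. f\<epsilon> (x - t))"
      unfolding f pdf_of_def F[symmetric] by (rule DERIV_imp_deriv)
    with d show "(F has_real_derivative f x) (at x)" by simp
  qed
  have f_lip: "bdd_lip K f" using bdd_lip_pred_mean[OF lip(2)] f_eq by (simp add: bdd_lip_def)
  have F_lip: "bdd_lip K F" unfolding F_eq' by (rule bdd_lip_pred_mean[OF lip(1)])
  interpret DX: real_distribution "distr M borel (X 0)"
    by (rule real_distribution_distr) (rule X_meas)
  have F_cont: "continuous_on UNIV F"
    using F' by (intro continuous_at_imp_continuous_on ballI) (rule DERIV_isCont)
  note F_quantile = DX.cdf_quantile[folded F, OF F_cont]
  \<comment> \<open>A margin of 1 on either side keeps the neighbourhoods of all quantiles inside
    the interval and makes its length at least 2.\<close>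
  define A where "A = quantile F p0 - 1"
  define B where "B = quantile F p1 + 1"
  have \<xi>_mono: "quantile F s \<le> quantile F t" if st: "p0 \<le> s" "s \<le> t" "t \<le> p1" for s t
  proof -
    obtain u where "t \<le> F u" using F_quantile(2)[of t] p st by auto
    moreover obtain l where "\<forall>x. s \<le> F x \<longrightarrow> l \<le> x" using F_quantile(3)[of s] p st by auto
    ultimately show ?thesis using st by (intro quantile_mono[where u = u and l = l]) auto
  qed
  have AB: "2 \<le> B - A" using \<xi>_mono[of p0 p1] p by (simp add: A_def B_def)
  define m where "m = (INF p\<in>{p0..p1}. f (quantile F p))"
  have m: "0 < m" using inf_pos by (simp add: m_def)
  have mf: "m \<le> f (quantile F s)" if "s \<in> {p0..p1}" for s
    unfolding m_def
  proof (rule cINF_lower[OF _ that])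
    have "- K \<le> f (quantile F t)" for t using bdd_lipD(1)[OF f_lip, of "quantile F t"] by simp
    then show "bdd_below ((\<lambda>p. f (quantile F p)) ` {p0..p1})" by (auto simp: bdd_below_def)
  qed
  define E where "E n \<omega> s = quantile (empirical_cdf X n \<omega>) s - quantile F s" for n \<omega> s
  define R where "R n \<omega> s = E n \<omega> s - (s - empirical_cdf X n \<omega> (quantile F s)) / f (quantile F s)" for n \<omega> s
  have ne: "{p0..p1} \<noteq> {}" using p by simp
  have obs_eq: "AE \<omega> in M. \<forall>k. X (int k + 1) \<omega> = obs k \<omega>"
    unfolding AE_all_countable obs_def using X_eq by blast
  have "AE \<omega> in M.
      (\<forall>e>0. \<forall>\<^sub>F n in sequentially. \<forall>s\<in>{p0..p1}. \<bar>E n \<omega> s\<bar> \<le> e * (iota_rate q n / sqrt (real n))) \<and>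
      (\<exists>C. \<forall>\<^sub>F n in sequentially. \<forall>s\<in>{p0..p1}. \<bar>R n \<omega> s\<bar> \<le> C * bahadur_rate q n)"
    using empirical_rates[OF AB dF df(1) lip] obs_eq
  proof eventually_elim
    case (elim \<omega>)
    have G: "(\<Sum>k<n. indicator {..x} (obs k \<omega>)) / real n = empirical_cdf X n \<omega> x" for n x
    proof -
      have "(\<Sum>i = 1..n. if X (int i) \<omega> \<le> x then 1 else 0) = (\<Sum>k<n. indicator {..x} (obs k \<omega>) :: real)"
        unfolding One_nat_def sum.atLeast1_atMost_eq
      proof (rule sum.cong)
        fix k
        have "X (int (Suc k)) \<omega> = obs k \<omega>" using elim(2) by (simp add: add.commute)
        then show "(if X (int (Suc k)) \<omega> \<le> x then 1 else 0) = (indicator {..x} (obs k \<omega>) :: real)"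
          by (simp add: indicator_def)
      qed simp
      then show ?thesis by (simp add: empirical_cdf_def)
    qed
    obtain C where C: "0 \<le> C"
      and osc: "\<forall>\<^sub>F n in sequentially. \<forall>x\<in>{A..B}. \<forall>y\<in>{A..B}. \<bar>x - y\<bar> \<le> iota_rate q n / sqrt (real n) \<longrightarrow>
        \<bar>(empirical_cdf X n \<omega> x - F x) - (empirical_cdf X n \<omega> y - F y)\<bar> \<le> C * bahadur_rate q n"
      using elim(1) unfolding G F_eq by blast
    have close: "\<forall>\<^sub>F n in sequentially. \<forall>x\<in>{A..B}. \<bar>empirical_cdf X n \<omega> x - F x\<bar> \<le> e * (iota_rate q n / sqrt (real n))"
      if "0 < e" for e
      using elim(1) that unfolding G F_eq by blast
    have \<xi>: "F (quantile F s) = s" "A + 1 \<le> quantile F s" "quantile F s \<le> B - 1" if "s \<in> {p0..p1}" for s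
      using F_quantile(1)[of s] \<xi>_mono[of p0 s] \<xi>_mono[of s p1] that p by (auto simp: A_def B_def)
    note asym = bahadur_asymptotics[OF q F' f_lip F_lip empirical_cdf_mono m \<xi> mf close C osc]
    show ?case unfolding R_def E_def using asym by blast
  qed
  then have "AE \<omega> in M.
      (\<lambda>n. (SUP p\<in>{p0..p1}. \<bar>E n \<omega> p\<bar>) / (iota_rate q n / sqrt (real n))) \<longlonglongrightarrow> 0 \<and>
      Bseq (\<lambda>n. (SUP p\<in>{p0..p1}. \<bar>R n \<omega> p\<bar>) / bahadur_rate q n)"
  proof eventually_elim
    case (elim \<omega>)
    show ?case
    proof
      show "(\<lambda>n. (SUP p\<in>{p0..p1}. \<bar>E n \<omega> p\<bar>) / (iota_rate q n / sqrt (real n))) \<longlonglongrightarrow> 0"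
      proof (rule tendstoI)
        fix e :: real assume e: "0 < e"
        then have "\<forall>\<^sub>F n in sequentially. \<forall>s\<in>{p0..p1}. \<bar>E n \<omega> s\<bar> \<le> (e / 2) * (iota_rate q n / sqrt (real n))"
          using conjunct1[OF elim] half_gt_zero by blast
        then show "\<forall>\<^sub>F n in sequentially. dist ((SUP p\<in>{p0..p1}. \<bar>E n \<omega> p\<bar>) / (iota_rate q n / sqrt (real n))) 0 < e"
          using rate_facts(1)[OF q]
        proof eventually_elim
          case (elim n)
          define r where "r = iota_rate q n / sqrt (real n)"
          have r: "0 < r" using elim by (auto simp: r_def)
          have "\<bar>SUP p\<in>{p0..p1}. \<bar>E n \<omega> p\<bar>\<bar> \<le> (e / 2) * r"
            by (rule abs_SUP_abs_le[OF ne]) (use elim in \<open>auto simp: r_def\<close>)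
          also have "\<dots> < e * r" using r e by simp
          finally have "\<bar>SUP p\<in>{p0..p1}. \<bar>E n \<omega> p\<bar>\<bar> / r < e"
            using r by (simp add: pos_divide_less_eq)
          then show ?case using r e by (simp add: r_def[symmetric])
        qed
      qed
      obtain C where "\<forall>\<^sub>F n in sequentially. \<forall>s\<in>{p0..p1}. \<bar>R n \<omega> s\<bar> \<le> C * bahadur_rate q n"
        using elim by blast
      then have "\<forall>\<^sub>F n in sequentially. norm ((SUP p\<in>{p0..p1}. \<bar>R n \<omega> p\<bar>) / bahadur_rate q n) \<le> norm C"
        using rate_facts(1)[OF q]
      proof eventually_elim
        case (elim n)
        have "0 < (iota_rate q n)\<^sup>2 / real n" using elim by (intro divide_pos_pos) auto
        then have w: "0 < bahadur_rate q n" using elim by linarith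
        have "\<bar>SUP p\<in>{p0..p1}. \<bar>R n \<omega> p\<bar>\<bar> \<le> C * bahadur_rate q n"
          by (rule abs_SUP_abs_le[OF ne]) (use elim in auto)
        then have "\<bar>SUP p\<in>{p0..p1}. \<bar>R n \<omega> p\<bar>\<bar> / bahadur_rate q n \<le> C"
          using w by (simp add: pos_divide_le_eq)
        then show ?case using w by simp
      qed
      then show "Bseq (\<lambda>n. (SUP p\<in>{p0..p1}. \<bar>R n \<omega> p\<bar>) / bahadur_rate q n)"
        by (rule Bseq_eventually_mono) (rule Bfun_const)
    qed
  qed
  then show ?thesis
    unfolding small_o_as_def big_O_as_def bahadur_rate_def E_def R_def by (auto elim: eventually_mono)
qed

end
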